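(* Let $\rho$ be a density operator on $h$ with $\mathrm{tr}\,\rho>0$ that commutes with the fermionic parity $e^{i\pi\sum_ia_i^\dagger a_i}$, and let $\rho_0$ denote $\rho$ placed on slice $0$. Define, in $\mathcal K$, $$|\Phi^+\rangle:=\exp\Big(\sum_{t,j}a^\dagger_{tj}\tilde a^\dagger_{tj}\Big)|\Omega\rangle\!\rangle,\qquad |\Psi\rangle:=\rho_0e^{i\tilde{\mathcal S}/2}|\Phi^+\rangle,\qquad |\overline\Psi\rangle:=\big(Pe^{i\tilde{\mathcal S}/2}\big)^\dagger|\Phi^+\rangle,$$ and $$R:=\frac{|\Psi\rangle\langle\overline\Psi|}{\langle\overline\Psi|\Psi\rangle}.$$ Then $R$ is well defined, $R^2=R$, and $\mathrm{Tr}_{\mathcal K}R=1$. Moreover, for all operators $O^{(0)},\dots,O^{(N-1)}$ on $h$, with $O^{(t)}_t$ placed on slice $t$ (acting only on system modes), $$\frac{\mathrm{Tr}\big[P\rho_0e^{i\tilde{\mathcal S}}\prod_tO^{(t)}_t\big]}{\mathrm{Tr}\big[P\rho_0e^{i\tilde{\mathcal S}}\big]}=\mathrm{Tr}_{\mathcal K}\Big[R\prod_tO^{(t)}_t\Big].$$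
   Context: Fix integers $L\ge1$, $N\ge1$, a real $\epsilon>0$, and set $T=\epsilon N$. The space $h$. Let $h$ be the fermionic Fock space of $L$ modes, with vacuum $|0\rangle$, ladder operators $a_i$ satisfying $\{a_i,a_j^\dagger\}=\delta_{ij}$ and $\{a_i,a_j\}=\{a_i^\dagger,a_j^\dagger\}=0$, and trace $\mathrm{tr}$. The space $\mathcal H$. Let $\mathcal H$ be the Fock space generated from a vacuum $|\Omega\rangle$ by $a_{ti}$, $t=0,\dots,N-1$, $i=1,\dots,L$, with $\{a_{ti},a^\dagger_{t'j}\}=\delta_{tt'}\delta_{ij}$ and all other anticommutators zero. The symbol $\mathrm{Tr}$ denotes the trace on $\mathcal H$. Time translations and parity. Set $\omega_n=(2n+1)\pi/T$ and $\hat a_{ni}=N^{-1/2}\sum_te^{i\omega_n\epsilon t}a_{ti}$. Define $$\mathcal P=\sum_{n,j}\omega_n\hat a^\dagger_{nj}\hat a_{nj},\qquad P=\exp\Big(i\pi\sum_{t,i}a^\dagger_{ti}a_{ti}\Big).$$ Placing operators on a slice. For an operator $O$ on $h$, $O_t$ is its image under the unital $*$-homomorphism determined by $a_i\mapsto a_{ti}$. Quantum action. Let $H$ be a time-independent, hermitian, parity-preserving Hamiltonian on $h$ (an even polynomial in the ladder operators), and write $H_t$ for $H$ placed on slice $t$. Define $$e^{i\mathcal S}=e^{i\epsilon\mathcal P}\prod_te^{-i\epsilon H_t},\qquad \mathcal V=\prod_te^{i\epsilon tH_t},$$ $$e^{i\tilde{\mathcal S}}:=e^{iTH_0}e^{i\mathcal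 S}\ \big(=\mathcal V^\dagger e^{i\epsilon\mathcal P}\mathcal V\big),\qquad e^{i\tilde{\mathcal S}/2}:=\mathcal V^\dagger e^{i\epsilon\mathcal P/2}\mathcal V.$$ Environment. Enlarge the system by environment modes $\tilde a_{ti}$. Let $\mathcal K$ be the Fock space on the $2LN$ modes $a_{ti},\tilde a_{ti}$, all satisfying canonical anticommutation relations; modes with different labels anticommute (e.g. $\{a_{ti},\tilde a^\dagger_{t'j}\}=0$). Let $|\Omega\rangle\!\rangle$ be the global vacuum. All operators built from the $a_{ti}$ (including $P$, $\mathcal P$, $H_t$, $\rho_0$, $O_t$) are regarded also as operators on $\mathcal K$ acting trivially on environment modes. $\mathrm{Tr}_{\mathcal K}$ denotes the trace on $\mathcal K$. *)

theory Defs
  imports "Jordan_Normal_Form.Schur_Decomposition"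
begin

text \<open>The Fock space of M fermionic modes is realised on complex 2^M-dimensional
  space; basis vector with index n (n < 2^M) is the occupation configuration given by
  the binary digits of n (bit k = occupation of mode k).  The vacuum is basis vector 0.\<close>

definition fdim :: "nat \<Rightarrow> nat" where "fdim M = 2 ^ M"

definition occ :: "nat \<Rightarrow> nat \<Rightarrow> bool" where
  "occ n k = odd (n div 2 ^ k)"

definition jw_sign :: "nat \<Rightarrow> nat \<Rightarrow> complex" where
  "jw_sign n k = (-1) ^ card {j. j < k \<and> occ n j}"

definition ann :: "nat \<Rightarrow> nat \<Rightarrow> complex mat" where
  "ann M k = mat (fdim M) (fdim M)
     (\<lambda>(r, c). if occ c k \<and> r = c - 2 ^ k then jw_sign c k else 0)"

definition cre :: "nat \<Rightarrow> nat \<Rightarrow> complex mat" where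
  "cre M k = mat_adjoint (ann M k)"

definition vacuum :: "nat \<Rightarrow> complex vec" where
  "vacuum M = unit_vec (fdim M) 0"

definition num_total :: "nat \<Rightarrow> complex mat" where
  "num_total M = foldr (+) (map (\<lambda>k. cre M k * ann M k) [0..<M]) (0\<^sub>m (fdim M) (fdim M))"

definition mtrace :: "complex mat \<Rightarrow> complex" where
  "mtrace A = (\<Sum>i<dim_row A. A $$ (i, i))"

definition mexp :: "complex mat \<Rightarrow> complex mat" where
  "mexp A = mat (dim_row A) (dim_col A)
     (\<lambda>(i, j). \<Sum>k. (A ^\<^sub>m k) $$ (i, j) / of_nat (fact k))"

definition mprod :: "nat \<Rightarrow> complex mat list \<Rightarrow> complex mat" where
  "mprod d As = foldr (*) As (1\<^sub>m d)"

definition msum :: "nat \<Rightarrow> complex mat list \<Rightarrow> complex mat" where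
  "msum d As = foldr (+) As (0\<^sub>m d d)"

definition hermitian :: "complex mat \<Rightarrow> bool" where
  "hermitian A \<longleftrightarrow> mat_adjoint A = A"

definition density_op :: "nat \<Rightarrow> complex mat \<Rightarrow> bool" where
  "density_op d A \<longleftrightarrow> A \<in> carrier_mat d d \<and> hermitian A \<and>
     (\<forall>v \<in> carrier_vec d. 0 \<le> conjugate v \<bullet> (A *\<^sub>v v))"

definition ketbra :: "complex vec \<Rightarrow> complex vec \<Rightarrow> complex mat" where
  "ketbra u w = mat (dim_vec u) (dim_vec w) (\<lambda>(i, j). u $ i * cnj (w $ j))"

definition braket :: "complex vec \<Rightarrow> complex vec \<Rightarrow> complex" where
  "braket w u = conjugate w \<bullet> u"

text \<open>For an injective map f from the M modes into the modes of an M'-mode Fock space,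
  the unique unital *-homomorphism with a_k \<mapsto> a_{f k} is written out explicitly:
  the matrix unit |r><c| of the M-mode space equals
  (a^dag_{k1} ... a^dag_{km}) |0><0| (a_{l_p} ... a_{l_1}) with k1<...<km the occupied modes
  of r, l1<...<lp those of c, and |0><0| = prod_k (1 - a^dag_k a_k).\<close>

definition occ_list :: "nat \<Rightarrow> nat \<Rightarrow> nat list" where
  "occ_list M n = filter (occ n) [0..<M]"

definition mode_hom :: "nat \<Rightarrow> nat \<Rightarrow> (nat \<Rightarrow> nat) \<Rightarrow> complex mat \<Rightarrow> complex mat" where
  "mode_hom M M' f X =
    (let d' = fdim M';
         Q = mprod d' (map (\<lambda>k. 1\<^sub>m d' - cre M' (f k) * ann M' (f k)) [0..<M]);
         Cr = (\<lambda>r. mprod d' (map (\<lambda>k. cre M' (f k)) (occ_list M r)));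
         An = (\<lambda>c. mprod d' (map (\<lambda>k. ann M' (f k)) (rev (occ_list M c))))
     in msum d' (concat (map (\<lambda>r. map (\<lambda>c. X $$ (r, c) \<cdot>\<^sub>m (Cr r * Q * An c))
                    [0..<fdim M]) [0..<fdim M])))"

text \<open>h: L modes.  \<H>: modes a_{ti} with index t*L+i (N*L modes).
  \<K>: system modes a_{ti} with index t*L+i, environment modes \<tilde>a_{ti} with index
  N*L + t*L + i (2*N*L modes).\<close>

definition parity :: "nat \<Rightarrow> complex mat" where
  "parity M = mexp ((\<i> * pi) \<cdot>\<^sub>m num_total M)"

definition slice :: "nat \<Rightarrow> nat \<Rightarrow> nat \<Rightarrow> complex mat \<Rightarrow> complex mat" where
  "slice L N t X = mode_hom L (N * L) (\<lambda>i. t * L + i) X"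

definition toK :: "nat \<Rightarrow> nat \<Rightarrow> complex mat \<Rightarrow> complex mat" where
  "toK L N X = mode_hom (N * L) (2 * N * L) (\<lambda>k. k) X"

definition envK :: "nat \<Rightarrow> nat \<Rightarrow> nat \<Rightarrow> nat \<Rightarrow> complex mat" where
  "envK L N t i = ann (2 * N * L) (N * L + t * L + i)"

definition sysK :: "nat \<Rightarrow> nat \<Rightarrow> nat \<Rightarrow> nat \<Rightarrow> complex mat" where
  "sysK L N t i = ann (2 * N * L) (t * L + i)"

definition omega :: "nat \<Rightarrow> real \<Rightarrow> nat \<Rightarrow> real" where
  "omega N \<epsilon> n = (2 * real n + 1) * pi / (\<epsilon> * real N)"

definition fourier_ann :: "nat \<Rightarrow> nat \<Rightarrow> real \<Rightarrow> nat \<Rightarrow> nat \<Rightarrow> complex mat" where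
  "fourier_ann L N \<epsilon> n j =
     msum (fdim (N * L)) (map (\<lambda>t. (exp (\<i> * of_real (omega N \<epsilon> n * \<epsilon> * real t)) / of_real (sqrt (real N)))
                                   \<cdot>\<^sub>m ann (N * L) (t * L + j)) [0..<N])"

definition momentum :: "nat \<Rightarrow> nat \<Rightarrow> real \<Rightarrow> complex mat" where
  "momentum L N \<epsilon> = msum (fdim (N * L))
     (concat (map (\<lambda>n. map (\<lambda>j. of_real (omega N \<epsilon> n) \<cdot>\<^sub>m
        (mat_adjoint (fourier_ann L N \<epsilon> n j) * fourier_ann L N \<epsilon> n j)) [0..<L]) [0..<N]))"

definition expiS :: "nat \<Rightarrow> nat \<Rightarrow> real \<Rightarrow> complex mat \<Rightarrow> complex mat" where
  "expiS L N \<epsilon> H = mexp ((\<i> * of_real \<epsilon>) \<cdot>\<^sub>m momentum L N \<epsilon>) *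
     mprod (fdim (N * L)) (map (\<lambda>t. mexp ((- \<i> * of_real \<epsilon>) \<cdot>\<^sub>m slice L N t H)) [0..<N])"

definition Vop :: "nat \<Rightarrow> nat \<Rightarrow> real \<Rightarrow> complex mat \<Rightarrow> complex mat" where
  "Vop L N \<epsilon> H = mprod (fdim (N * L))
     (map (\<lambda>t. mexp ((\<i> * of_real (\<epsilon> * real t)) \<cdot>\<^sub>m slice L N t H)) [0..<N])"

definition expiSt :: "nat \<Rightarrow> nat \<Rightarrow> real \<Rightarrow> complex mat \<Rightarrow> complex mat" where
  "expiSt L N \<epsilon> H = mexp ((\<i> * of_real (\<epsilon> * real N)) \<cdot>\<^sub>m slice L N 0 H) * expiS L N \<epsilon> H"

definition expiSt_half :: "nat \<Rightarrow> nat \<Rightarrow> real \<Rightarrow> complex mat \<Rightarrow> complex mat" where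
  "expiSt_half L N \<epsilon> H = mat_adjoint (Vop L N \<epsilon> H) *
     mexp ((\<i> * of_real \<epsilon> / 2) \<cdot>\<^sub>m momentum L N \<epsilon>) * Vop L N \<epsilon> H"

definition PhiPlus :: "nat \<Rightarrow> nat \<Rightarrow> complex vec" where
  "PhiPlus L N = mexp (msum (fdim (2 * N * L))
      (concat (map (\<lambda>t. map (\<lambda>j. mat_adjoint (sysK L N t j) * mat_adjoint (envK L N t j))
        [0..<L]) [0..<N]))) *\<^sub>v vacuum (2 * N * L)"


definition PsiK :: "nat \<Rightarrow> nat \<Rightarrow> real \<Rightarrow> complex mat \<Rightarrow> complex mat \<Rightarrow> complex vec" where
  "PsiK L N \<epsilon> H \<rho> = (toK L N (slice L N 0 \<rho>) * toK L N (expiSt_half L N \<epsilon> H)) *\<^sub>v PhiPlus L N"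

definition PsibarK :: "nat \<Rightarrow> nat \<Rightarrow> real \<Rightarrow> complex mat \<Rightarrow> complex vec" where
  "PsibarK L N \<epsilon> H = mat_adjoint (toK L N (parity (N * L)) * toK L N (expiSt_half L N \<epsilon> H))
                        *\<^sub>v PhiPlus L N"

definition Rop :: "nat \<Rightarrow> nat \<Rightarrow> real \<Rightarrow> complex mat \<Rightarrow> complex mat \<Rightarrow> complex mat" where
  "Rop L N \<epsilon> H \<rho> = (1 / braket (PsibarK L N \<epsilon> H) (PsiK L N \<epsilon> H \<rho>)) \<cdot>\<^sub>m
      ketbra (PsiK L N \<epsilon> H \<rho>) (PsibarK L N \<epsilon> H)"

end

theory Submission
  imports Defs
begin

text \<open>
  System modes come first in the Jordan-Wigner order of \<open>\<K>\<close>, so a system operator \<open>X\<close> acts as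
  \<open>X \<otimes> 1\<close>, and \<open>\<Phi>\<^sup>+\<close> is a sum of all \<open>|n\<rangle>|n\<rangle>\<close> with phases of modulus one; hence
  \<open>\<langle>\<Phi>\<^sup>+|X|\<Phi>\<^sup>+\<rangle> = Tr X\<close>.  Cyclicity of the trace, together with the facts that the parity \<open>P\<close> commutes
  with \<open>\<rho>\<^sub>0\<close> and with \<open>exp (i S/2)\<close> and that \<open>exp (i S/2)\<close> squares to \<open>exp (i S)\<close>, then turns
  \<open>\<langle>\<Psi>'|X|\<Psi>\<rangle>\<close> into \<open>Tr (P \<rho>\<^sub>0 exp (i S) X)\<close>.

  The square identity rests on \<open>exp (i \<epsilon> \<P>)\<close> being the translation of creation operators by one slice with
  an antiperiodic boundary sign, which is invisible to the even operator \<open>H\<close>.  The same translation shows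
  \<open>Tr (P \<rho>\<^sub>0 exp (i S)) = tr \<rho>\<close>, so that the denominator does not vanish: \<open>P exp (i \<epsilon> \<P>)\<close> permutes the
  occupation basis up to signs, only configurations equal on all slices contribute to the trace, and on
  these all signs cancel.
\<close>

subsection \<open>Matrix algebra and the matrix exponential\<close>

text \<open>Matrix exponentials are handled without diagonalisation. An operator \<open>W\<close> is
  known by exchange relations \<open>W * cre M k = s \<cdot>\<^sub>m (cre M (g k) * W)\<close> and
  by its value on the vacuum; such relations lift from ladder operators to placed operators,
  exponentials and ordered products, and along strings of creators to basis vectors. The half
  translation has no such local description, since it does not map modes to modes. Only two facts
  about it are used: it squares to the full translation and it commutes with parity. The trace is
  therefore rearranged until both halves meet. The Jordan-Wigner order makes slice 0 an initial
  segment of the modes, so operators placed there have a matrix without signs. On later slices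
  strings of signs intervene, and facts about them are transported by the translation or obtained by
  commutation. The Hamiltonian drops out of the denominator: the slice-0 factor of \<V> is trivial,
  so \<V> commutes with the placed density operator and cancels under the trace.\<close>

lemma mat_assoc: "dim_col A = dim_row B \<Longrightarrow> dim_col B = dim_row C \<Longrightarrow>
    (A * B) * C = A * (B * (C :: complex mat))"
  by (rule assoc_mult_mat) auto

lemma mat_vec_assoc: "dim_col A = dim_row B \<Longrightarrow> dim_col B = dim_vec v \<Longrightarrow>
    (A * B) *\<^sub>v v = A *\<^sub>v (B *\<^sub>v (v :: complex vec))"
  by (rule assoc_mult_mat_vec) auto

lemma smult_mult_left: "dim_col A = dim_row B \<Longrightarrow> (k \<cdot>\<^sub>m A) * B = k \<cdot>\<^sub>m (A * (B :: complex mat))"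
  by (rule mult_smult_assoc_mat) auto

lemma smult_mult_right: "dim_col A = dim_row B \<Longrightarrow> A * (k \<cdot>\<^sub>m B) = k \<cdot>\<^sub>m (A * (B :: complex mat))"
  by (rule mult_smult_distrib) auto

lemma add_mult_left: "dim_row A = dim_row B \<Longrightarrow> dim_col A = dim_col B \<Longrightarrow> dim_col A = dim_row C \<Longrightarrow>
    (A + B) * C = A * C + B * (C :: complex mat)"
  by (rule add_mult_distrib_mat) auto

lemma add_mult_right: "dim_row B = dim_row C \<Longrightarrow> dim_col B = dim_col C \<Longrightarrow> dim_col A = dim_row B \<Longrightarrow>
    A * (B + C) = A * B + A * (C :: complex mat)"
  by (rule mult_add_distrib_mat) auto

lemma minus_mult_left: "dim_row A = dim_row B \<Longrightarrow> dim_col A = dim_col B \<Longrightarrow> dim_col A = dim_row C \<Longrightarrow>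
    (A - B) * C = A * C - B * (C :: complex mat)"
  by (rule minus_mult_distrib_mat) auto

lemma minus_mult_right: "dim_row B = dim_row C \<Longrightarrow> dim_col B = dim_col C \<Longrightarrow> dim_col A = dim_row B \<Longrightarrow>
    A * (B - C) = A * B - A * (C :: complex mat)"
  by (rule mult_minus_distrib_mat) auto

lemmas mat_distribs = smult_mult_left smult_mult_right add_mult_left add_mult_right
  minus_mult_left minus_mult_right

lemma smult_smult_mat [simp]: "a \<cdot>\<^sub>m (b \<cdot>\<^sub>m A) = (a * b) \<cdot>\<^sub>m (A :: complex mat)"
  by (intro eq_matI) auto

lemma one_smult_mat [simp]: "1 \<cdot>\<^sub>m A = (A :: complex mat)"
  by (intro eq_matI) auto

lemma mat_mult_entry: "i < dim_row A \<Longrightarrow> j < dim_col B \<Longrightarrow> dim_col A = dim_row B \<Longrightarrow>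
    (A * B) $$ (i, j) = (\<Sum>l<dim_row B. A $$ (i, l) * B $$ (l, j) :: complex)"
  by (auto simp: scalar_prod_def lessThan_atLeast0 intro!: sum.cong)

lemma mat_vec_entry: "i < dim_row A \<Longrightarrow> dim_col A = dim_vec v \<Longrightarrow>
    (A *\<^sub>v v) $ i = (\<Sum>l<dim_vec v. A $$ (i, l) * v $ l :: complex)"
  by (auto simp: scalar_prod_def lessThan_atLeast0 intro!: sum.cong)

text \<open>Ladder operators act on components by flipping one bit, so their products are easiest to
  compare on vectors: composition replaces the sum over an intermediate index.\<close>

lemma mat_eqI_vec:
  fixes A B :: "complex mat"
  assumes "dim_row A = dim_row B" "dim_col A = dim_col B"
    and "\<And>v x. dim_vec v = dim_col B \<Longrightarrow> x < dim_row B \<Longrightarrow> (A *\<^sub>v v) $ x = (B *\<^sub>v v) $ x"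
  shows "A = B"
proof (rule eq_matI)
  fix i j assume ij: "i < dim_row B" "j < dim_col B"
  have "(C *\<^sub>v unit_vec (dim_col B) j) $ i = C $$ (i, j)"
    if "dim_row C = dim_row B" "dim_col C = dim_col B" for C :: "complex mat"
    using ij that by simp
  then show "A $$ (i, j) = B $$ (i, j)"
    using assms ij by (metis index_unit_vec(3))
qed (use assms in auto)

lemma mat_adjoint_eq: "mat_adjoint A = mat (dim_col A) (dim_row A) (\<lambda>(i, j). cnj (A $$ (j, i)))"
  unfolding mat_adjoint_def by (intro eq_matI) (auto simp: mat_of_rows_index)

lemma mat_adjoint_dim [simp]:
  "dim_row (mat_adjoint A) = dim_col A" "dim_col (mat_adjoint (A :: complex mat)) = dim_row A"
  by (auto simp: mat_adjoint_eq)

lemma mat_adjoint_index [simp]: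
  "i < dim_col A \<Longrightarrow> j < dim_row A \<Longrightarrow> mat_adjoint A $$ (i, j) = cnj (A $$ (j, i))"
  by (simp add: mat_adjoint_eq)

lemma mat_adjoint_adjoint [simp]: "mat_adjoint (mat_adjoint A) = (A :: complex mat)"
  by (intro eq_matI) auto

lemma mat_adjoint_mult: "dim_col A = dim_row B \<Longrightarrow>
    mat_adjoint (A * B) = mat_adjoint B * mat_adjoint (A :: complex mat)"
  by (intro eq_matI) (auto simp: mat_mult_entry mult.commute simp del: index_mult_mat(1) intro!: sum.cong)

lemma mat_adjoint_smult: "mat_adjoint (k \<cdot>\<^sub>m A) = cnj k \<cdot>\<^sub>m mat_adjoint (A :: complex mat)"
  by (intro eq_matI) auto

lemma mat_adjoint_add: "dim_row A = dim_row B \<Longrightarrow> dim_col A = dim_col B \<Longrightarrow>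
    mat_adjoint (A + B) = mat_adjoint A + mat_adjoint (B :: complex mat)"
  by (intro eq_matI) auto

lemma mat_adjoint_one [simp]: "mat_adjoint (1\<^sub>m n) = (1\<^sub>m n :: complex mat)"
  by (intro eq_matI) auto

lemma mat_adjoint_zero [simp]: "mat_adjoint (0\<^sub>m n m) = (0\<^sub>m m n :: complex mat)"
  by (intro eq_matI) auto

section \<open>Matrix powers and the exponential series\<close>

lemma pow_mat_dims [simp]:
  "dim_row A = d \<Longrightarrow> dim_col A = d \<Longrightarrow> dim_row (A ^\<^sub>m k) = d"
  "dim_row A = d \<Longrightarrow> dim_col A = d \<Longrightarrow> dim_col (A ^\<^sub>m k) = d"
  by (cases k; simp)+

lemma pow_mat_Suc_left: "dim_row A = d \<Longrightarrow> dim_col A = d \<Longrightarrow> A * (A ^\<^sub>m k) = A ^\<^sub>m Suc k"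
  for A :: "complex mat"
  by (induction k) (auto simp: mat_assoc[symmetric])

lemma mexp_dim [simp]: "dim_row (mexp A) = dim_row A" "dim_col (mexp A) = dim_col A"
  by (auto simp: mexp_def)

context
  fixes A :: "complex mat" and d :: nat
  assumes A [simp]: "dim_row A = d" "dim_col A = d"
begin

text \<open>Row sums of moduli, unlike single entries, behave submultiplicatively, so the induction
  closes with the crude constant given by the sum of all moduli. The scalar exponential series of
  that constant then majorises every entry series.\<close>

lemma pow_mat_row_bound:
  assumes "i < d"
  shows "(\<Sum>j<d. cmod ((A ^\<^sub>m k) $$ (i, j))) \<le> (\<Sum>i<d. \<Sum>j<d. cmod (A $$ (i, j))) ^ k"
proof (induction k)
  case 0
  have "(\<Sum>j<d. cmod ((1\<^sub>m d :: complex mat) $$ (i, j))) = (\<Sum>j<d. if i = j then 1 else 0)"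
    using assms by (intro sum.cong) auto
  then show ?case using assms by simp
next
  case (Suc k)
  let ?B = "\<Sum>i<d. \<Sum>j<d. cmod (A $$ (i, j))"
  have "(\<Sum>j<d. cmod ((A ^\<^sub>m Suc k) $$ (i, j)))
      \<le> (\<Sum>j<d. \<Sum>l<d. cmod ((A ^\<^sub>m k) $$ (i, l)) * cmod (A $$ (l, j)))"
    using assms by (intro sum_mono) (auto simp: mat_mult_entry norm_mult[symmetric]
        simp del: index_mult_mat(1) intro: norm_sum)
  also have "\<dots> = (\<Sum>l<d. cmod ((A ^\<^sub>m k) $$ (i, l)) * (\<Sum>j<d. cmod (A $$ (l, j))))"
    by (subst sum.swap) (simp add: sum_distrib_left)
  also have "\<dots> \<le> (\<Sum>l<d. cmod ((A ^\<^sub>m k) $$ (i, l)) * ?B)"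
    by (intro sum_mono mult_left_mono member_le_sum) (auto intro: sum_nonneg)
  also have "\<dots> \<le> ?B ^ k * ?B"
    unfolding sum_distrib_right[symmetric] using Suc by (intro mult_right_mono) (auto intro!: sum_nonneg)
  finally show ?case by (simp add: mult.commute)
qed

lemma pow_mat_entry_bound:
  assumes "i < d" "j < d"
  shows "cmod ((A ^\<^sub>m k) $$ (i, j)) \<le> (\<Sum>i<d. \<Sum>j<d. cmod (A $$ (i, j))) ^ k"
proof -
  have "cmod ((A ^\<^sub>m k) $$ (i, j)) \<le> (\<Sum>j<d. cmod ((A ^\<^sub>m k) $$ (i, j)))"
    using assms by (intro member_le_sum) auto
  then show ?thesis using pow_mat_row_bound[OF assms(1), of k] by simp
qed

lemma mexp_summable_norm:
  assumes "i < d" "j < d"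
  shows "summable (\<lambda>k. norm ((A ^\<^sub>m k) $$ (i, j) / of_nat (fact k)))"
proof (rule summable_comparison_test)
  let ?B = "\<Sum>i<d. \<Sum>j<d. cmod (A $$ (i, j))"
  show "summable (\<lambda>k. inverse (fact k) * ?B ^ k)" by (rule summable_exp)
  show "\<exists>N. \<forall>n\<ge>N. norm (norm ((A ^\<^sub>m n) $$ (i, j) / of_nat (fact n))) \<le> inverse (fact n) * ?B ^ n"
    using pow_mat_entry_bound[OF assms] by (auto simp: norm_divide field_simps)
qed

lemma mexp_sums:
  assumes "i < d" "j < d"
  shows "(\<lambda>k. (A ^\<^sub>m k) $$ (i, j) / of_nat (fact k)) sums (mexp A $$ (i, j))"
  using summable_norm_cancel[OF mexp_summable_norm[OF assms]] assms by (auto simp: mexp_def summable_sums)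

lemma mexp_mult_sums:
  assumes "i < d" "j < dim_col W" "dim_row W = d"
  shows "(\<lambda>k. (A ^\<^sub>m k * W) $$ (i, j) / of_nat (fact k)) sums ((mexp A * W) $$ (i, j))"
proof -
  have "(\<lambda>k. \<Sum>l<d. (A ^\<^sub>m k) $$ (i, l) / of_nat (fact k) * W $$ (l, j)) sums
      (\<Sum>l<d. mexp A $$ (i, l) * W $$ (l, j))"
    using assms by (intro sums_sum sums_mult2 mexp_sums) auto
  then show ?thesis
    using assms by (simp add: mat_mult_entry sum_divide_distrib del: index_mult_mat(1))
qed

lemma mult_mexp_sums:
  assumes "i < dim_row W" "j < d" "dim_col W = d"
  shows "(\<lambda>k. (W * A ^\<^sub>m k) $$ (i, j) / of_nat (fact k)) sums ((W * mexp A) $$ (i, j))"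
proof -
  have "(\<lambda>k. \<Sum>l<d. W $$ (i, l) * ((A ^\<^sub>m k) $$ (l, j) / of_nat (fact k))) sums
      (\<Sum>l<d. W $$ (i, l) * mexp A $$ (l, j))"
    using assms by (intro sums_sum sums_mult mexp_sums) auto
  then show ?thesis
    using assms by (simp add: mat_mult_entry sum_divide_distrib del: index_mult_mat(1))
qed

lemma mexp_mult_vec_sums:
  assumes "i < d" "dim_vec v = d"
  shows "(\<lambda>k. (A ^\<^sub>m k *\<^sub>v v) $ i / of_nat (fact k)) sums ((mexp A *\<^sub>v v) $ i)"
proof -
  have "(\<lambda>k. \<Sum>l<d. (A ^\<^sub>m k) $$ (i, l) / of_nat (fact k) * v $ l) sums
      (\<Sum>l<d. mexp A $$ (i, l) * v $ l)"
    using assms by (intro sums_sum sums_mult2 mexp_sums) auto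
  then show ?thesis
    using assms by (simp add: mat_vec_entry sum_divide_distrib del: index_mult_mat_vec)
qed

text \<open>Every power beyond the zeroth annihilates \<open>v\<close>, so a single term of the
  series remains. Parity and translation obtain their invariant vacuum in this way.\<close>

lemma mexp_fixes_kernel:
  assumes [simp]: "dim_vec v = d" and ker: "A *\<^sub>v v = 0\<^sub>v d"
  shows "mexp A *\<^sub>v v = v"
proof (rule eq_vecI)
  fix i assume i: "i < dim_vec v"
  have pow: "A ^\<^sub>m k *\<^sub>v v = (if k = 0 then v else 0\<^sub>v d)" for k
  proof (cases k)
    case 0
    then show ?thesis using one_mult_mat_vec[OF carrier_vecI[OF assms(1)]] by simp
  next
    case (Suc m)
    have "A ^\<^sub>m m *\<^sub>v 0\<^sub>v d = 0\<^sub>v d"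
      by (intro eq_vecI) (auto simp: scalar_prod_def)
    with Suc show ?thesis by (simp add: mat_vec_assoc ker)
  qed
  have "(\<lambda>k. (A ^\<^sub>m k *\<^sub>v v) $ i / of_nat (fact k)) sums ((mexp A *\<^sub>v v) $ i)"
    using i by (intro mexp_mult_vec_sums) auto
  moreover have "(\<lambda>k. (A ^\<^sub>m k *\<^sub>v v) $ i / of_nat (fact k)) = (\<lambda>k. if k = 0 then v $ i else 0)"
    using i by (intro ext) (subst pow, auto)
  ultimately have "(\<lambda>k. if k = 0 then v $ i else 0) sums ((mexp A *\<^sub>v v) $ i)" by simp
  moreover have "(\<lambda>k::nat. if k = 0 then v $ i else 0) sums (v $ i)"
    using sums_single[of 0 "\<lambda>_. v $ i"] by simp
  ultimately show "(mexp A *\<^sub>v v) $ i = v $ i" by (rule sums_unique2)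
qed simp

end

text \<open>The relation passes to all powers by induction and then termwise to the series.
  \<open>W\<close> may be singular, so ladder operators are covered as well as unitaries.\<close>

lemma mexp_intertwine:
  assumes [simp]: "dim_row A = d" "dim_col A = d" "dim_row W = d" "dim_col W = d" "dim_row C = d" "dim_col C = d"
    and comm: "A * W = W * C"
  shows "mexp A * W = W * mexp C"
proof (rule eq_matI)
  have pow: "A ^\<^sub>m k * W = W * C ^\<^sub>m k" for k
  proof (induction k)
    case (Suc k)
    have "A ^\<^sub>m Suc k * W = A ^\<^sub>m k * (A * W)" by (simp add: mat_assoc)
    also have "\<dots> = (A ^\<^sub>m k * W) * C" by (simp add: comm mat_assoc)
    also have "\<dots> = W * C ^\<^sub>m Suc k" by (simp add: Suc mat_assoc)
    finally show ?case .
  qed simp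
  fix i j assume "i < dim_row (W * mexp C)" "j < dim_col (W * mexp C)"
  then have ij: "i < d" "j < d" by auto
  have "(\<lambda>k. (W * C ^\<^sub>m k) $$ (i, j) / of_nat (fact k)) sums ((mexp A * W) $$ (i, j))"
    using mexp_mult_sums[of A d i j W] ij by (simp add: pow)
  moreover have "(\<lambda>k. (W * C ^\<^sub>m k) $$ (i, j) / of_nat (fact k)) sums ((W * mexp C) $$ (i, j))"
    using mult_mexp_sums[of C d i W j] ij by simp
  ultimately show "(mexp A * W) $$ (i, j) = (W * mexp C) $$ (i, j)" by (rule sums_unique2)
qed auto

lemma mexp_zero [simp]: "mexp (0\<^sub>m d d) = 1\<^sub>m d"
proof (rule eq_matI)
  fix i j assume ij: "i < dim_row (1\<^sub>m d :: complex mat)" "j < dim_col (1\<^sub>m d :: complex mat)"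
  have pow: "(0\<^sub>m d d :: complex mat) ^\<^sub>m k = (if k = 0 then 1\<^sub>m d else 0\<^sub>m d d)" for k
    by (induction k) auto
  have "(\<lambda>k. ((0\<^sub>m d d) ^\<^sub>m k) $$ (i, j) / of_nat (fact k)) sums (mexp (0\<^sub>m d d) $$ (i, j))"
    using ij by (intro mexp_sums) auto
  moreover have "(\<lambda>k. ((0\<^sub>m d d :: complex mat) ^\<^sub>m k) $$ (i, j) / of_nat (fact k)) =
      (\<lambda>k. if k = 0 then 1\<^sub>m d $$ (i, j) else 0)"
    using ij by (intro ext) (auto simp: pow)
  moreover have "(\<lambda>k::nat. if k = 0 then 1\<^sub>m d $$ (i, j) else 0) sums (1\<^sub>m d $$ (i, j) :: complex)"
    using sums_single[of 0 "\<lambda>_. 1\<^sub>m d $$ (i, j) :: complex"] by simp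
  ultimately show "mexp (0\<^sub>m d d) $$ (i, j) = 1\<^sub>m d $$ (i, j)" by (metis sums_unique2)
qed auto

lemma mexp_adjoint:
  assumes [simp]: "dim_row A = d" "dim_col A = d"
  shows "mat_adjoint (mexp A) = mexp (mat_adjoint A)"
proof (rule eq_matI)
  have pow: "mat_adjoint A ^\<^sub>m k = mat_adjoint (A ^\<^sub>m k)" for k
  proof (induction k)
    case (Suc k)
    have "mat_adjoint A ^\<^sub>m Suc k = mat_adjoint (A * A ^\<^sub>m k)"
      by (simp add: Suc mat_adjoint_mult)
    then show ?case by (simp only: pow_mat_Suc_left[OF assms])
  qed simp
  fix i j assume "i < dim_row (mexp (mat_adjoint A))" "j < dim_col (mexp (mat_adjoint A))"
  then have ij: "i < d" "j < d" by auto
  have "(\<lambda>k. cnj ((A ^\<^sub>m k) $$ (j, i) / of_nat (fact k))) sums cnj (mexp A $$ (j, i))"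
    unfolding sums_cnj using ij by (intro mexp_sums) auto
  moreover have "(\<lambda>k. (mat_adjoint A ^\<^sub>m k) $$ (i, j) / of_nat (fact k)) sums (mexp (mat_adjoint A) $$ (i, j))"
    using ij by (intro mexp_sums) auto
  ultimately show "mat_adjoint (mexp A) $$ (i, j) = mexp (mat_adjoint A) $$ (i, j)"
    using ij by (auto simp: pow dest: sums_unique2)
qed auto

text \<open>Fixing an entry turns the right-hand side into a sum of complex numbers, the shape in
  which the Cauchy product of two entry series appears in \<open>mexp_add\<close>. The induction
  must vary the column, because the next factor is summed over it.\<close>

lemma pow_mat_binomial:
  fixes A B :: "complex mat"
  assumes [simp]: "dim_row A = d" "dim_col A = d" "dim_row B = d" "dim_col B = d"
    and comm: "A * B = B * A" and ij: "i < d" "j < d"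
  shows "((A + B) ^\<^sub>m n) $$ (i, j) = (\<Sum>k\<le>n. of_nat (n choose k) * (A ^\<^sub>m k * B ^\<^sub>m (n - k)) $$ (i, j))"
  using ij
proof (induction n arbitrary: i j)
  case 0
  then show ?case by simp
next
  case (Suc n)
  have powA: "B ^\<^sub>m m * A = A * B ^\<^sub>m m" for m
  proof (induction m)
    case (Suc m)
    have "B ^\<^sub>m Suc m * A = B ^\<^sub>m m * (B * A)" by (simp add: mat_assoc)
    also have "\<dots> = (B ^\<^sub>m m * A) * B" by (simp add: comm[symmetric] mat_assoc)
    finally show ?case by (simp add: Suc mat_assoc)
  qed simp
  have step: "A ^\<^sub>m k * B ^\<^sub>m m * (A + B) = A ^\<^sub>m Suc k * B ^\<^sub>m m + A ^\<^sub>m k * B ^\<^sub>m Suc m" for k m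
    by (simp add: add_mult_right mat_assoc powA)
  let ?T = "\<lambda>k m. (A ^\<^sub>m k * B ^\<^sub>m m) $$ (i, j)"
  have "((A + B) ^\<^sub>m Suc n) $$ (i, j) = (\<Sum>l<d. ((A + B) ^\<^sub>m n) $$ (i, l) * (A + B) $$ (l, j))"
    using Suc.prems by (subst pow_mat.simps, subst mat_mult_entry) auto
  also have "\<dots> = (\<Sum>l<d. (\<Sum>k\<le>n. of_nat (n choose k) * (A ^\<^sub>m k * B ^\<^sub>m (n - k)) $$ (i, l)) * (A + B) $$ (l, j))"
    using Suc.prems Suc.IH by (intro sum.cong) auto
  also have "\<dots> = (\<Sum>k\<le>n. of_nat (n choose k) * (\<Sum>l<d. (A ^\<^sub>m k * B ^\<^sub>m (n - k)) $$ (i, l) * (A + B) $$ (l, j)))"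
    unfolding sum_distrib_right sum_distrib_left by (subst sum.swap) (simp add: mult.assoc)
  also have "\<dots> = (\<Sum>k\<le>n. of_nat (n choose k) * (A ^\<^sub>m k * B ^\<^sub>m (n - k) * (A + B)) $$ (i, j))"
  proof -
    have "(X * (A + B)) $$ (i, j) = (\<Sum>l<d. X $$ (i, l) * (A + B) $$ (l, j))"
      if "dim_row X = d" "dim_col X = d" for X
      using that Suc.prems by (subst mat_mult_entry) auto
    then show ?thesis by (simp del: index_mult_mat(1) index_add_mat(1))
  qed
  also have "\<dots> = (\<Sum>k\<le>n. of_nat (n choose k) * ?T (Suc k) (n - k)) + (\<Sum>k\<le>n. of_nat (n choose k) * ?T k (Suc (n - k)))"
    unfolding step using Suc.prems by (simp add: distrib_left sum.distrib del: index_mult_mat(1) pow_mat.simps)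
  \<comment> \<open>The range may grow to \<open>Suc n\<close> because \<open>n choose Suc n\<close>
    is 0; after an index shift this sum joins the other one by Pascal's rule.\<close>
  also have "(\<Sum>k\<le>n. of_nat (n choose k) * ?T k (Suc (n - k))) = (\<Sum>k\<le>Suc n. of_nat (n choose k) * ?T k (Suc n - k))"
    by (simp add: Suc_diff_le binomial_eq_0 del: index_mult_mat(1) pow_mat.simps)
  also have "\<dots> = ?T 0 (Suc n) + (\<Sum>k\<le>n. of_nat (n choose Suc k) * ?T (Suc k) (n - k))"
    by (subst sum.atMost_Suc_shift) (simp del: index_mult_mat(1) pow_mat.simps)
  also have "(\<Sum>k\<le>n. of_nat (n choose k) * ?T (Suc k) (n - k)) + \<dots> =
      ?T 0 (Suc n) + (\<Sum>k\<le>n. of_nat (Suc n choose Suc k) * ?T (Suc k) (n - k))"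
    by (simp add: sum.distrib distrib_right del: index_mult_mat(1) pow_mat.simps)
  also have "\<dots> = (\<Sum>k\<le>Suc n. of_nat (Suc n choose k) * ?T k (Suc n - k))"
    by (subst sum.atMost_Suc_shift) (simp del: index_mult_mat(1) pow_mat.simps)
  finally show ?case .
qed

text \<open>For each intermediate index \<open>l\<close> the two entry series converge absolutely
  and have a Cauchy product; summing over \<open>l\<close> gives the entry of the product.
  Commutation enters only through the binomial formula.\<close>

lemma mexp_add:
  fixes A B :: "complex mat"
  assumes [simp]: "dim_row A = d" "dim_col A = d" "dim_row B = d" "dim_col B = d"
    and comm: "A * B = B * A"
  shows "mexp (A + B) = mexp A * mexp B"
proof (rule eq_matI)
  fix i j assume "i < dim_row (mexp A * mexp B)" "j < dim_col (mexp A * mexp B)"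
  then have ij: "i < d" "j < d" by auto
  let ?a = "\<lambda>l k. (A ^\<^sub>m k) $$ (i, l) / of_nat (fact k)"
  let ?b = "\<lambda>l k. (B ^\<^sub>m k) $$ (l, j) / of_nat (fact k)"
  have "(\<lambda>n. \<Sum>k\<le>n. ?a l k * ?b l (n - k)) sums (mexp A $$ (i, l) * mexp B $$ (l, j))" if "l < d" for l
  proof -
    have "mexp A $$ (i, l) = suminf (?a l)" "mexp B $$ (l, j) = suminf (?b l)"
      using mexp_sums[of A d i l] mexp_sums[of B d l j] ij that by (auto simp: sums_iff)
    then show ?thesis
      using Cauchy_product_sums[OF mexp_summable_norm[of A d i l] mexp_summable_norm[of B d l j]] ij that
      by simp
  qed
  then have "(\<lambda>n. \<Sum>l<d. \<Sum>k\<le>n. ?a l k * ?b l (n - k)) sums (\<Sum>l<d. mexp A $$ (i, l) * mexp B $$ (l, j))"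
    by (intro sums_sum) auto
  also have "(\<Sum>l<d. mexp A $$ (i, l) * mexp B $$ (l, j)) = (mexp A * mexp B) $$ (i, j)"
    using ij by (subst mat_mult_entry) auto
  also have "(\<lambda>n. \<Sum>l<d. \<Sum>k\<le>n. ?a l k * ?b l (n - k)) = (\<lambda>n. ((A + B) ^\<^sub>m n) $$ (i, j) / of_nat (fact n))"
  proof
    fix n
    have "(\<Sum>l<d. \<Sum>k\<le>n. ?a l k * ?b l (n - k)) =
        (\<Sum>k\<le>n. (\<Sum>l<d. (A ^\<^sub>m k) $$ (i, l) * (B ^\<^sub>m (n - k)) $$ (l, j)) / (fact k * fact (n - k)))"
      by (subst sum.swap) (simp add: sum_divide_distrib)
    also have "\<dots> = (\<Sum>k\<le>n. (A ^\<^sub>m k * B ^\<^sub>m (n - k)) $$ (i, j) / (fact k * fact (n - k)))"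
      using ij by (intro sum.cong refl) (subst mat_mult_entry, auto)
    also have "\<dots> = (\<Sum>k\<le>n. of_nat (n choose k) * (A ^\<^sub>m k * B ^\<^sub>m (n - k)) $$ (i, j) / fact n)"
      by (intro sum.cong refl) (simp add: binomial_fact field_simps del: index_mult_mat(1))
    finally show "(\<Sum>l<d. \<Sum>k\<le>n. ?a l k * ?b l (n - k)) = ((A + B) ^\<^sub>m n) $$ (i, j) / of_nat (fact n)"
      using ij by (simp add: pow_mat_binomial[OF assms] sum_divide_distrib del: index_mult_mat(1))
  qed
  finally have "(\<lambda>n. ((A + B) ^\<^sub>m n) $$ (i, j) / of_nat (fact n)) sums ((mexp A * mexp B) $$ (i, j))" .
  moreover have "(\<lambda>n. ((A + B) ^\<^sub>m n) $$ (i, j) / of_nat (fact n)) sums (mexp (A + B) $$ (i, j))"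
    using ij by (intro mexp_sums) auto
  ultimately show "mexp (A + B) $$ (i, j) = (mexp A * mexp B) $$ (i, j)" by (metis sums_unique2)
qed auto

lemma mexp_smult_add:
  assumes "dim_row A = d" "dim_col A = d"
  shows "mexp (s \<cdot>\<^sub>m A) * mexp (t \<cdot>\<^sub>m A) = mexp ((s + t) \<cdot>\<^sub>m A)"
proof -
  have "(s + t) \<cdot>\<^sub>m A = s \<cdot>\<^sub>m A + t \<cdot>\<^sub>m A" by (intro eq_matI) (auto simp: algebra_simps)
  moreover have "(s \<cdot>\<^sub>m A) * (t \<cdot>\<^sub>m A) = (t \<cdot>\<^sub>m A) * (s \<cdot>\<^sub>m A)"
    using assms by (simp add: mat_distribs mult.commute)
  ultimately show ?thesis using assms mexp_add[of "s \<cdot>\<^sub>m A" d "t \<cdot>\<^sub>m A"] by simp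
qed

lemma mexp_scalar: "mexp (c \<cdot>\<^sub>m 1\<^sub>m d) = exp c \<cdot>\<^sub>m 1\<^sub>m d"
proof (rule eq_matI)
  fix i j assume ij: "i < dim_row (exp c \<cdot>\<^sub>m 1\<^sub>m d)" "j < dim_col (exp c \<cdot>\<^sub>m 1\<^sub>m d)"
  have pow: "(c \<cdot>\<^sub>m 1\<^sub>m d) ^\<^sub>m k = c ^ k \<cdot>\<^sub>m 1\<^sub>m d" for k
    by (induction k) (auto simp: mat_distribs mult.commute)
  have "(\<lambda>k. (c ^ k / of_nat (fact k)) * 1\<^sub>m d $$ (i, j)) sums (exp c * 1\<^sub>m d $$ (i, j))"
    by (intro sums_mult2) (use exp_converges[of c] in \<open>simp add: scaleR_conv_of_real divide_inverse mult.commute\<close>)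
  moreover have "(\<lambda>k. ((c \<cdot>\<^sub>m 1\<^sub>m d) ^\<^sub>m k) $$ (i, j) / of_nat (fact k)) sums (mexp (c \<cdot>\<^sub>m 1\<^sub>m d) $$ (i, j))"
    using ij by (intro mexp_sums) auto
  ultimately show "mexp (c \<cdot>\<^sub>m 1\<^sub>m d) $$ (i, j) = (exp c \<cdot>\<^sub>m 1\<^sub>m d) $$ (i, j)"
    using ij by (auto simp: pow simp del: index_one_mat dest: sums_unique2)
qed auto

lemma mexp_add_scalar:
  assumes [simp]: "dim_row A = d" "dim_col A = d"
  shows "mexp (A + c \<cdot>\<^sub>m 1\<^sub>m d) = exp c \<cdot>\<^sub>m mexp A"
  by (subst mexp_add[of _ d]) (auto simp: mexp_scalar mat_distribs)

text \<open>The hypothesis reads \<open>A * W = W * (A + c \<cdot>\<^sub>m 1\<^sub>m d)\<close>, so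
  intertwining replaces \<open>A\<close> by \<open>A\<close> plus a scalar, and the scalar
  exponentiates to a number. With \<open>c = 1\<close> this gives the parity sign of a creator, with
  a frequency the phase of a Fourier mode.\<close>

lemma mexp_ladder:
  assumes [simp]: "dim_row A = d" "dim_col A = d" "dim_row W = d" "dim_col W = d"
    and comm: "A * W = W * A + c \<cdot>\<^sub>m W"
  shows "mexp (s \<cdot>\<^sub>m A) * W = exp (s * c) \<cdot>\<^sub>m (W * mexp (s \<cdot>\<^sub>m A))"
proof -
  have "mexp (s \<cdot>\<^sub>m A) * W = W * mexp (s \<cdot>\<^sub>m A + (s * c) \<cdot>\<^sub>m 1\<^sub>m d)"
  proof (rule mexp_intertwine[of _ d])
    show "s \<cdot>\<^sub>m A * W = W * (s \<cdot>\<^sub>m A + (s * c) \<cdot>\<^sub>m 1\<^sub>m d)"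
      by (simp add: mat_distribs comm) (intro eq_matI, auto simp: algebra_simps)
  qed auto
  then show ?thesis by (simp add: mexp_add_scalar[of _ d] mat_distribs)
qed

lemma mexp_square_zero:
  fixes B :: "complex mat"
  assumes [simp]: "dim_row B = d" "dim_col B = d" and sq: "B * B = 0\<^sub>m d d"
  shows "mexp B = 1\<^sub>m d + B"
proof (rule eq_matI)
  fix i j assume ij': "i < dim_row (1\<^sub>m d + B)" "j < dim_col (1\<^sub>m d + B)"
  then have ij: "i < d" "j < d" by auto
  have pow: "B ^\<^sub>m Suc (Suc k) = 0\<^sub>m d d" for k
    by (induction k) (auto simp: sq mat_assoc)
  have "(\<lambda>k. (B ^\<^sub>m k) $$ (i, j) / of_nat (fact k)) sums (mexp B $$ (i, j))"
    using ij by (intro mexp_sums) auto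
  moreover have "(\<lambda>k. (B ^\<^sub>m k) $$ (i, j) / of_nat (fact k)) sums
      (\<Sum>k\<in>{0,1}. (B ^\<^sub>m k) $$ (i, j) / of_nat (fact k))"
  proof (rule sums_finite)
    fix k :: nat assume "k \<notin> {0, 1}"
    then obtain m where "k = Suc (Suc m)" by (cases k rule: nat.exhaust; metis insertCI not0_implies_Suc One_nat_def)
    then show "(B ^\<^sub>m k) $$ (i, j) / of_nat (fact k) = 0" using ij by (simp only: pow) simp
  qed auto
  ultimately have "mexp B $$ (i, j) = (\<Sum>k\<in>{0,1}. (B ^\<^sub>m k) $$ (i, j) / of_nat (fact k))"
    by (rule sums_unique2)
  then show "mexp B $$ (i, j) = (1\<^sub>m d + B) $$ (i, j)"
    using ij by simp
qed auto

subsection \<open>Ladder operators\<close>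

lemma occ_bit: "occ n k = bit n k"
  by (simp add: occ_def bit_iff_odd)

lemma flip_bit_involution [simp]: "flip_bit k (flip_bit k x) = (x :: nat)"
  by (rule bit_eqI) (auto simp: bit_simps)

lemma flip_bit_commute: "flip_bit j (flip_bit k x) = flip_bit k (flip_bit j (x :: nat))"
  by (rule bit_eqI) (auto simp: bit_simps)

lemma bit_flip_bit_nat [simp]: "bit (flip_bit m (x :: nat)) n \<longleftrightarrow> (m = n) \<noteq> bit x n"
  by (auto simp: bit_simps)

lemma flip_bit_add: "\<not> bit x k \<Longrightarrow> flip_bit k x = x + 2 ^ k" for x :: nat
  by (simp add: flip_bit_eq_if set_bit_eq)

lemma flip_bit_diff: "bit x k \<Longrightarrow> flip_bit k x = x - 2 ^ k" for x :: nat
  using flip_bit_add[of "flip_bit k x" k] by simp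

lemma flip_bit_less_fdim [simp]: "k < M \<Longrightarrow> flip_bit k x < fdim M \<longleftrightarrow> x < fdim M"
proof -
  assume k: "k < M"
  have "flip_bit k y < fdim M" if "y < fdim M" for y
    using take_bit_flip_bit_eq[of M k y] that k
    by (simp add: fdim_def take_bit_nat_eq_self_iff flip: take_bit_nat_eq_self_iff)
  from this[of x] this[of "flip_bit k x"] show ?thesis by auto
qed

lemma bit_less_fdim: "x < fdim M \<Longrightarrow> bit x k \<Longrightarrow> k < M"
  by (metis bit_take_bit_iff fdim_def take_bit_nat_eq_self)

text \<open>The sign at \<open>k\<close> counts occupied modes strictly below \<open>k\<close>, so a
  flip at \<open>j\<close> is felt only when \<open>j < k\<close>. For two distinct modes exactly
  one of the two orders feels it, which is the source of every anticommutation sign.\<close>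

lemma jw_sign_flip: "jw_sign (flip_bit j x) k = (if j < k then - jw_sign x k else jw_sign x k)"
proof -
  let ?S = "{i. i < k \<and> bit x i}"
  have fin: "finite ?S" by simp
  have S: "{i. i < k \<and> bit (flip_bit j x) i} =
      (if j < k then if bit x j then ?S - {j} else insert j ?S else ?S)"
    by auto
  have "(- 1) ^ card ?S = - ((- 1 :: complex) ^ card (?S - {j}))" if "j < k" "bit x j"
    using that by (subst card.remove[of _ j]) auto
  then show ?thesis unfolding jw_sign_def occ_bit S by auto
qed

lemma jw_sign_square [simp]: "jw_sign x k * jw_sign x k = 1"
  by (simp add: jw_sign_def flip: power_add)

lemma cnj_jw_sign [simp]: "cnj (jw_sign x k) = jw_sign x k"
  by (simp add: jw_sign_def)

lemma ann_dim [simp]: "dim_row (ann M k) = fdim M" "dim_col (ann M k) = fdim M"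
  by (auto simp: ann_def)

lemma cre_dim [simp]: "dim_row (cre M k) = fdim M" "dim_col (cre M k) = fdim M"
  by (auto simp: cre_def)

lemma adjoint_ann [simp]: "mat_adjoint (ann M k) = cre M k"
  by (simp add: cre_def)

lemma adjoint_cre [simp]: "mat_adjoint (cre M k) = ann M k"
  by (simp only: cre_def mat_adjoint_adjoint)

text \<open>The definition takes the sign of the source configuration; the sign of the target
  \<open>x\<close> may stand here because flipping mode \<open>k\<close> leaves the sign at
  \<open>k\<close> unchanged.\<close>

lemma ann_vec:
  assumes "k < M" "dim_vec v = fdim M" "x < fdim M"
  shows "(ann M k *\<^sub>v v) $ x = (if bit x k then 0 else jw_sign x k * v $ flip_bit k x)"
proof -
  have "(ann M k *\<^sub>v v) $ x = (\<Sum>l<fdim M. if l = flip_bit k x then if bit x k then 0 else jw_sign x k * v $ l else 0)"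
  proof -
    have "bit l k \<and> x = l - 2 ^ k \<longleftrightarrow> l = flip_bit k x \<and> \<not> bit x k" for l
      by (metis flip_bit_diff flip_bit_involution bit_flip_bit_nat)
    then show ?thesis
      using assms by (subst mat_vec_entry, simp, simp, intro sum.cong)
        (auto simp: ann_def occ_bit jw_sign_flip)
  qed
  then show ?thesis using assms by (simp add: sum.delta)
qed

lemma cre_vec:
  assumes "k < M" "dim_vec v = fdim M" "x < fdim M"
  shows "(cre M k *\<^sub>v v) $ x = (if bit x k then jw_sign x k * v $ flip_bit k x else 0)"
proof -
  have "(cre M k *\<^sub>v v) $ x = (\<Sum>l<fdim M. if l = flip_bit k x then if bit x k then jw_sign x k * v $ l else 0 else 0)"
    using assms by (subst mat_vec_entry, simp, simp, intro sum.cong)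
      (auto simp: cre_def ann_def occ_bit simp del: adjoint_ann simp flip: flip_bit_diff)
  then show ?thesis using assms by (simp add: sum.delta)
qed

lemma smult_mat_vec: "dim_col A = dim_vec v \<Longrightarrow> (c \<cdot>\<^sub>m A) *\<^sub>v v = c \<cdot>\<^sub>v (A *\<^sub>v (v :: complex vec))"
  by (intro eq_vecI) auto

lemma add_mat_vec: "dim_row A = dim_row B \<Longrightarrow> dim_col A = dim_vec v \<Longrightarrow> dim_col B = dim_vec v \<Longrightarrow>
    (A + B) *\<^sub>v v = A *\<^sub>v v + B *\<^sub>v (v :: complex vec)"
  by (rule add_mult_distrib_mat_vec[of _ "dim_row B" "dim_vec v"]) auto

lemma minus_mat_vec: "dim_row A = dim_row B \<Longrightarrow> dim_col A = dim_vec v \<Longrightarrow> dim_col B = dim_vec v \<Longrightarrow>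
    (A - B) *\<^sub>v v = A *\<^sub>v v - B *\<^sub>v (v :: complex vec)"
  by (rule minus_mult_distrib_mat_vec[of _ "dim_row B" "dim_vec v"]) auto

lemma one_mat_vec: "dim_vec v = d \<Longrightarrow> 1\<^sub>m d *\<^sub>v v = (v :: complex vec)"
  using one_mult_mat_vec[OF carrier_vecI] by blast

text \<open>Two flips commute, and their signs differ by the asymmetry in
  \<open>jw_sign_flip\<close>. The case \<open>j = k\<close> is included and then expresses that a
  creator squares to zero.\<close>

lemma cre_cre:
  assumes "j < M" "k < M"
  shows "cre M j * cre M k = (- 1) \<cdot>\<^sub>m (cre M k * cre M j)"
proof (rule mat_eqI_vec)
  fix v :: "complex vec" and x assume "dim_vec v = dim_col ((- 1) \<cdot>\<^sub>m (cre M k * cre M j))" "x < dim_row ((- 1) \<cdot>\<^sub>m (cre M k * cre M j))"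
  then show "(cre M j * cre M k *\<^sub>v v) $ x = ((- 1) \<cdot>\<^sub>m (cre M k * cre M j) *\<^sub>v v) $ x"
    using assms by (cases j k rule: linorder_cases)
     (auto simp: smult_mat_vec mat_vec_assoc cre_vec jw_sign_flip flip_bit_commute[of j k]
        simp del: index_mult_mat_vec)
qed auto

lemma ann_ann:
  assumes "j < M" "k < M"
  shows "ann M j * ann M k = (- 1) \<cdot>\<^sub>m (ann M k * ann M j)"
  using arg_cong[OF cre_cre[OF assms(2,1)], of mat_adjoint] by (simp add: mat_adjoint_mult mat_adjoint_smult)

lemma ann_cre:
  assumes "j < M" "k < M" "j \<noteq> k"
  shows "ann M j * cre M k = (- 1) \<cdot>\<^sub>m (cre M k * ann M j)"
proof (rule mat_eqI_vec)
  fix v :: "complex vec" and x assume "dim_vec v = dim_col ((- 1) \<cdot>\<^sub>m (cre M k * ann M j))" "x < dim_row ((- 1) \<cdot>\<^sub>m (cre M k * ann M j))"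
  then show "(ann M j * cre M k *\<^sub>v v) $ x = ((- 1) \<cdot>\<^sub>m (cre M k * ann M j) *\<^sub>v v) $ x"
    using assms by (cases j k rule: linorder_cases)
     (auto simp: smult_mat_vec mat_vec_assoc cre_vec ann_vec jw_sign_flip flip_bit_commute[of j k]
        simp del: index_mult_mat_vec)
qed auto

lemma cre_ann:
  assumes "j < M" "k < M" "j \<noteq> k"
  shows "cre M j * ann M k = (- 1) \<cdot>\<^sub>m (ann M k * cre M j)"
  using arg_cong[OF ann_cre[of k M j], of "\<lambda>A. (- 1) \<cdot>\<^sub>m A"] assms by simp

lemma jw_sign_square' [simp]: "jw_sign x k * (jw_sign x k * c) = c"
  by (simp flip: mult.assoc)

lemma number_vec:
  assumes "k < M" "dim_vec v = fdim M" "x < fdim M"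
  shows "((cre M k * ann M k) *\<^sub>v v) $ x = (if bit x k then v $ x else 0)"
  using assms by (auto simp: mat_vec_assoc cre_vec ann_vec jw_sign_flip simp del: index_mult_mat_vec)

lemma ann_cre_same:
  assumes "k < M"
  shows "ann M k * cre M k + cre M k * ann M k = 1\<^sub>m (fdim M)"
proof (rule mat_eqI_vec)
  fix v :: "complex vec" and x assume "dim_vec v = dim_col (1\<^sub>m (fdim M))" "x < dim_row (1\<^sub>m (fdim M))"
  then show "((ann M k * cre M k + cre M k * ann M k) *\<^sub>v v) $ x = (1\<^sub>m (fdim M) *\<^sub>v v) $ x"
    using assms by (auto simp: add_mat_vec mat_vec_assoc cre_vec ann_vec jw_sign_flip one_mat_vec
        simp del: index_mult_mat_vec)
qed auto

subsection \<open>Finite sums and products of matrices\<close>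

abbreviation square_dim :: "nat \<Rightarrow> complex mat \<Rightarrow> bool" where
  "square_dim d A \<equiv> dim_row A = d \<and> dim_col A = d"

lemma msum_dim [simp]: "dim_row (msum d As) = d" "dim_col (msum d As) = d"
  by (induction As) (auto simp: msum_def)

lemma mprod_dim_col [simp]: "dim_col (mprod d As) = d"
  by (induction As) (auto simp: mprod_def)

lemma mprod_dim_row [simp]: "\<forall>A\<in>set As. dim_row A = d \<Longrightarrow> dim_row (mprod d As) = d"
  by (induction As) (auto simp: mprod_def)

lemma msum_Nil [simp]: "msum d [] = 0\<^sub>m d d" and msum_Cons [simp]: "msum d (A # As) = A + msum d As"
  by (auto simp: msum_def)

lemma mprod_Nil [simp]: "mprod d [] = 1\<^sub>m d" and mprod_Cons [simp]: "mprod d (A # As) = A * mprod d As"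
  by (auto simp: mprod_def)

lemma msum_append: "\<forall>A\<in>set As. square_dim d A \<Longrightarrow> msum d (As @ Bs) = msum d As + msum d Bs"
  by (induction As) (auto intro!: assoc_add_mat)

lemma mprod_append: "\<forall>A\<in>set As \<union> set Bs. square_dim d A \<Longrightarrow> mprod d (As @ Bs) = mprod d As * mprod d Bs"
  by (induction As) (auto simp: mat_assoc)

lemma msum_index:
  "\<forall>A\<in>set As. square_dim d A \<Longrightarrow> i < d \<Longrightarrow> j < d \<Longrightarrow> msum d As $$ (i, j) = (\<Sum>A\<leftarrow>As. A $$ (i, j))"
  by (induction As) auto

lemma mult_msum:
  "\<forall>A\<in>set As. square_dim d A \<Longrightarrow> square_dim d W \<Longrightarrow> W * msum d As = msum d (map ((*) W) As)"
  by (induction As) (auto simp: mat_distribs)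

lemma msum_mult:
  "\<forall>A\<in>set As. square_dim d A \<Longrightarrow> square_dim d W \<Longrightarrow> msum d As * W = msum d (map (\<lambda>A. A * W) As)"
  by (induction As) (auto simp: mat_distribs)

lemma smult_add_mat: "dim_row A = dim_row B \<Longrightarrow> dim_col A = dim_col B \<Longrightarrow>
    c \<cdot>\<^sub>m (A + B) = c \<cdot>\<^sub>m A + c \<cdot>\<^sub>m (B :: complex mat)"
  by (rule add_smult_distrib_left_mat) auto

lemma smult_msum:
  "\<forall>A\<in>set As. square_dim d A \<Longrightarrow> c \<cdot>\<^sub>m msum d As = msum d (map ((\<cdot>\<^sub>m) c) As)"
  by (induction As) (auto simp: smult_add_mat)

lemma msum_concat:
  "\<forall>As\<in>set Ass. \<forall>A\<in>set As. square_dim d A \<Longrightarrow> msum d (concat Ass) = msum d (map (msum d) Ass)"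
  by (induction Ass) (auto simp: msum_append)

lemma adjoint_msum:
  "\<forall>A\<in>set As. square_dim d A \<Longrightarrow> mat_adjoint (msum d As) = msum d (map mat_adjoint As)"
  by (induction As) (auto simp: mat_adjoint_add)

lemma adjoint_mprod:
  "\<forall>A\<in>set As. square_dim d A \<Longrightarrow> mat_adjoint (mprod d As) = mprod d (rev (map mat_adjoint As))"
  by (induction As) (auto simp: mat_adjoint_mult mprod_append)

lemma msum_commutator:
  assumes "\<forall>x\<in>set xs. square_dim d (T x) \<and> T x * W = W * T x + c x \<cdot>\<^sub>m W" "square_dim d W"
  shows "msum d (map T xs) * W = W * msum d (map T xs) + (\<Sum>x\<leftarrow>xs. c x) \<cdot>\<^sub>m W"
  using assms
proof (induction xs)
  case Nil
  then show ?case by (auto intro!: eq_matI)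
next
  case (Cons x xs)
  then show ?case
    by (auto simp: mat_distribs) (intro eq_matI, auto simp: algebra_simps)
qed

text \<open>\<open>W\<close> is pushed through the product one factor at a time and collects one
  scalar per factor. Strings of ladder operators use it with signs, vacuum projections and evolution
  factors with all scalars equal to 1.\<close>

lemma mprod_intertwine:
  assumes "\<forall>x\<in>set xs. square_dim d (A x) \<and> square_dim d (B x) \<and> W * A x = c x \<cdot>\<^sub>m (B x * W)"
    and "square_dim d W"
  shows "W * mprod d (map A xs) = (\<Prod>x\<leftarrow>xs. c x) \<cdot>\<^sub>m (mprod d (map B xs) * W)"
  using assms
proof (induction xs)
  case (Cons x xs)
  have "W * mprod d (map A (x # xs)) = (W * A x) * mprod d (map A xs)"
    using Cons.prems by (subst mat_assoc) auto
  also have "\<dots> = c x \<cdot>\<^sub>m (B x * (W * mprod d (map A xs)))"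
    using Cons.prems by (simp add: mat_assoc mat_distribs)
  finally show ?case using Cons by (simp add: mat_assoc mat_distribs)
qed auto

lemma prod_list_const [simp]: "(\<Prod>x\<leftarrow>xs. c) = (c :: complex) ^ length xs"
  by (induction xs) auto

lemma mprod_commute:
  assumes "\<forall>A\<in>set As. square_dim d A \<and> W * A = A * W" "square_dim d W"
  shows "W * mprod d As = mprod d As * W"
  using mprod_intertwine[where xs = As and d = d and A = "\<lambda>A. A" and B = "\<lambda>A. A" and W = W and c = "\<lambda>_. 1"] assms
  by simp

subsection \<open>Embeddings of mode algebras\<close>

lemma occ_list_less: "k \<in> set (occ_list M n) \<Longrightarrow> k < M"
  by (auto simp: occ_list_def)

lemma mode_hom_alt:
  "mode_hom M M' f X = msum (fdim M') (concat (map (\<lambda>r. map (\<lambda>c. X $$ (r, c) \<cdot>\<^sub>m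
     (mprod (fdim M') (map (\<lambda>k. cre M' (f k)) (occ_list M r)) *
      mprod (fdim M') (map (\<lambda>k. 1\<^sub>m (fdim M') - cre M' (f k) * ann M' (f k)) [0..<M]) *
      mprod (fdim M') (map (\<lambda>k. ann M' (f k)) (rev (occ_list M c)))))
        [0..<fdim M]) [0..<fdim M]))"
  by (simp add: mode_hom_def Let_def)

lemma mode_hom_dim [simp]: "dim_row (mode_hom M M' f X) = fdim M'" "dim_col (mode_hom M M' f X) = fdim M'"
  by (simp_all add: mode_hom_alt)

text \<open>Evenness is read off the matrix entries: \<open>X\<close> connects only configurations
  whose particle numbers agree modulo 2. In this form it fits the expansion of
  \<open>mode_hom\<close> into matrix units, where an entry at \<open>(r, c)\<close> comes with as
  many ladder operators as \<open>r\<close> and \<open>c\<close> have occupied modes.\<close>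

definition even_op :: "nat \<Rightarrow> complex mat \<Rightarrow> bool" where
  "even_op M X \<longleftrightarrow> (\<forall>r<fdim M. \<forall>c<fdim M. X $$ (r, c) \<noteq> 0 \<longrightarrow>
     even (length (occ_list M r) + length (occ_list M c)))"

text \<open>The placed operator is a combination of words in ladder operators, so a relation with
  the generators lifts to it. A word picks up one factor \<open>s\<close> per ladder operator; the
  vacuum projection contains them in pairs and contributes none. For \<open>s = - 1\<close> the
  remaining sign disappears on even operators. \<open>W\<close> may be a translation, the parity or
  itself a ladder operator.\<close>

lemma mode_hom_intertwine:
  assumes W: "square_dim (fdim M') W" and s: "s * s = 1"
    and cre: "\<And>k. k < M \<Longrightarrow> W * cre M' (f k) = s \<cdot>\<^sub>m (cre M' (g k) * W)"
    and ann: "\<And>k. k < M \<Longrightarrow> W * ann M' (f k) = s \<cdot>\<^sub>m (ann M' (g k) * W)"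
    and even: "s = 1 \<or> even_op M X"
  shows "W * mode_hom M M' f X = mode_hom M M' g X * W"
proof -
  define d where "d = fdim M'"
  define Cr where "Cr = (\<lambda>f r. mprod d (map (\<lambda>k. cre M' (f k)) (occ_list M r)))"
  define An where "An = (\<lambda>f c. mprod d (map (\<lambda>k. ann M' (f k)) (rev (occ_list M c))))"
  define Q where "Q = (\<lambda>f. mprod d (map (\<lambda>k. 1\<^sub>m d - cre M' (f k) * ann M' (f k)) [0..<M]))"
  have [simp]: "dim_row W = d" "dim_col W = d" using W by (auto simp: d_def)
  have [simp]: "square_dim d (Cr f r)" "square_dim d (An f r)" "square_dim d (Q f)" for f r
    by (auto simp: Cr_def An_def Q_def d_def)
  have Cr: "W * Cr f r = s ^ length (occ_list M r) \<cdot>\<^sub>m (Cr g r * W)" for r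
    unfolding Cr_def using cre
    by (subst mprod_intertwine[where c = "\<lambda>_. s" and B = "\<lambda>k. cre M' (g k)"])
      (auto simp: d_def dest: occ_list_less)
  have An: "W * An f r = s ^ length (occ_list M r) \<cdot>\<^sub>m (An g r * W)" for r
    unfolding An_def using ann
    by (subst mprod_intertwine[where c = "\<lambda>_. s" and B = "\<lambda>k. ann M' (g k)"])
      (auto simp: d_def dest: occ_list_less)
  have "W * (1\<^sub>m d - cre M' (f k) * ann M' (f k)) = (1\<^sub>m d - cre M' (g k) * ann M' (g k)) * W"
    if "k < M" for k
  proof -
    have "W * (cre M' (f k) * ann M' (f k)) = (s \<cdot>\<^sub>m (cre M' (g k) * W)) * ann M' (f k)"
      using cre[OF that] W by (simp flip: mat_assoc)
    also have "\<dots> = s \<cdot>\<^sub>m (cre M' (g k) * (W * ann M' (f k)))"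
      using W by (simp add: mat_distribs mat_assoc)
    also have "\<dots> = cre M' (g k) * ann M' (g k) * W"
      using W s ann[OF that] by (simp add: mat_distribs mat_assoc)
    finally show ?thesis using W by (simp add: mat_distribs d_def)
  qed
  then have Q: "W * Q f = Q g * W"
    unfolding Q_def
    by (subst mprod_intertwine[where c = "\<lambda>_. 1" and B = "\<lambda>k. 1\<^sub>m d - cre M' (g k) * ann M' (g k)"])
      (auto simp: d_def)
  have move: "W * (Cr f r * Q f * An f c) = s ^ (length (occ_list M r) + length (occ_list M c)) \<cdot>\<^sub>m (Cr g r * Q g * An g c * W)" for r c
  proof -
    have "W * (Cr f r * Q f * An f c) = (W * Cr f r) * (Q f * An f c)" by (simp add: mat_assoc)
    also have "\<dots> = s ^ length (occ_list M r) \<cdot>\<^sub>m (Cr g r * ((W * Q f) * An f c))"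
      by (simp add: Cr mat_assoc mat_distribs)
    also have "\<dots> = s ^ length (occ_list M r) \<cdot>\<^sub>m (Cr g r * (Q g * (W * An f c)))"
      by (simp add: Q mat_assoc)
    finally show ?thesis by (simp add: An mat_assoc mat_distribs power_add mult.commute)
  qed
  have summand: "W * (X $$ (r, c) \<cdot>\<^sub>m (Cr f r * Q f * An f c)) = X $$ (r, c) \<cdot>\<^sub>m (Cr g r * Q g * An g c) * W"
    if "r < fdim M" "c < fdim M" for r c
  proof (cases "X $$ (r, c) = 0")
    case True
    then show ?thesis by (intro eq_matI) (auto simp: scalar_prod_def)
  next
    case False
    then have "s ^ (length (occ_list M r) + length (occ_list M c)) = 1"
    proof -
      have "s ^ n = 1" if "even n" for n
        using that s by (auto elim!: evenE simp: power_mult power2_eq_square)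
      then show ?thesis using even that False unfolding even_op_def by (cases "s = 1") auto
    qed
    then show ?thesis
      by (simp add: mat_distribs move)
  qed
  have expand: "mode_hom M M' f X = msum d (concat (map (\<lambda>r. map (\<lambda>c.
      X $$ (r, c) \<cdot>\<^sub>m (Cr f r * Q f * An f c)) [0..<fdim M]) [0..<fdim M]))" for f
    by (simp add: mode_hom_alt Cr_def An_def Q_def d_def)
  show ?thesis
    unfolding expand
    by (subst mult_msum, simp, simp, subst msum_mult, simp, simp)
      (auto simp: map_concat o_def summand intro!: arg_cong[where f = "\<lambda>xs. msum d (concat xs)"])
qed

section \<open>Basis configurations as strings of creators on the vacuum\<close>

lemma cre_unit_vec:
  assumes "k < M" "m < fdim M" "\<And>j. j \<le> k \<Longrightarrow> \<not> bit m j"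
  shows "cre M k *\<^sub>v unit_vec (fdim M) m = unit_vec (fdim M) (flip_bit k m)"
proof (rule eq_vecI)
  fix x assume "x < dim_vec (unit_vec (fdim M) (flip_bit k m) :: complex vec)"
  then have x: "x < fdim M" by simp
  have "{j. j < k \<and> bit m j} = {}" using assms(3) by auto
  then have "jw_sign m k = 1" unfolding jw_sign_def occ_bit by (simp only: card.empty power_0)
  moreover have "flip_bit k x = m \<longleftrightarrow> x = flip_bit k m" by auto
  ultimately show "(cre M k *\<^sub>v unit_vec (fdim M) m) $ x = (unit_vec (fdim M) (flip_bit k m) :: complex vec) $ x"
    using assms x by (auto simp: cre_vec jw_sign_flip simp del: index_mult_mat_vec)
qed auto

lemma bit_foldr_flip: "distinct xs \<Longrightarrow> bit (foldr flip_bit xs (m :: nat)) j \<longleftrightarrow> (j \<in> set xs) \<noteq> bit m j"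
  by (induction xs) auto

lemma foldr_flip_less: "\<forall>k\<in>set xs. k < M \<Longrightarrow> m < fdim M \<Longrightarrow> foldr flip_bit xs m < fdim M"
  by (induction xs) auto

text \<open>The rightmost creator, which acts first, belongs to the largest mode. Each later creator
  therefore sees only occupied modes above its own, and every Jordan-Wigner sign is 1.\<close>

lemma cre_list_unit_vec:
  assumes "sorted_wrt (<) xs" "\<forall>k\<in>set xs. k < M" "m < fdim M"
    and "\<And>j k. k \<in> set xs \<Longrightarrow> j \<le> k \<Longrightarrow> \<not> bit m j"
  shows "mprod (fdim M) (map (cre M) xs) *\<^sub>v unit_vec (fdim M) m = unit_vec (fdim M) (foldr flip_bit xs m)"
  using assms
proof (induction xs)
  case Nil
  then show ?case by (simp add: one_mat_vec)
next
  case (Cons k xs)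
  have "distinct xs" using Cons.prems(1) strict_sorted_iff by auto
  then have "\<not> bit (foldr flip_bit xs m) j" if "j \<le> k" for j
    using Cons.prems(1,4) that by (auto simp: bit_foldr_flip)
  then have "cre M k *\<^sub>v unit_vec (fdim M) (foldr flip_bit xs m) = unit_vec (fdim M) (foldr flip_bit (k # xs) m)"
    using Cons.prems by (simp add: cre_unit_vec foldr_flip_less)
  moreover have "mprod (fdim M) (map (cre M) xs) *\<^sub>v unit_vec (fdim M) m = unit_vec (fdim M) (foldr flip_bit xs m)"
    using Cons.prems by (intro Cons.IH) auto
  ultimately show ?case by (simp add: mat_vec_assoc)
qed

lemma occ_list_sorted [simp]: "sorted_wrt (<) (occ_list M n)" and occ_list_distinct [simp]: "distinct (occ_list M n)"
  by (auto simp: occ_list_def sorted_wrt_filter)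

lemma set_occ_list: "set (occ_list M n) = {k. k < M \<and> bit n k}"
  by (auto simp: occ_list_def occ_bit)

text \<open>Through this representation an operator is determined by its exchange relations with
  creators and its value on the vacuum.\<close>

lemma unit_vec_cre_vacuum:
  assumes "n < fdim M"
  shows "unit_vec (fdim M) n = mprod (fdim M) (map (cre M) (occ_list M n)) *\<^sub>v vacuum M"
proof -
  have "foldr flip_bit (occ_list M n) 0 = n"
    using bit_less_fdim[OF assms] by (intro bit_eqI) (auto simp: bit_foldr_flip set_occ_list)
  then show ?thesis
    unfolding vacuum_def by (subst cre_list_unit_vec) (auto simp: set_occ_list fdim_def)
qed

lemma vacuum_dim [simp]: "dim_vec (vacuum M) = fdim M"
  by (simp add: vacuum_def)

lemma hole_vec:
  assumes "k < M" "dim_vec v = fdim M" "x < fdim M"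
  shows "((1\<^sub>m (fdim M) - cre M k * ann M k) *\<^sub>v v) $ x = (if bit x k then 0 else v $ x)"
  using assms number_vec[OF assms] by (simp add: minus_mat_vec one_mat_vec del: index_mult_mat_vec)

lemma empty_projection_vec:
  assumes "\<forall>k\<in>set xs. k < M" "dim_vec v = fdim M" "x < fdim M"
  shows "(mprod (fdim M) (map (\<lambda>k. 1\<^sub>m (fdim M) - cre M k * ann M k) xs) *\<^sub>v v) $ x =
    (if \<exists>k\<in>set xs. bit x k then 0 else v $ x)"
  using assms(1)
proof (induction xs)
  case Nil
  then show ?case using assms by (simp add: one_mat_vec del: index_mult_mat_vec)
next
  case (Cons k xs)
  then show ?case using assms(2,3)
    by (simp add: mat_vec_assoc hole_vec del: index_mult_mat_vec)
qed

lemma mat_entry_unit_vec: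
  "i < dim_row A \<Longrightarrow> j < dim_col A \<Longrightarrow> A $$ (i, j) = (A *\<^sub>v unit_vec (dim_col A) j) $ i"
  for A :: "complex mat"
  by simp

lemma empty_projection_eq:
  assumes "M \<le> M'"
  shows "mprod (fdim M') (map (\<lambda>k. 1\<^sub>m (fdim M') - cre M' k * ann M' k) [0..<M]) =
    mat (fdim M') (fdim M') (\<lambda>(i, j). if i = j \<and> take_bit M i = 0 then 1 else 0)"
proof (rule eq_matI, goal_cases)
  case (1 i j)
  have "take_bit M i = 0 \<longleftrightarrow> (\<forall>k<M. \<not> bit i k)"
    by (auto simp: bit_eq_iff bit_simps)
  then show ?case using 1 assms
    by (subst mat_entry_unit_vec) (auto simp: empty_projection_vec simp del: index_mult_mat_vec)
qed auto

text \<open>Inclusion of the first modes respects the Jordan-Wigner ordering, so no signs appear.\<close>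

lemma mode_hom_inclusion:
  assumes M: "M \<le> M'"
  shows "mode_hom M M' (\<lambda>k. k) X = mat (fdim M') (fdim M')
    (\<lambda>(i, j). if drop_bit M i = drop_bit M j then X $$ (take_bit M i, take_bit M j) else 0)"
proof -
  define d where "d = fdim M'"
  define Cr where "Cr = (\<lambda>r. mprod d (map (cre M') (occ_list M r)))"
  define An where "An = (\<lambda>c. mprod d (map (ann M') (rev (occ_list M c))))"
  define Q where "Q = mprod d (map (\<lambda>k. 1\<^sub>m d - cre M' k * ann M' k) [0..<M])"
  have Q: "Q = mat d d (\<lambda>(i, j). if i = j \<and> take_bit M i = 0 then 1 else 0)"
    unfolding Q_def d_def by (rule empty_projection_eq[OF M])
  have [simp]: "square_dim d (Cr r)" "square_dim d (An r)" "square_dim d Q" for r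
    by (auto simp: Cr_def An_def Q_def d_def)
  have Q_adj: "mat_adjoint Q = Q" by (intro eq_matI) (auto simp: Q)
  have QQ: "Q * Q = Q"
  proof (rule eq_matI)
    fix i j assume "i < dim_row Q" "j < dim_col Q"
    then have ij: "i < d" "j < d" by auto
    then have "(Q * Q) $$ (i, j) = (\<Sum>l<d. if l = j then Q $$ (i, j) else 0)"
      by (subst mat_mult_entry, simp, simp, simp, intro sum.cong) (auto simp: Q)
    then show "(Q * Q) $$ (i, j) = Q $$ (i, j)" using ij by simp
  qed auto
  have Cr_adj: "mat_adjoint (Cr r) = An r" for r
    unfolding Cr_def An_def by (subst adjoint_mprod) (auto simp: d_def rev_map o_def)
  \<comment> \<open>\<open>Q\<close> keeps only configurations whose first \<open>M\<close> modes
    are empty, and the creators then fill in the pattern \<open>r\<close> there. All other occupied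
    modes lie above, so no sign arises.\<close>
  have CrQ: "(Cr r * Q) $$ (i, l) = (if take_bit M l = 0 \<and> take_bit M i = r \<and> drop_bit M i = drop_bit M l then 1 else 0)"
    if "r < fdim M" "i < d" "l < d" for r i l
  proof -
    have "(Cr r * Q) $$ (i, l) = (Cr r *\<^sub>v (Q *\<^sub>v unit_vec d l)) $ i"
      using that by (subst mat_entry_unit_vec) (auto simp: mat_vec_assoc simp del: index_mult_mat_vec)
    also have "Q *\<^sub>v unit_vec d l = (if take_bit M l = 0 then unit_vec d l else 0\<^sub>v d)"
      using that by (intro eq_vecI) (auto simp: Q)
    finally have *: "(Cr r * Q) $$ (i, l) = (if take_bit M l = 0 then (Cr r *\<^sub>v unit_vec d l) $ i else 0)"
      using that by (auto simp: scalar_prod_def)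
    show ?thesis
    proof (cases "take_bit M l = 0")
      case True
      then have l: "\<not> bit l j" if "j < M" for j using that by (auto simp: bit_eq_iff bit_simps)
      have "Cr r *\<^sub>v unit_vec d l = unit_vec d (foldr flip_bit (occ_list M r) l)"
        unfolding Cr_def d_def using that M l
        by (intro cre_list_unit_vec) (auto simp: set_occ_list d_def)
      moreover have "foldr flip_bit (occ_list M r) l = i \<longleftrightarrow> take_bit M i = r \<and> drop_bit M i = drop_bit M l"
      proof -
        have "take_bit M i = r \<longleftrightarrow> (\<forall>j<M. bit i j = bit r j)"
          using bit_less_fdim[OF that(1)] by (auto simp: bit_eq_iff bit_simps)
        moreover have "drop_bit M i = drop_bit M l \<longleftrightarrow> (\<forall>j\<ge>M. bit i j = bit l j)"
          by (auto simp: bit_eq_iff bit_simps) (metis le_add_diff_inverse)+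
        moreover have "bit (foldr flip_bit (occ_list M r) l) j = (if j < M then bit r j else bit l j)" for j
          using l bit_less_fdim[OF that(1)] by (auto simp: bit_foldr_flip set_occ_list)
        then have "foldr flip_bit (occ_list M r) l = i \<longleftrightarrow> (\<forall>j. bit i j = (if j < M then bit r j else bit l j))"
          by (auto simp: bit_eq_iff)
        ultimately show ?thesis by (auto simp: not_less)
      qed
      moreover have "foldr flip_bit (occ_list M r) l < d"
        unfolding d_def using M that by (intro foldr_flip_less) (auto simp: set_occ_list d_def)
      ultimately show ?thesis using * True that by (auto simp del: index_mult_mat(1))
    qed (use * in \<open>auto simp del: index_mult_mat(1)\<close>)
  qed
  have unit: "(Cr r * Q * An c) $$ (i, j) =
      (if take_bit M i = r \<and> take_bit M j = c \<and> drop_bit M i = drop_bit M j then 1 else 0)"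
    if "r < fdim M" "c < fdim M" "i < d" "j < d" for r c i j
  proof -
    \<comment> \<open>The only intermediate configuration that contributes: \<open>i\<close> with
      its first \<open>M\<close> modes emptied.\<close>
    define l where "l = push_bit M (drop_bit M i)"
    have "l \<le> i" by (simp add: l_def push_bit_eq_mult drop_bit_eq_div)
    then have ld: "l < d" using that by simp
    have uniq: "take_bit M k = 0 \<and> drop_bit M i = drop_bit M k \<longleftrightarrow> k = l" for k
      using div_mult_mod_eq[of k "2 ^ M"]
      by (auto simp: l_def take_bit_eq_mod drop_bit_eq_div push_bit_eq_mult)
    \<comment> \<open>\<open>An c\<close> is the adjoint of \<open>Cr c\<close> and \<open>Q\<close>
      is a projection, so the placed matrix unit factors into two operators whose entries are given
      by \<open>CrQ\<close>.\<close>
    have "Cr r * Q * An c = (Cr r * Q) * mat_adjoint (Cr c * Q)"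
    proof -
      have "(Cr r * Q) * mat_adjoint (Cr c * Q) = Cr r * (Q * Q) * An c"
        by (simp add: mat_adjoint_mult Q_adj Cr_adj mat_assoc)
      then show ?thesis by (simp add: QQ)
    qed
    then have "(Cr r * Q * An c) $$ (i, j) = ((Cr r * Q) * mat_adjoint (Cr c * Q)) $$ (i, j)"
      by (rule arg_cong)
    also have "\<dots> = (\<Sum>k<d. (Cr r * Q) $$ (i, k) * mat_adjoint (Cr c * Q) $$ (k, j))"
      using that by (subst mat_mult_entry) (auto simp del: index_mult_mat(1))
    also have "\<dots> = (\<Sum>k<d. (Cr r * Q) $$ (i, k) * cnj ((Cr c * Q) $$ (j, k)))"
      using that by (intro sum.cong) (auto simp del: index_mult_mat(1))
    also have "\<dots> = (\<Sum>k<d. if k = l then (if take_bit M i = r \<and> take_bit M j = c \<and> drop_bit M i = drop_bit M j then 1 else 0) else 0)"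
    proof (intro sum.cong refl)
      fix k assume "k \<in> {..<d}"
      then have "(Cr r * Q) $$ (i, k) * cnj ((Cr c * Q) $$ (j, k)) =
          (if take_bit M k = 0 \<and> drop_bit M i = drop_bit M k then
            if take_bit M i = r \<and> take_bit M j = c \<and> drop_bit M i = drop_bit M j then 1 else 0 else 0)"
        using that by (simp add: CrQ del: index_mult_mat(1))
      then show "(Cr r * Q) $$ (i, k) * cnj ((Cr c * Q) $$ (j, k)) =
          (if k = l then if take_bit M i = r \<and> take_bit M j = c \<and> drop_bit M i = drop_bit M j then 1 else 0 else 0)"
        unfolding uniq .
    qed
    finally show ?thesis using ld by simp
  qed
  have expand: "mode_hom M M' (\<lambda>k. k) X = msum d (concat (map (\<lambda>r. map (\<lambda>c.
      X $$ (r, c) \<cdot>\<^sub>m (Cr r * Q * An c)) [0..<fdim M]) [0..<fdim M]))"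
    by (simp add: mode_hom_alt Cr_def An_def Q_def d_def)
  show ?thesis
  proof (rule eq_matI, goal_cases)
    case (1 i j)
    then have ij: "i < d" "j < d" by (auto simp: d_def)
    have tb: "take_bit M k < fdim M" for k :: nat by (simp add: fdim_def)
    have "mode_hom M M' (\<lambda>k. k) X $$ (i, j) =
        (\<Sum>r\<leftarrow>[0..<fdim M]. \<Sum>c\<leftarrow>[0..<fdim M]. X $$ (r, c) * (Cr r * Q * An c) $$ (i, j))"
      unfolding expand using ij by (subst msum_concat) (auto simp: msum_index o_def simp del: index_mult_mat(1))
    also have "\<dots> = (\<Sum>r<fdim M. \<Sum>c<fdim M. X $$ (r, c) * (Cr r * Q * An c) $$ (i, j))"
      by (simp add: interv_sum_list_conv_sum_set_nat lessThan_atLeast0)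
    also have "\<dots> = (\<Sum>r<fdim M. \<Sum>c<fdim M. if c = take_bit M j then if r = take_bit M i then
        if drop_bit M i = drop_bit M j then X $$ (r, c) else 0 else 0 else 0)"
      using ij by (intro sum.cong refl) (auto simp: unit simp del: index_mult_mat(1))
    also have "\<dots> = (if drop_bit M i = drop_bit M j then X $$ (take_bit M i, take_bit M j) else 0)"
      using tb by (simp add: sum.delta)
    finally show ?case using 1 by simp
  qed auto
qed

section \<open>Unitary exponentials and graded commutators\<close>

lemma smult_zero_mat [simp]: "0 \<cdot>\<^sub>m A = (0\<^sub>m (dim_row A) (dim_col A) :: complex mat)"
  by (intro eq_matI) auto

lemma mexp_inverse:
  assumes "square_dim d A"
  shows "mexp (s \<cdot>\<^sub>m A) * mexp ((- s) \<cdot>\<^sub>m A) = 1\<^sub>m d"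
  using assms by (simp add: mexp_smult_add[of A d])

lemma mexp_i_hermitian_adjoint:
  assumes "square_dim d A" "mat_adjoint A = A"
  shows "mat_adjoint (mexp ((\<i> * of_real s) \<cdot>\<^sub>m A)) = mexp ((- (\<i> * of_real s)) \<cdot>\<^sub>m A)"
  using assms by (simp add: mexp_adjoint[of _ d] mat_adjoint_smult)

lemma mexp_i_hermitian_unitary:
  assumes "square_dim d A" "mat_adjoint A = A"
  shows "mexp ((\<i> * of_real s) \<cdot>\<^sub>m A) * mat_adjoint (mexp ((\<i> * of_real s) \<cdot>\<^sub>m A)) = 1\<^sub>m d"
    and "mat_adjoint (mexp ((\<i> * of_real s) \<cdot>\<^sub>m A)) * mexp ((\<i> * of_real s) \<cdot>\<^sub>m A) = 1\<^sub>m d"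
  using mexp_inverse[OF assms(1), of "\<i> * of_real s"] mexp_inverse[OF assms(1), of "- (\<i> * of_real s)"]
  unfolding mexp_i_hermitian_adjoint[OF assms] by simp_all

text \<open>Taking adjoints reverses the relation, and unitarity of \<open>W\<close> turns it back;
  the scalar survives because it is real. Rules for annihilators thus follow from those for
  creators.\<close>

lemma unitary_intertwine_adjoint:
  assumes [simp]: "square_dim d W" "square_dim d A" "square_dim d B"
    and U: "W * mat_adjoint W = 1\<^sub>m d" "mat_adjoint W * W = 1\<^sub>m d"
    and comm: "W * A = s \<cdot>\<^sub>m (B * W)" and s: "cnj s = s"
  shows "W * mat_adjoint A = s \<cdot>\<^sub>m (mat_adjoint B * W)"
proof -
  have adj: "mat_adjoint A * mat_adjoint W = s \<cdot>\<^sub>m (mat_adjoint W * mat_adjoint B)"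
    using arg_cong[OF comm, of mat_adjoint] s by (simp add: mat_adjoint_mult mat_adjoint_smult)
  have "W * mat_adjoint A = W * ((mat_adjoint A * mat_adjoint W) * W)"
    by (simp add: mat_assoc U)
  also have "\<dots> = s \<cdot>\<^sub>m ((W * mat_adjoint W) * (mat_adjoint B * W))"
    unfolding adj by (simp add: mat_assoc mat_distribs)
  finally show ?thesis by (simp add: U)
qed

lemma mexp_commute:
  assumes "square_dim d A" "square_dim d W" "A * W = W * A"
  shows "mexp (c \<cdot>\<^sub>m A) * W = W * mexp (c \<cdot>\<^sub>m A)"
  using assms by (intro mexp_intertwine[of _ d]) (auto simp: mat_distribs)

text \<open>The commutator of \<open>B * A\<close> with \<open>W\<close> equals \<open>B\<close>
  times the anticommutator of \<open>A\<close> and \<open>W\<close>, minus the anticommutator of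
  \<open>B\<close> and \<open>W\<close> times \<open>A\<close>. The remainder is a multiple of
  \<open>B\<close>; where \<open>c\<close> is nonzero the applications have \<open>B\<close> equal
  to \<open>W\<close>, which gives a ladder relation.\<close>

lemma number_commutator:
  assumes [simp]: "square_dim d A" "square_dim d B" "square_dim d W"
    and AW: "A * W + W * A = c \<cdot>\<^sub>m 1\<^sub>m d" and BW: "B * W + W * B = 0 \<cdot>\<^sub>m 1\<^sub>m d"
  shows "(B * A) * W = W * (B * A) + c \<cdot>\<^sub>m B"
proof -
  have swap: "X = Z + (- 1) \<cdot>\<^sub>m Y" if "X + Y = Z" "square_dim d X" "square_dim d Y" for X Y Z :: "complex mat"
    using that by (intro eq_matI) auto
  have "(B * A) * W = B * (A * W)" by (simp add: mat_assoc)
  also have "\<dots> = B * (c \<cdot>\<^sub>m 1\<^sub>m d + (- 1) \<cdot>\<^sub>m (W * A))" by (subst swap[OF AW]) auto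
  also have "\<dots> = c \<cdot>\<^sub>m B + (- 1) \<cdot>\<^sub>m ((B * W) * A)" by (simp add: mat_distribs mat_assoc)
  also have "B * W = 0 \<cdot>\<^sub>m 1\<^sub>m d + (- 1) \<cdot>\<^sub>m (W * B)" by (subst swap[OF BW]) auto
  also have "\<dots> = (- 1) \<cdot>\<^sub>m (W * B)" by (intro eq_matI) auto
  finally have "(B * A) * W = c \<cdot>\<^sub>m B + W * (B * A)" by (simp add: mat_distribs mat_assoc)
  also have "\<dots> = W * (B * A) + c \<cdot>\<^sub>m B" by (rule comm_add_mat) auto
  finally show ?thesis .
qed

lemma add_mat_swap:
  assumes "square_dim d A" "square_dim d B" "square_dim d C" "square_dim d D"
  shows "(A + B) + (C + D) = (A + C) + (B + D)"
  using assms by (intro eq_matI) auto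

lemma msum_anticommutator:
  assumes "\<forall>x\<in>set xs. square_dim d (A x) \<and> A x * W + W * A x = c x \<cdot>\<^sub>m 1\<^sub>m d" "square_dim d W"
  shows "msum d (map A xs) * W + W * msum d (map A xs) = (\<Sum>x\<leftarrow>xs. c x) \<cdot>\<^sub>m 1\<^sub>m d"
  using assms
proof (induction xs)
  case (Cons x xs)
  have "msum d (map A (x # xs)) * W + W * msum d (map A (x # xs)) =
      (A x * W + W * A x) + (msum d (map A xs) * W + W * msum d (map A xs))"
    using Cons.prems by (subst add_mat_swap[where d = d and A = "A x * W" and B = "W * A x"]) (auto simp: mat_distribs)
  also have "\<dots> = c x \<cdot>\<^sub>m 1\<^sub>m d + (\<Sum>x\<leftarrow>xs. c x) \<cdot>\<^sub>m 1\<^sub>m d"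
    using Cons by simp
  finally show ?case by (simp add: add_smult_distrib_right_mat[of _ d d])
qed auto

lemma msum_mult_vec_zero:
  assumes "\<forall>A\<in>set As. square_dim d A \<and> A *\<^sub>v v = 0\<^sub>v d" "dim_vec v = d"
  shows "msum d As *\<^sub>v v = 0\<^sub>v d"
  using assms by (induction As) (auto simp: add_mat_vec)

lemma ann_vacuum [simp]: "k < M \<Longrightarrow> ann M k *\<^sub>v vacuum M = 0\<^sub>v (fdim M)"
proof (rule eq_vecI)
  fix x assume "k < M" "x < dim_vec (0\<^sub>v (fdim M) :: complex vec)"
  moreover have "flip_bit k x \<noteq> 0" if "\<not> bit x k"
    using that by (metis bit_0_eq bit_flip_bit_nat bot_apply bot_bool_def)
  ultimately show "(ann M k *\<^sub>v vacuum M) $ x = 0\<^sub>v (fdim M) $ x"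
    by (auto simp: ann_vec vacuum_def simp del: index_mult_mat_vec)
qed auto

text \<open>This evaluates \<open>W\<close> on a basis configuration without knowing its matrix. The
  string of moved creators need not be increasing, so a reordering sign may still have to be
  extracted.\<close>

lemma cre_list_intertwine_vacuum:
  assumes W: "square_dim (fdim M) W" and vac: "W *\<^sub>v vacuum M = vacuum M"
    and cre: "\<forall>k\<in>set xs. W * cre M k = c k \<cdot>\<^sub>m (cre M (\<sigma> k) * W)"
  shows "W *\<^sub>v (mprod (fdim M) (map (cre M) xs) *\<^sub>v vacuum M) =
    (\<Prod>k\<leftarrow>xs. c k) \<cdot>\<^sub>v (mprod (fdim M) (map (cre M) (map \<sigma> xs)) *\<^sub>v vacuum M)"
proof -
  have "W *\<^sub>v (mprod (fdim M) (map (cre M) xs) *\<^sub>v vacuum M) = (W * mprod (fdim M) (map (cre M) xs)) *\<^sub>v vacuum M"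
    using W by (simp add: mat_vec_assoc)
  also have "W * mprod (fdim M) (map (cre M) xs) =
      (\<Prod>k\<leftarrow>xs. c k) \<cdot>\<^sub>m (mprod (fdim M) (map (\<lambda>k. cre M (\<sigma> k)) xs) * W)"
    using assms by (intro mprod_intertwine) auto
  finally show ?thesis using W vac by (simp add: smult_mat_vec mat_vec_assoc o_def)
qed

lemma ann_cre_anticommutator:
  assumes "j < M" "k < M"
  shows "ann M j * cre M k + cre M k * ann M j = (if j = k then 1 else 0) \<cdot>\<^sub>m 1\<^sub>m (fdim M)"
  using assms by (cases "j = k") (auto simp: ann_cre_same ann_cre intro!: eq_matI)

lemma cre_cre_anticommutator:
  assumes "j < M" "k < M"
  shows "cre M j * cre M k + cre M k * cre M j = 0 \<cdot>\<^sub>m 1\<^sub>m (fdim M)"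
  by (subst cre_cre[OF assms]) (auto intro!: eq_matI)

subsection \<open>Parity\<close>

lemma num_total_msum: "num_total M = msum (fdim M) (map (\<lambda>k. cre M k * ann M k) [0..<M])"
  by (simp add: num_total_def msum_def)

lemma num_total_dim [simp]: "dim_row (num_total M) = fdim M" "dim_col (num_total M) = fdim M"
  by (auto simp: num_total_msum)

lemma parity_dim [simp]: "dim_row (parity M) = fdim M" "dim_col (parity M) = fdim M"
  by (auto simp: parity_def)

lemma num_total_hermitian: "mat_adjoint (num_total M) = num_total M"
  unfolding num_total_msum by (subst adjoint_msum) (auto simp: o_def mat_adjoint_mult)

lemma num_total_cre:
  assumes "k < M"
  shows "num_total M * cre M k = cre M k * num_total M + 1 \<cdot>\<^sub>m cre M k"
proof -
  have "(\<Sum>j\<leftarrow>[0..<M]. if j = k then 1 else 0) = (1 :: complex)"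
    using assms by (simp add: interv_sum_list_conv_sum_set_nat)
  moreover have "num_total M * cre M k = cre M k * num_total M +
      (\<Sum>j\<leftarrow>[0..<M]. if j = k then 1 else 0) \<cdot>\<^sub>m cre M k"
    unfolding num_total_msum
  proof (intro msum_commutator ballI conjI)
    fix j assume "j \<in> set [0..<M]"
    then have "(cre M j * ann M j) * cre M k = cre M k * (cre M j * ann M j) + (if j = k then 1 else 0) \<cdot>\<^sub>m cre M j"
      using assms by (intro number_commutator[of _ "fdim M"] ann_cre_anticommutator cre_cre_anticommutator) auto
    then show "(cre M j * ann M j) * cre M k = cre M k * (cre M j * ann M j) + (if j = k then 1 else 0) \<cdot>\<^sub>m cre M k"
      by (cases "j = k") simp_all
  qed auto
  ultimately show ?thesis by simp
qed

lemma parity_cre: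
  assumes "k < M"
  shows "parity M * cre M k = (- 1) \<cdot>\<^sub>m (cre M k * parity M)"
  unfolding parity_def
  using mexp_ladder[OF _ _ _ _ num_total_cre[OF assms], of "fdim M" "\<i> * pi"] by (simp add: exp_pi_i)

lemma parity_unitary: "parity M * mat_adjoint (parity M) = 1\<^sub>m (fdim M)" "mat_adjoint (parity M) * parity M = 1\<^sub>m (fdim M)"
  unfolding parity_def by (rule mexp_i_hermitian_unitary; simp add: num_total_hermitian)+

lemma parity_ann:
  assumes "k < M"
  shows "parity M * ann M k = (- 1) \<cdot>\<^sub>m (ann M k * parity M)"
  using unitary_intertwine_adjoint[OF _ _ _ parity_unitary parity_cre[OF assms]] by simp

lemma parity_vacuum [simp]: "parity M *\<^sub>v vacuum M = vacuum M"
  unfolding parity_def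
proof (rule mexp_fixes_kernel[of _ "fdim M"])
  have "num_total M *\<^sub>v vacuum M = 0\<^sub>v (fdim M)"
    unfolding num_total_msum by (rule msum_mult_vec_zero) (auto simp: mat_vec_assoc scalar_prod_def intro!: eq_vecI)
  then show "((\<i> * pi) \<cdot>\<^sub>m num_total M) *\<^sub>v vacuum M = 0\<^sub>v (fdim M)"
    by (simp add: smult_mat_vec) (intro eq_vecI, auto)
qed auto

lemma parity_unit_vec:
  assumes "n < fdim M"
  shows "parity M *\<^sub>v unit_vec (fdim M) n = (- 1) ^ length (occ_list M n) \<cdot>\<^sub>v unit_vec (fdim M) n"
proof -
  have "parity M *\<^sub>v (mprod (fdim M) (map (cre M) (occ_list M n)) *\<^sub>v vacuum M) =
    (\<Prod>k\<leftarrow>occ_list M n. - 1) \<cdot>\<^sub>v (mprod (fdim M) (map (cre M) (map (\<lambda>k. k) (occ_list M n))) *\<^sub>v vacuum M)"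
    by (intro cre_list_intertwine_vacuum ballI parity_cre) (auto dest: occ_list_less)
  then show ?thesis by (simp add: unit_vec_cre_vacuum[OF assms])
qed

lemma parity_eq: "parity M = mat (fdim M) (fdim M) (\<lambda>(i, j). if i = j then (- 1) ^ length (occ_list M i) else 0)"
proof (rule eq_matI, goal_cases)
  case (1 i j)
  then have "parity M $$ (i, j) = (parity M *\<^sub>v unit_vec (fdim M) j) $ i" by simp
  with 1 show ?case by (auto simp: parity_unit_vec simp del: index_mult_mat_vec)
qed auto

text \<open>Parity is diagonal with entries 1 and -1, so comparing the entries at
  \<open>(r, c)\<close> of both products forces equal signs at \<open>r\<close> and \<open>c\<close>
  wherever \<open>X\<close> does not vanish.\<close>

lemma even_opI:
  assumes X: "square_dim (fdim M) X" and comm: "X * parity M = parity M * X"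
  shows "even_op M X"
  unfolding even_op_def
proof (intro allI impI)
  fix r c assume rc: "r < fdim M" "c < fdim M" and nz: "X $$ (r, c) \<noteq> 0"
  let ?p = "\<lambda>n. (- 1 :: complex) ^ length (occ_list M n)"
  have right: "(X * parity M) $$ (r, c) = (\<Sum>l<fdim M. if l = c then X $$ (r, c) * ?p c else 0)"
    using X rc by (subst mat_mult_entry, simp, simp, simp, intro sum.cong) (auto simp: parity_eq)
  have left: "(parity M * X) $$ (r, c) = (\<Sum>l<fdim M. if l = r then ?p r * X $$ (r, c) else 0)"
    using X rc by (subst mat_mult_entry, simp, simp, simp, intro sum.cong) (auto simp: parity_eq)
  have "X $$ (r, c) * ?p c = (X * parity M) $$ (r, c)" using right rc by simp
  also have "\<dots> = ?p r * X $$ (r, c)" using left rc unfolding comm by simp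
  finally have "X $$ (r, c) * ?p c = ?p r * X $$ (r, c)" .
  then have "?p c = ?p r" using nz by simp
  then show "even (length (occ_list M r) + length (occ_list M c))"
    by (cases "even (length (occ_list M r))"; cases "even (length (occ_list M c))") auto
qed

subsection \<open>Time translations\<close>

text \<open>For \<open>t < N\<close> these are the entries of the antiperiodic discrete Fourier
  matrix, which is unitary. The argument \<open>t = N\<close> is meaningful too: the value there
  carries the boundary sign.\<close>

definition fcoef :: "nat \<Rightarrow> real \<Rightarrow> nat \<Rightarrow> nat \<Rightarrow> complex" where
  "fcoef N \<epsilon> n t = exp (\<i> * of_real (omega N \<epsilon> n * \<epsilon> * real t)) / of_real (sqrt (real N))"

text \<open>A geometric sum whose ratio is an \<open>N\<close>-th root of unity. The bound on
  \<open>k\<close> excludes the nonzero multiples of \<open>N\<close>, for which the ratio would be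
  1 as well.\<close>

lemma sum_roots_of_unity:
  fixes k :: int
  assumes "\<bar>k\<bar> < int N"
  shows "(\<Sum>t<N. cis (2 * pi * of_int k / real N) ^ t) = (if k = 0 then of_nat N else 0)"
proof (cases "k = 0")
  case False
  let ?z = "cis (2 * pi * of_int k / real N)"
  have "?z \<noteq> 1"
  proof
    assume "?z = 1"
    then have "cos (2 * pi * of_int k / real N) = 1" by (simp add: complex_eq_iff)
    then obtain m :: int where "2 * pi * of_int k / real N = of_int m * 2 * pi"
      by (auto simp: cos_one_2pi_int)
    then have "real_of_int k = of_int (m * int N)" using assms by (auto simp: field_simps)
    then have k: "k = m * int N" by linarith
    with False have "m \<noteq> 0" by auto
    then have "int N \<le> \<bar>m\<bar> * int N" using mult_right_mono[of 1 "\<bar>m\<bar>" "int N"] by simp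
    then show False using assms k by (simp add: abs_mult)
  qed
  moreover have "?z ^ N = 1"
    using assms cis_multiple_2pi[of "of_int k"] by (auto simp: DeMoivre)
  ultimately show ?thesis using False by (simp add: geometric_sum)
qed auto

lemma fcoef_cis:
  assumes "\<epsilon> > 0" "N \<ge> 1"
  shows "fcoef N \<epsilon> n t = cis ((2 * real n + 1) * pi * real t / real N) / of_real (sqrt (real N))"
proof -
  have "omega N \<epsilon> n * \<epsilon> * real t = (2 * real n + 1) * pi * real t / real N"
    using assms by (simp add: omega_def)
  then show ?thesis unfolding fcoef_def by (simp only: cis_conv_exp)
qed

lemma fcoef_orthogonal_time:
  assumes "\<epsilon> > 0" "N \<ge> 1" "n < N" "m < N"
  shows "(\<Sum>t<N. cnj (fcoef N \<epsilon> m t) * fcoef N \<epsilon> n t) = (if n = m then 1 else 0)"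
proof -
  have "cnj (fcoef N \<epsilon> m t) * fcoef N \<epsilon> n t = cis (2 * pi * of_int (int n - int m) / real N) ^ t / of_nat N" for t
  proof -
    have "cis (- ((2 * real m + 1) * pi * real t / real N)) * cis ((2 * real n + 1) * pi * real t / real N)
        = cis (real t * (2 * pi * of_int (int n - int m) / real N))"
      by (subst cis_mult, rule arg_cong[of _ _ cis]) (simp add: field_simps flip: add_divide_distrib)
    then show ?thesis using assms
      by (simp add: fcoef_cis cis_cnj DeMoivre flip: of_real_mult)
  qed
  then show ?thesis
    using sum_roots_of_unity[of "int n - int m" N] assms by (simp flip: sum_divide_distrib)
qed

lemma fcoef_orthogonal_mode:
  assumes "\<epsilon> > 0" "N \<ge> 1" "t < N" "t' < N"
  shows "(\<Sum>n<N. fcoef N \<epsilon> n t * cnj (fcoef N \<epsilon> n t')) = (if t = t' then 1 else 0)"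
proof -
  \<comment> \<open>The phase produced by the half-integer shift of the frequencies. It does not
    depend on \<open>n\<close>, so it leaves the sum, and it equals 1 when
    \<open>t = t'\<close>.\<close>
  let ?u = "cis (pi * of_int (int t - int t') / real N)"
  have "fcoef N \<epsilon> n t * cnj (fcoef N \<epsilon> n t') = ?u * cis (2 * pi * of_int (int t - int t') / real N) ^ n / of_nat N" for n
  proof -
    have "cis ((2 * real n + 1) * pi * real t / real N) * cis (- ((2 * real n + 1) * pi * real t' / real N))
        = ?u * cis (real n * (2 * pi * of_int (int t - int t') / real N))"
      by (subst cis_mult, subst cis_mult, rule arg_cong[of _ _ cis]) (simp add: field_simps flip: add_divide_distrib)
    then show ?thesis using assms
      by (simp add: fcoef_cis cis_cnj DeMoivre flip: of_real_mult)
  qed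
  then show ?thesis
    using sum_roots_of_unity[of "int t - int t'" N] assms
    by (auto simp flip: sum_divide_distrib sum_distrib_left)
qed

lemma fcoef_step:
  "exp (\<i> * of_real \<epsilon> * of_real (omega N \<epsilon> n)) * fcoef N \<epsilon> n t = fcoef N \<epsilon> n (Suc t)"
  unfolding fcoef_def by (simp add: algebra_simps flip: exp_add)

lemma fcoef_antiperiodic:
  assumes "\<epsilon> > 0" "N \<ge> 1"
  shows "fcoef N \<epsilon> n N = - fcoef N \<epsilon> n 0"
proof -
  have "cis ((2 * real n + 1) * pi) = - 1"
    by (simp add: complex_eq_iff distrib_right cos_add sin_add)
  then show ?thesis using assms by (simp add: fcoef_cis)
qed

lemma smult_anticommutator:
  assumes "square_dim d A" "square_dim d W" "A * W + W * A = c \<cdot>\<^sub>m 1\<^sub>m d"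
  shows "(a \<cdot>\<^sub>m A) * W + W * (a \<cdot>\<^sub>m A) = (a * c) \<cdot>\<^sub>m 1\<^sub>m d"
proof -
  have "(a \<cdot>\<^sub>m A) * W + W * (a \<cdot>\<^sub>m A) = a \<cdot>\<^sub>m (A * W + W * A)"
    using assms(1,2) by (simp add: mat_distribs smult_add_mat)
  then show ?thesis by (simp add: assms(3))
qed

lemma anticommutator_commute:
  assumes "square_dim d A" "square_dim d (B :: complex mat)"
  shows "A * B + B * A = B * A + A * B"
  using assms by (intro comm_add_mat) auto

section \<open>Fourier modes on the time lattice and their ladder algebra\<close>

locale time_lattice =
  fixes L N :: nat and \<epsilon> :: real
  assumes eps: "\<epsilon> > 0" and N: "N \<ge> 1"
begin

lemma slice_index_less: "t < N \<Longrightarrow> j < L \<Longrightarrow> t * L + j < N * L"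
proof -
  assume "t < N" "j < L"
  then have "t * L + j < Suc t * L" "Suc t * L \<le> N * L" using mult_le_mono1[of "Suc t" N L] by auto
  then show ?thesis by linarith
qed

lemma slice_index_eq: "j < L \<Longrightarrow> i < L \<Longrightarrow> t * L + j = t' * L + i \<longleftrightarrow> t = t' \<and> j = i"
  by (metis add.commute div_mult_self3 div_less add_0 mod_less mod_mult_self3 less_nat_zero_code)

abbreviation fcre :: "nat \<Rightarrow> nat \<Rightarrow> complex mat" where
  "fcre n j \<equiv> mat_adjoint (fourier_ann L N \<epsilon> n j)"

lemma fourier_ann_msum:
  "fourier_ann L N \<epsilon> n j = msum (fdim (N * L)) (map (\<lambda>t. fcoef N \<epsilon> n t \<cdot>\<^sub>m ann (N * L) (t * L + j)) [0..<N])"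
  by (simp add: fourier_ann_def fcoef_def)

lemma fourier_ann_dim [simp]:
  "dim_row (fourier_ann L N \<epsilon> n j) = fdim (N * L)" "dim_col (fourier_ann L N \<epsilon> n j) = fdim (N * L)"
  by (auto simp: fourier_ann_msum)

lemma fcre_msum:
  "fcre n j = msum (fdim (N * L)) (map (\<lambda>t. cnj (fcoef N \<epsilon> n t) \<cdot>\<^sub>m cre (N * L) (t * L + j)) [0..<N])"
  unfolding fourier_ann_msum by (subst adjoint_msum) (auto simp: mat_adjoint_smult o_def)

lemma fourier_ann_cre:
  assumes "t < N" "i < L" "j < L"
  shows "fourier_ann L N \<epsilon> n j * cre (N * L) (t * L + i) + cre (N * L) (t * L + i) * fourier_ann L N \<epsilon> n j =
    (if i = j then fcoef N \<epsilon> n t else 0) \<cdot>\<^sub>m 1\<^sub>m (fdim (N * L))"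
proof -
  have "fourier_ann L N \<epsilon> n j * cre (N * L) (t * L + i) + cre (N * L) (t * L + i) * fourier_ann L N \<epsilon> n j =
    (\<Sum>t'\<leftarrow>[0..<N]. fcoef N \<epsilon> n t' * (if t' * L + j = t * L + i then 1 else 0)) \<cdot>\<^sub>m 1\<^sub>m (fdim (N * L))"
    unfolding fourier_ann_msum using assms
    by (intro msum_anticommutator ballI conjI smult_anticommutator ann_cre_anticommutator)
      (auto simp: slice_index_less)
  also have "(\<Sum>t'\<leftarrow>[0..<N]. fcoef N \<epsilon> n t' * (if t' * L + j = t * L + i then 1 else 0)) =
      (\<Sum>t'\<in>{0..<N}. if t' = t then if i = j then fcoef N \<epsilon> n t else 0 else 0)"
    unfolding interv_sum_list_conv_sum_set_nat using assms
    by (intro sum.cong) (auto simp: slice_index_eq)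
  finally show ?thesis using assms by simp
qed

lemma fourier_ann_fcre:
  assumes "n < N" "m < N" "i < L" "j < L"
  shows "fourier_ann L N \<epsilon> n j * fcre m i + fcre m i * fourier_ann L N \<epsilon> n j =
    (if (n, j) = (m, i) then 1 else 0) \<cdot>\<^sub>m 1\<^sub>m (fdim (N * L))"
proof -
  have "fcre m i * fourier_ann L N \<epsilon> n j + fourier_ann L N \<epsilon> n j * fcre m i =
    (\<Sum>t\<leftarrow>[0..<N]. cnj (fcoef N \<epsilon> m t) * (if i = j then fcoef N \<epsilon> n t else 0)) \<cdot>\<^sub>m 1\<^sub>m (fdim (N * L))"
    unfolding fcre_msum using assms
    by (intro msum_anticommutator ballI conjI smult_anticommutator)
      (auto simp: fourier_ann_cre[symmetric] intro: anticommutator_commute)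
  also have "(\<Sum>t\<leftarrow>[0..<N]. cnj (fcoef N \<epsilon> m t) * (if i = j then fcoef N \<epsilon> n t else 0)) =
      (if (n, j) = (m, i) then 1 else 0)"
    using fcoef_orthogonal_time[OF eps N assms(1,2)]
    by (cases "i = j") (auto simp: interv_sum_list_conv_sum_set_nat lessThan_atLeast0)
  finally show ?thesis by (subst anticommutator_commute[where d = "fdim (N * L)"]) auto
qed

lemma fcre_fcre:
  assumes "i < L" "j < L"
  shows "fcre n j * fcre m i + fcre m i * fcre n j = 0 \<cdot>\<^sub>m 1\<^sub>m (fdim (N * L))"
proof -
  have cre: "fcre m i * cre (N * L) (t * L + j) + cre (N * L) (t * L + j) * fcre m i = 0 \<cdot>\<^sub>m 1\<^sub>m (fdim (N * L))"
    if "t < N" for t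
  proof -
    have "fcre m i * cre (N * L) (t * L + j) + cre (N * L) (t * L + j) * fcre m i =
      (\<Sum>t'\<leftarrow>[0..<N]. cnj (fcoef N \<epsilon> m t') * 0) \<cdot>\<^sub>m 1\<^sub>m (fdim (N * L))"
      unfolding fcre_msum using assms that
      by (intro msum_anticommutator ballI conjI smult_anticommutator cre_cre_anticommutator)
        (auto simp: slice_index_less)
    then show ?thesis by simp
  qed
  have "fcre n j * fcre m i + fcre m i * fcre n j =
    (\<Sum>t\<leftarrow>[0..<N]. cnj (fcoef N \<epsilon> n t) * 0) \<cdot>\<^sub>m 1\<^sub>m (fdim (N * L))"
    unfolding fcre_msum[of n j]
  proof (intro msum_anticommutator ballI conjI smult_anticommutator)
    fix t assume "t \<in> set [0..<N]"
    then show "cre (N * L) (t * L + j) * fcre m i + fcre m i * cre (N * L) (t * L + j) = 0 \<cdot>\<^sub>m 1\<^sub>m (fdim (N * L))"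
      using cre[of t] by (subst anticommutator_commute[where d = "fdim (N * L)"]) auto
  qed auto
  then show ?thesis by simp
qed

lemma momentum_msum:
  "momentum L N \<epsilon> = msum (fdim (N * L)) (map (\<lambda>(n, j). of_real (omega N \<epsilon> n) \<cdot>\<^sub>m
     (fcre n j * fourier_ann L N \<epsilon> n j)) (List.product [0..<N] [0..<L]))"
  by (simp add: momentum_def product_concat_map map_concat o_def)

lemma momentum_dim [simp]: "dim_row (momentum L N \<epsilon>) = fdim (N * L)" "dim_col (momentum L N \<epsilon>) = fdim (N * L)"
  by (auto simp: momentum_msum)

lemma momentum_hermitian: "mat_adjoint (momentum L N \<epsilon>) = momentum L N \<epsilon>"
  unfolding momentum_msum
  by (subst adjoint_msum) (auto simp: mat_adjoint_smult mat_adjoint_mult intro!: arg_cong[where f = "msum _"])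

text \<open>The Fourier operators again satisfy canonical relations, so among all number operators
  only that of the mode \<open>(m, i)\<close> fails to commute, and it contributes its
  frequency.\<close>

lemma momentum_fcre:
  assumes "m < N" "i < L"
  shows "momentum L N \<epsilon> * fcre m i = fcre m i * momentum L N \<epsilon> + of_real (omega N \<epsilon> m) \<cdot>\<^sub>m fcre m i"
proof -
  let ?c = "\<lambda>p :: nat \<times> nat. if p = (m, i) then of_real (omega N \<epsilon> m) else (0 :: complex)"
  have "momentum L N \<epsilon> * fcre m i = fcre m i * momentum L N \<epsilon> +
      (\<Sum>p\<leftarrow>List.product [0..<N] [0..<L]. ?c p) \<cdot>\<^sub>m fcre m i"
    unfolding momentum_msum
  proof (intro msum_commutator ballI conjI, goal_cases)
    case (3 p)
    obtain n j where p: "p = (n, j)" by force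
    have "(fcre n j * fourier_ann L N \<epsilon> n j) * fcre m i = fcre m i * (fcre n j * fourier_ann L N \<epsilon> n j) +
        (if (n, j) = (m, i) then 1 else 0) \<cdot>\<^sub>m fcre n j"
      using 3 assms p by (intro number_commutator[of _ "fdim (N * L)"] fourier_ann_fcre fcre_fcre) auto
    then have "of_real (omega N \<epsilon> n) \<cdot>\<^sub>m (fcre n j * fourier_ann L N \<epsilon> n j) * fcre m i =
        of_real (omega N \<epsilon> n) \<cdot>\<^sub>m (fcre m i * (fcre n j * fourier_ann L N \<epsilon> n j) + (if (n, j) = (m, i) then 1 else 0) \<cdot>\<^sub>m fcre n j)"
      by (simp add: mat_distribs)
    also have "\<dots> = fcre m i * (of_real (omega N \<epsilon> n) \<cdot>\<^sub>m (fcre n j * fourier_ann L N \<epsilon> n j)) + ?c p \<cdot>\<^sub>m fcre m i"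
      using p by (cases "(n, j) = (m, i)") (auto simp: smult_add_mat mat_distribs intro!: eq_matI)
    finally show ?case using p by simp
  qed auto
  also have "(\<Sum>p\<leftarrow>List.product [0..<N] [0..<L]. ?c p) = of_real (omega N \<epsilon> m)"
    using assms by (subst sum_list_distinct_conv_sum_set) (auto simp: distinct_product)
  finally show ?thesis .
qed

text \<open>Fourier inversion, from orthogonality in the frequency index. It allows phases attached
  to Fourier modes to be read as a shift in time.\<close>

lemma cre_fourier:
  assumes "t < N" "j < L"
  shows "msum (fdim (N * L)) (map (\<lambda>n. fcoef N \<epsilon> n t \<cdot>\<^sub>m fcre n j) [0..<N]) = cre (N * L) (t * L + j)"
proof (rule eq_matI, goal_cases)
  case (1 x y)
  then have xy: "x < fdim (N * L)" "y < fdim (N * L)" by auto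
  let ?C = "\<lambda>t'. cre (N * L) (t' * L + j) $$ (x, y)"
  have "msum (fdim (N * L)) (map (\<lambda>n. fcoef N \<epsilon> n t \<cdot>\<^sub>m fcre n j) [0..<N]) $$ (x, y) =
      (\<Sum>n<N. fcoef N \<epsilon> n t * (\<Sum>t'<N. cnj (fcoef N \<epsilon> n t') * ?C t'))"
    unfolding fcre_msum using xy
    by (simp add: msum_index o_def interv_sum_list_conv_sum_set_nat lessThan_atLeast0)
  also have "\<dots> = (\<Sum>t'<N. (\<Sum>n<N. fcoef N \<epsilon> n t * cnj (fcoef N \<epsilon> n t')) * ?C t')"
    unfolding sum_distrib_left sum_distrib_right by (subst sum.swap) (simp add: mult.assoc)
  also have "\<dots> = (\<Sum>t'<N. if t' = t then ?C t else 0)"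
    using assms fcoef_orthogonal_mode[OF eps N] by (intro sum.cong) auto
  finally show ?case using assms by simp
qed auto

section \<open>Translation by one slice\<close>

definition trans_op :: "complex mat" where
  "trans_op = mexp ((\<i> * of_real \<epsilon>) \<cdot>\<^sub>m momentum L N \<epsilon>)"

lemma trans_op_dim [simp]: "dim_row trans_op = fdim (N * L)" "dim_col trans_op = fdim (N * L)"
  by (auto simp: trans_op_def)

lemma trans_op_fcre:
  assumes "m < N" "i < L"
  shows "trans_op * fcre m i = exp (\<i> * of_real \<epsilon> * of_real (omega N \<epsilon> m)) \<cdot>\<^sub>m (fcre m i * trans_op)"
  unfolding trans_op_def by (rule mexp_ladder[OF _ _ _ _ momentum_fcre[OF assms]]) auto

text \<open>The phase of each Fourier mode advances its coefficient from \<open>t\<close> to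
  \<open>Suc t\<close>. The sum is left unevaluated in order to cover \<open>t = N - 1\<close> too:
  there it involves the coefficients at \<open>N\<close>, which antiperiodicity turns into minus
  those at 0.\<close>

lemma trans_op_cre_sum:
  assumes "t < N" "j < L"
  shows "trans_op * cre (N * L) (t * L + j) =
    msum (fdim (N * L)) (map (\<lambda>n. fcoef N \<epsilon> n (Suc t) \<cdot>\<^sub>m fcre n j) [0..<N]) * trans_op"
proof -
  have "trans_op * (fcoef N \<epsilon> n t \<cdot>\<^sub>m fcre n j) = (fcoef N \<epsilon> n (Suc t) \<cdot>\<^sub>m fcre n j) * trans_op" if "n < N" for n
    using trans_op_fcre[OF that assms(2)] fcoef_step[of \<epsilon> N n t]
    by (simp add: mat_distribs mult.commute)
  then show ?thesis
    unfolding cre_fourier[OF assms, symmetric]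
    by (subst mult_msum, simp, simp, subst msum_mult, simp, simp)
      (auto simp: o_def intro!: arg_cong[where f = "msum _"])
qed

lemma trans_op_cre:
  assumes "Suc t < N" "j < L"
  shows "trans_op * cre (N * L) (t * L + j) = cre (N * L) (Suc t * L + j) * trans_op"
  using assms by (subst trans_op_cre_sum) (auto simp only: cre_fourier)

lemma trans_op_cre_last:
  assumes "j < L"
  shows "trans_op * cre (N * L) ((N - 1) * L + j) = (- 1) \<cdot>\<^sub>m (cre (N * L) j * trans_op)"
proof -
  have "msum (fdim (N * L)) (map (\<lambda>n. fcoef N \<epsilon> n N \<cdot>\<^sub>m fcre n j) [0..<N]) =
      (- 1) \<cdot>\<^sub>m msum (fdim (N * L)) (map (\<lambda>n. fcoef N \<epsilon> n 0 \<cdot>\<^sub>m fcre n j) [0..<N])"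
    by (subst smult_msum) (auto simp: o_def fcoef_antiperiodic[OF eps N])
  also have "\<dots> = (- 1) \<cdot>\<^sub>m cre (N * L) j"
    using N assms cre_fourier[of 0 j] by simp
  finally show ?thesis using assms N trans_op_cre_sum[of "N - 1" j] by (simp add: mat_distribs)
qed

lemma trans_op_unitary: "trans_op * mat_adjoint trans_op = 1\<^sub>m (fdim (N * L))"
    "mat_adjoint trans_op * trans_op = 1\<^sub>m (fdim (N * L))"
  unfolding trans_op_def by (rule mexp_i_hermitian_unitary; simp add: momentum_hermitian)+

lemma trans_op_ann:
  assumes "Suc t < N" "j < L"
  shows "trans_op * ann (N * L) (t * L + j) = ann (N * L) (Suc t * L + j) * trans_op"
  using unitary_intertwine_adjoint[OF _ _ _ trans_op_unitary, of "cre (N * L) (t * L + j)" "cre (N * L) (Suc t * L + j)" 1]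
    trans_op_cre[OF assms] by simp

lemma trans_op_ann_last:
  assumes "j < L"
  shows "trans_op * ann (N * L) ((N - 1) * L + j) = (- 1) \<cdot>\<^sub>m (ann (N * L) j * trans_op)"
  using unitary_intertwine_adjoint[OF _ _ _ trans_op_unitary trans_op_cre_last[OF assms]] by simp

lemma trans_op_vacuum: "trans_op *\<^sub>v vacuum (N * L) = vacuum (N * L)"
  unfolding trans_op_def
proof (rule mexp_fixes_kernel[of _ "fdim (N * L)"])
  have zero: "A *\<^sub>v 0\<^sub>v d = 0\<^sub>v d" if "square_dim d A" for A d
    using that by (intro eq_vecI) (auto simp: scalar_prod_def)
  have smult_zero: "c \<cdot>\<^sub>v 0\<^sub>v d = (0\<^sub>v d :: complex vec)" for c d
    by (intro eq_vecI) auto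
  have "fourier_ann L N \<epsilon> n j *\<^sub>v vacuum (N * L) = 0\<^sub>v (fdim (N * L))" if "j < L" for n j
    unfolding fourier_ann_msum using that
    by (intro msum_mult_vec_zero) (auto simp: smult_mat_vec slice_index_less smult_zero)
  then have "momentum L N \<epsilon> *\<^sub>v vacuum (N * L) = 0\<^sub>v (fdim (N * L))"
    unfolding momentum_msum
    by (intro msum_mult_vec_zero) (auto simp: smult_mat_vec mat_vec_assoc zero smult_zero)
  then show "((\<i> * of_real \<epsilon>) \<cdot>\<^sub>m momentum L N \<epsilon>) *\<^sub>v vacuum (N * L) = 0\<^sub>v (fdim (N * L))"
    by (simp add: smult_mat_vec smult_zero)
qed auto

end

declare index_mult_mat(1) [simp del] index_mult_mat_vec [simp del]

section \<open>Products of commuting matrices\<close>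

lemma mprod_mult_commuting:
  assumes "\<forall>x\<in>set xs. square_dim d (A x) \<and> square_dim d (B x)"
    and "\<forall>x\<in>set xs. \<forall>y\<in>set xs. B x * A y = A y * B x"
  shows "mprod d (map A xs) * mprod d (map B xs) = mprod d (map (\<lambda>x. A x * B x) xs)"
  using assms
proof (induction xs)
  case (Cons x xs)
  have comm: "B x * mprod d (map A xs) = mprod d (map A xs) * B x"
    using Cons.prems by (intro mprod_commute) auto
  have "mprod d (map A (x # xs)) * mprod d (map B (x # xs)) = A x * ((mprod d (map A xs) * B x) * mprod d (map B xs))"
    using Cons.prems by (simp add: mat_assoc)
  also have "\<dots> = A x * (B x * (mprod d (map A xs) * mprod d (map B xs)))"
    using Cons.prems by (simp add: mat_assoc flip: comm)
  finally show ?case using Cons by (simp add: mat_assoc)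
qed auto

lemma mprod_rev:
  assumes "\<forall>A\<in>set As. square_dim d A" "\<forall>A\<in>set As. \<forall>B\<in>set As. A * B = B * A"
  shows "mprod d (rev As) = mprod d As"
  using assms
proof (induction As)
  case (Cons A As)
  have sq: "\<forall>B\<in>set As. square_dim d B" "square_dim d A"
    using Cons.prems(1) by simp_all
  have "\<forall>B\<in>set As. \<forall>C\<in>set As. B * C = C * B"
    using Cons.prems(2) by (meson list.set_intros(2))
  then have IH: "mprod d (rev As) = mprod d As"
    using sq by (intro Cons.IH)
  have comm: "\<forall>B\<in>set As. square_dim d B \<and> A * B = B * A"
    using Cons.prems(2) sq by (meson list.set_intros)
  have "mprod d (rev (A # As)) = mprod d As * A"
    using sq by (simp add: mprod_append IH)
  also have "\<dots> = A * mprod d As"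
    using mprod_commute[OF comm sq(2)] by simp
  finally show ?case by simp
qed auto

lemma mprod_ones: "\<forall>A\<in>set As. A = 1\<^sub>m d \<Longrightarrow> mprod d As = 1\<^sub>m d"
  by (induction As) auto

lemma msum_intertwine:
  assumes "\<forall>x\<in>set xs. square_dim d (A x) \<and> square_dim d (B x) \<and> W * A x = s \<cdot>\<^sub>m (B x * W)"
    and "square_dim d W"
  shows "W * msum d (map A xs) = s \<cdot>\<^sub>m (msum d (map B xs) * W)"
  using assms by (induction xs) (auto simp: mat_distribs smult_add_mat intro!: eq_matI)

lemma slice_dim [simp]: "dim_row (slice L N t X) = fdim (N * L)" "dim_col (slice L N t X) = fdim (N * L)"
  by (auto simp: slice_def)

subsection \<open>Slice operators\<close>

context time_lattice
begin

lemma L_le: "L \<le> N * L"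
  using N by (cases N) auto

lemma trans_op_slice:
  assumes "Suc t < N"
  shows "trans_op * slice L N t X = slice L N (Suc t) X * trans_op"
  unfolding slice_def using assms
  by (intro mode_hom_intertwine[where s = 1]) (auto simp: trans_op_cre trans_op_ann)

lemma trans_op_slice_last:
  assumes "even_op L X"
  shows "trans_op * slice L N (N - 1) X = slice L N 0 X * trans_op"
  unfolding slice_def using assms
  by (intro mode_hom_intertwine[where s = "- 1"]) (auto simp: trans_op_cre_last[unfolded One_nat_def] trans_op_ann_last[unfolded One_nat_def])

lemma parity_slice:
  assumes "t < N" "even_op L X"
  shows "parity (N * L) * slice L N t X = slice L N t X * parity (N * L)"
  unfolding slice_def using assms
  by (intro mode_hom_intertwine[where s = "- 1"]) (auto simp: parity_cre parity_ann slice_index_less)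

text \<open>The intertwining lemma is applied twice. A ladder operator of slice \<open>t\<close>
  passes the even \<open>X\<close> on slice \<open>s\<close>, with a sign for every ladder operator
  in it; then the placed \<open>X\<close> itself serves as \<open>W\<close> and passes an arbitrary
  \<open>Y\<close> on slice \<open>t\<close>.\<close>

lemma slice_commute:
  assumes "s < N" "t < N" "s \<noteq> t" "even_op L X"
  shows "slice L N s X * slice L N t Y = slice L N t Y * slice L N s X"
proof -
  have "W * slice L N s X = slice L N s X * W"
    if "W = cre (N * L) (t * L + i) \<or> W = ann (N * L) (t * L + i)" "i < L" for W i
    unfolding slice_def using assms that
    by (intro mode_hom_intertwine[where s = "- 1"])
      (auto intro!: cre_cre cre_ann ann_cre ann_ann simp: slice_index_less slice_index_eq)
  note this[OF disjI1[OF refl]] this[OF disjI2[OF refl]]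
  then show ?thesis
    unfolding slice_def[of L N t]
    by (intro mode_hom_intertwine[where s = 1]) auto
qed

lemma slice_zero_eq: "slice L N 0 X = mat (fdim (N * L)) (fdim (N * L))
    (\<lambda>(i, j). if drop_bit L i = drop_bit L j then X $$ (take_bit L i, take_bit L j) else 0)"
  unfolding slice_def mult_0 add_0 by (rule mode_hom_inclusion[OF L_le])

text \<open>On slice 0 the matrix of the placed operator is explicit and free of signs. Each further
  slice is obtained by conjugating with the unitary translation, so Jordan-Wigner strings never have
  to be examined.\<close>

lemma slice_hermitian:
  assumes X: "square_dim (fdim L) X" "mat_adjoint X = X" and "t < N"
  shows "mat_adjoint (slice L N t X) = slice L N t X"
  using assms(3)
proof (induction t)
  case 0
  have "cnj (X $$ (j, i)) = X $$ (i, j)" if "i < fdim L" "j < fdim L" for i j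
    using that X by (metis mat_adjoint_index)
  then show ?case
    by (intro eq_matI) (auto simp: slice_zero_eq fdim_def)
next
  case (Suc t)
  have "slice L N (Suc t) X = (slice L N (Suc t) X * trans_op) * mat_adjoint trans_op"
    by (simp add: mat_assoc trans_op_unitary)
  then have conj: "slice L N (Suc t) X = trans_op * slice L N t X * mat_adjoint trans_op"
    using Suc by (simp add: trans_op_slice)
  show ?case
    unfolding conj using Suc by (simp add: mat_adjoint_mult mat_assoc)
qed

end

section \<open>Evolution factors of the Hamiltonian\<close>

locale hamiltonian_lattice = time_lattice +
  fixes H :: "complex mat"
  assumes H: "square_dim (fdim L) H" "mat_adjoint H = H" "even_op L H"
begin

definition evo :: "complex \<Rightarrow> nat \<Rightarrow> complex mat" where
  "evo c t = mexp (c \<cdot>\<^sub>m slice L N t H)"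

text \<open>One coefficient per slice. The operator \<V>, its adjoint, the product of the one-step
  evolutions and a single factor on slice 0 are all instances, so identities between them reduce to
  adding coefficient functions.\<close>

definition evos :: "(nat \<Rightarrow> complex) \<Rightarrow> complex mat" where
  "evos c = mprod (fdim (N * L)) (map (\<lambda>t. evo (c t) t) [0..<N])"

lemma evo_dim [simp]: "dim_row (evo c t) = fdim (N * L)" "dim_col (evo c t) = fdim (N * L)"
  by (auto simp: evo_def)

lemma evos_dim [simp]: "dim_row (evos c) = fdim (N * L)" "dim_col (evos c) = fdim (N * L)"
  by (auto simp: evos_def)

lemma evo_zero [simp]: "evo 0 t = 1\<^sub>m (fdim (N * L))"
  by (simp add: evo_def)

lemma evo_add: "evo c t * evo c' t = evo (c + c') t"
  unfolding evo_def by (rule mexp_smult_add) auto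

lemma evo_slice_commute:
  assumes "s < N" "t < N" "s \<noteq> t"
  shows "evo c s * slice L N t Y = slice L N t Y * evo c s"
  unfolding evo_def using assms H by (intro mexp_commute slice_commute) auto

lemma evo_commute:
  assumes "s < N" "t < N"
  shows "evo c s * evo c' t = evo c' t * evo c s"
proof (cases "s = t")
  case True
  then show ?thesis by (simp add: evo_add add.commute)
next
  case False
  then show ?thesis
    unfolding evo_def[of c' t] using assms
    by (intro mexp_commute[symmetric] evo_slice_commute[symmetric]) auto
qed

lemma trans_op_evo:
  assumes "Suc t < N"
  shows "trans_op * evo c t = evo c (Suc t) * trans_op"
  unfolding evo_def
  by (rule mexp_intertwine[of _ "fdim (N * L)", symmetric])
    (auto simp: mat_distribs trans_op_slice[OF assms])

lemma trans_op_evo_last: "trans_op * evo c (N - 1) = evo c 0 * trans_op"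
  unfolding evo_def
  using trans_op_slice_last[OF H(3)]
  by (intro mexp_intertwine[of _ "fdim (N * L)", symmetric]) (auto simp: mat_distribs)

lemma parity_evo: "t < N \<Longrightarrow> parity (N * L) * evo c t = evo c t * parity (N * L)"
  unfolding evo_def using H
  by (intro mexp_commute[symmetric] parity_slice[symmetric]) auto

lemma evo_adjoint:
  assumes "t < N"
  shows "mat_adjoint (evo (\<i> * of_real s) t) = evo (- (\<i> * of_real s)) t"
  unfolding evo_def using slice_hermitian[OF H(1,2) assms]
  by (intro mexp_i_hermitian_adjoint[where d = "fdim (N * L)"]) auto

lemma evos_mult: "evos c * evos c' = evos (\<lambda>t. c t + c' t)"
  unfolding evos_def by (subst mprod_mult_commuting) (auto simp: evo_commute evo_add)

lemma evos_zero [simp]: "evos (\<lambda>_. 0) = 1\<^sub>m (fdim (N * L))"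
  unfolding evos_def by (rule mprod_ones) auto

lemma evos_adjoint: "mat_adjoint (evos (\<lambda>t. \<i> * of_real (s t))) = evos (\<lambda>t. - (\<i> * of_real (s t)))"
proof -
  have "mat_adjoint (evos (\<lambda>t. \<i> * of_real (s t))) =
      mprod (fdim (N * L)) (rev (map (\<lambda>t. evo (- (\<i> * of_real (s t))) t) [0..<N]))"
    unfolding evos_def
    by (subst adjoint_mprod) (auto simp: evo_adjoint intro!: arg_cong[where f = "\<lambda>xs. mprod _ (rev xs)"])
  also have "\<dots> = evos (\<lambda>t. - (\<i> * of_real (s t)))"
    unfolding evos_def by (rule mprod_rev) (auto simp: evo_commute)
  finally show ?thesis .
qed

lemma upt_Cons_Suc: "[0..<N] = 0 # map Suc [0..<N - 1]"
  using N by (simp add: map_Suc_upt upt_conv_Cons)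

lemma evos_single: "evos (\<lambda>t. if t = 0 then c else 0) = evo c 0"
proof -
  have "mprod (fdim (N * L)) (map (\<lambda>t. evo (if t = 0 then c else 0) t) (map Suc [0..<N - 1])) = 1\<^sub>m (fdim (N * L))"
    by (rule mprod_ones) auto
  then show ?thesis unfolding evos_def upt_Cons_Suc by simp
qed

text \<open>Translation rotates the coefficient function cyclically. The last factor is split off
  because it alone wraps around, by \<open>trans_op_evo_last\<close> instead of
  \<open>trans_op_evo\<close>.\<close>

lemma trans_op_evos:
  "trans_op * evos c = evos (\<lambda>t. if t = 0 then c (N - 1) else c (t - 1)) * trans_op"
proof -
  let ?A = "mprod (fdim (N * L)) (map (\<lambda>t. evo (c t) t) [0..<N - 1])"
  let ?B = "mprod (fdim (N * L)) (map (\<lambda>t. evo (c t) (Suc t)) [0..<N - 1])"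
  have "[0..<N] = [0..<N - 1] @ [N - 1]"
    using N by (metis Suc_diff_1 less_eq_Suc_le One_nat_def upt_Suc_append zero_le)
  then have "evos c = ?A * evo (c (N - 1)) (N - 1)"
    unfolding evos_def by (simp add: mprod_append)
  then have "trans_op * evos c = (trans_op * ?A) * evo (c (N - 1)) (N - 1)"
    by (simp add: mat_assoc)
  also have "trans_op * ?A = ?B * trans_op"
    using mprod_intertwine[of "[0..<N - 1]" "\<lambda>t. evo (c t) t" "fdim (N * L)" "\<lambda>t. evo (c t) (Suc t)" trans_op "\<lambda>_. 1"]
    by (simp add: trans_op_evo)
  also have "?B * trans_op * evo (c (N - 1)) (N - 1) = ?B * evo (c (N - 1)) 0 * trans_op"
    by (simp add: mat_assoc trans_op_evo_last[unfolded One_nat_def])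
  \<comment> \<open>The wrapped factor arrives at the right end although it now belongs to slice 0;
    commuting it to the front restores the order of slices.\<close>
  also have "?B * evo (c (N - 1)) 0 = evo (c (N - 1)) 0 * ?B"
    using N by (intro mprod_commute[symmetric]) (auto intro!: evo_commute)
  also have "\<dots> = evos (\<lambda>t. if t = 0 then c (N - 1) else c (t - 1))"
    unfolding evos_def upt_Cons_Suc by (simp add: o_def)
  finally show ?thesis .
qed

lemma Vop_evos: "Vop L N \<epsilon> H = evos (\<lambda>t. \<i> * of_real (\<epsilon> * real t))"
  by (simp add: Vop_def evos_def evo_def)

lemma Vop_dim [simp]: "dim_row (Vop L N \<epsilon> H) = fdim (N * L)" "dim_col (Vop L N \<epsilon> H) = fdim (N * L)"
  by (auto simp: Vop_evos)

lemma Vop_adjoint: "mat_adjoint (Vop L N \<epsilon> H) = evos (\<lambda>t. - (\<i> * of_real (\<epsilon> * real t)))"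
  unfolding Vop_evos by (rule evos_adjoint)

lemma Vop_unitary: "Vop L N \<epsilon> H * mat_adjoint (Vop L N \<epsilon> H) = 1\<^sub>m (fdim (N * L))"
  unfolding Vop_adjoint unfolding Vop_evos evos_mult by simp

text \<open>Both sides are brought to the form \<open>evos c * trans_op\<close>. On slice 0,
  conjugation by \<V> leaves the coefficient \<epsilon>(N - 1), whereas the one-step factors alone
  would leave -\<epsilon>; the difference is \<epsilon>N = T, supplied by the prefactor on slice
  0.\<close>

lemma expiSt_eq: "expiSt L N \<epsilon> H = mat_adjoint (Vop L N \<epsilon> H) * trans_op * Vop L N \<epsilon> H"
proof -
  have "expiSt L N \<epsilon> H = evo (\<i> * of_real (\<epsilon> * real N)) 0 * (trans_op * evos (\<lambda>_. - \<i> * of_real \<epsilon>))"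
    by (simp add: expiSt_def expiS_def evos_def evo_def trans_op_def)
  also have "\<dots> = evos (\<lambda>t. (if t = 0 then \<i> * of_real (\<epsilon> * real N) else 0) + - \<i> * of_real \<epsilon>) * trans_op"
    unfolding trans_op_evos evos_single[symmetric] by (simp add: evos_mult flip: mat_assoc)
  finally have left: "expiSt L N \<epsilon> H = \<dots>" .
  have "mat_adjoint (Vop L N \<epsilon> H) * trans_op * Vop L N \<epsilon> H =
      mat_adjoint (Vop L N \<epsilon> H) * (trans_op * Vop L N \<epsilon> H)"
    by (simp add: mat_assoc)
  also have "\<dots> = evos (\<lambda>t. - (\<i> * of_real (\<epsilon> * real t)) +
      (if t = 0 then \<i> * of_real (\<epsilon> * real (N - 1)) else \<i> * of_real (\<epsilon> * real (t - 1)))) * trans_op"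
    unfolding Vop_adjoint unfolding Vop_evos trans_op_evos
    by (simp add: evos_mult flip: mat_assoc)
  also have "(\<lambda>t. - (\<i> * of_real (\<epsilon> * real t)) +
      (if t = 0 then \<i> * of_real (\<epsilon> * real (N - 1)) else \<i> * of_real (\<epsilon> * real (t - 1)))) =
      (\<lambda>t. (if t = 0 then \<i> * of_real (\<epsilon> * real N) else 0) + - \<i> * of_real \<epsilon>)"
    using N by (intro ext) (auto simp: of_nat_diff algebra_simps)
  finally show ?thesis using left by simp
qed

lemma expiSt_half_dim [simp]:
  "dim_row (expiSt_half L N \<epsilon> H) = fdim (N * L)" "dim_col (expiSt_half L N \<epsilon> H) = fdim (N * L)"
  by (auto simp: expiSt_half_def)

lemma expiSt_dim [simp]:
  "dim_row (expiSt L N \<epsilon> H) = fdim (N * L)" "dim_col (expiSt L N \<epsilon> H) = fdim (N * L)"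
  by (auto simp: expiSt_eq)

text \<open>Between the two factors \<V> meets its adjoint and cancels, and the two half exponents
  of the same momentum operator add.\<close>

lemma expiSt_half_square: "expiSt_half L N \<epsilon> H * expiSt_half L N \<epsilon> H = expiSt L N \<epsilon> H"
proof -
  let ?G = "mexp ((\<i> * of_real \<epsilon> / 2) \<cdot>\<^sub>m momentum L N \<epsilon>)" and ?V = "Vop L N \<epsilon> H"
  have "expiSt_half L N \<epsilon> H * expiSt_half L N \<epsilon> H =
      mat_adjoint ?V * ?G * (?V * mat_adjoint ?V) * ?G * ?V"
    unfolding expiSt_half_def by (simp add: mat_assoc)
  also have "\<dots> = mat_adjoint ?V * (?G * ?G) * ?V"
    unfolding Vop_unitary by (simp add: mat_assoc)
  also have "?G * ?G = trans_op"
    unfolding trans_op_def by (subst mexp_smult_add[of _ "fdim (N * L)"]) auto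
  finally show ?thesis by (simp add: expiSt_eq)
qed

lemma parity_momentum: "parity (N * L) * momentum L N \<epsilon> = momentum L N \<epsilon> * parity (N * L)"
proof -
  have ann: "parity (N * L) * fourier_ann L N \<epsilon> n j = (- 1) \<cdot>\<^sub>m (fourier_ann L N \<epsilon> n j * parity (N * L))" if "j < L" for n j
    unfolding fourier_ann_msum using that
    by (intro msum_intertwine) (auto simp: mat_distribs parity_ann slice_index_less)
  have cre: "parity (N * L) * fcre n j = (- 1) \<cdot>\<^sub>m (fcre n j * parity (N * L))" if "j < L" for n j
    unfolding fcre_msum using that
    by (intro msum_intertwine) (auto simp: mat_distribs parity_cre slice_index_less)
  have num: "parity (N * L) * (fcre n j * fourier_ann L N \<epsilon> n j) = (fcre n j * fourier_ann L N \<epsilon> n j) * parity (N * L)"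
    if "j < L" for n j
  proof -
    have "parity (N * L) * (fcre n j * fourier_ann L N \<epsilon> n j) = (parity (N * L) * fcre n j) * fourier_ann L N \<epsilon> n j"
      by (simp add: mat_assoc)
    also have "\<dots> = (- 1) \<cdot>\<^sub>m (fcre n j * (parity (N * L) * fourier_ann L N \<epsilon> n j))"
      unfolding cre[OF that] by (simp add: mat_assoc mat_distribs)
    finally show ?thesis by (simp add: ann[OF that] mat_assoc mat_distribs)
  qed
  show ?thesis
    unfolding momentum_msum
    by (subst msum_intertwine[where s = 1 and B = "\<lambda>(n, j). of_real (omega N \<epsilon> n) \<cdot>\<^sub>m (fcre n j * fourier_ann L N \<epsilon> n j)"])
      (auto simp: mat_distribs num)
qed

lemma parity_evos: "parity (N * L) * evos c = evos c * parity (N * L)"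
  unfolding evos_def by (rule mprod_commute) (auto simp: parity_evo)

lemma parity_expiSt_half: "parity (N * L) * expiSt_half L N \<epsilon> H = expiSt_half L N \<epsilon> H * parity (N * L)"
proof -
  let ?G = "mexp ((\<i> * of_real \<epsilon> / 2) \<cdot>\<^sub>m momentum L N \<epsilon>)" and ?P = "parity (N * L)"
  have G: "?P * ?G = ?G * ?P"
    by (intro mexp_commute[symmetric] parity_momentum[symmetric]) auto
  have "?P * (evos a * ?G * evos b) = (?P * evos a) * (?G * evos b)" for a b
    by (simp add: mat_assoc)
  also have "\<dots> a b = evos a * (?P * ?G) * evos b" for a b
    by (simp add: parity_evos mat_assoc)
  also have "\<dots> a b = evos a * ?G * (?P * evos b)" for a b
    unfolding G by (simp add: mat_assoc)
  also have "\<dots> a b = evos a * ?G * evos b * ?P" for a b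
    by (simp add: parity_evos mat_assoc)
  finally show ?thesis unfolding expiSt_half_def Vop_adjoint unfolding Vop_evos by simp
qed

text \<open>At \<open>t = 0\<close> the exponent of \<V> vanishes, so nothing acts on slice 0, and
  the even factors on the other slices commute with \<open>X\<close>. Hence no commutation between
  \<open>X\<close> and \<open>H\<close> is involved.\<close>

lemma Vop_slice_zero: "Vop L N \<epsilon> H * slice L N 0 X = slice L N 0 X * Vop L N \<epsilon> H"
proof -
  have "slice L N 0 X * evo (\<i> * of_real (\<epsilon> * real t)) t = evo (\<i> * of_real (\<epsilon> * real t)) t * slice L N 0 X"
    if "t < N" for t
    using that N evo_slice_commute[of t 0 _ X] by (cases "t = 0") auto
  then show ?thesis
    unfolding Vop_evos evos_def by (intro mprod_commute[symmetric]) auto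
qed

end

subsection \<open>The trace of a translated slice operator\<close>

lemma mtrace_comm:
  assumes "square_dim d A" "square_dim d B"
  shows "mtrace (A * B) = mtrace (B * A)"
proof -
  have "mtrace (A * B) = (\<Sum>i<d. \<Sum>l<d. A $$ (i, l) * B $$ (l, i))"
    using assms unfolding mtrace_def by (intro sum.cong) (auto simp: mat_mult_entry)
  also have "\<dots> = (\<Sum>l<d. \<Sum>i<d. B $$ (l, i) * A $$ (i, l))"
    by (subst sum.swap) (simp add: mult.commute)
  also have "\<dots> = mtrace (B * A)"
    using assms unfolding mtrace_def by (intro sum.cong) (auto simp: mat_mult_entry)
  finally show ?thesis .
qed

lemma cre_list_swap:
  assumes "\<forall>k\<in>set xs \<union> set ys. k < M"
  shows "mprod (fdim M) (map (cre M) (xs @ ys)) =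
    (- 1) ^ (length xs * length ys) \<cdot>\<^sub>m mprod (fdim M) (map (cre M) (ys @ xs))"
  using assms
proof (induction ys arbitrary: xs)
  case (Cons y ys)
  let ?C = "\<lambda>zs. mprod (fdim M) (map (cre M) zs)"
  have "cre M y * ?C xs = (\<Prod>k\<leftarrow>xs. - 1) \<cdot>\<^sub>m (?C xs * cre M y)"
    using Cons.prems by (intro mprod_intertwine) (auto intro: cre_cre)
  then have swap: "?C xs * cre M y = (- 1) ^ length xs \<cdot>\<^sub>m (cre M y * ?C xs)"
    by (simp flip: power_add mult_2)
  have append: "?C (us @ vs) = ?C us * ?C vs" for us vs
    unfolding map_append by (rule mprod_append) auto
  have "?C (xs @ y # ys) = (?C xs * cre M y) * ?C ys"
    unfolding append by (simp add: mat_assoc)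
  also have "\<dots> = (- 1) ^ length xs \<cdot>\<^sub>m (cre M y * ?C (xs @ ys))"
    unfolding swap append by (simp add: mat_assoc mat_distribs)
  also have "?C (xs @ ys) = (- 1) ^ (length xs * length ys) \<cdot>\<^sub>m ?C (ys @ xs)"
    using Cons.prems by (intro Cons.IH) auto
  finally show ?case by (simp add: mat_distribs power_add ball_Un)
qed auto

lemma upt_shift: "[K..<K + L] = map ((+) K) [0..<L]"
  by (rule nth_equalityI) auto

lemma length_filter_periodic:
  assumes "\<And>t j. t < m \<Longrightarrow> j < L \<Longrightarrow> p (t * L + j) = p j"
  shows "length (filter p [0..<m * L]) = m * length (filter p [0..<L])"
  using assms
proof (induction m)
  case (Suc m)
  have "[0..<Suc m * L] = [0..<m * L] @ map ((+) (m * L)) [0..<L]"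
    using upt_add_eq_append[of 0 "m * L" L] by (simp add: add.commute upt_shift[of "m * L" L, symmetric])
  moreover have "filter (\<lambda>j. p (m * L + j)) [0..<L] = filter p [0..<L]"
    using Suc.prems[of m] by (intro filter_cong) auto
  ultimately show ?case using Suc by (simp add: filter_map o_def)
qed auto

text \<open>The configuration translated by one slice: with \<open>K = (N - 1) * L\<close> the bits
  of the last slice become the lowest \<open>L\<close> bits and all others move up by
  \<open>L\<close>.\<close>

definition rot :: "nat \<Rightarrow> nat \<Rightarrow> nat \<Rightarrow> nat" where
  "rot K L n = semiring_bit_operations_class.or (push_bit L (take_bit K n)) (drop_bit K n)"

lemma bit_rot:
  assumes "n < fdim (K + L)"
  shows "bit (rot K L n) j \<longleftrightarrow> (if j < L then bit n (K + j) else j < K + L \<and> bit n (j - L))"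
proof -
  have "bit n (K + j) \<Longrightarrow> j < L" using bit_less_fdim[OF assms] by fastforce
  then show ?thesis by (auto simp: rot_def bit_simps)
qed

lemma less_fdimI: "(\<And>k. bit x k \<Longrightarrow> k < M) \<Longrightarrow> x < fdim M"
proof -
  assume "\<And>k. bit x k \<Longrightarrow> k < M"
  then have "take_bit M x = x" by (auto simp: bit_eq_iff bit_simps)
  then show ?thesis by (simp add: fdim_def take_bit_nat_eq_self_iff)
qed

text \<open>The increasing list of occupied modes begins with the block that wrapped around. This is
  the order which the moved creators attain after exchanging two blocks.\<close>

lemma occ_list_rot:
  assumes "n < fdim (K + L)"
  shows "occ_list (K + L) (rot K L n) =
    map (\<lambda>k. k - K) (filter (bit n) [K..<K + L]) @ map (\<lambda>k. k + L) (filter (bit n) [0..<K])"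
proof -
  have "[0..<K + L] = [0..<L] @ map (\<lambda>k. k + L) [0..<K]"
    by (metis add.commute map_add_upt upt_add_eq_append zero_le)
  then have "occ_list (K + L) (rot K L n) =
      filter (bit (rot K L n)) [0..<L] @ filter (bit (rot K L n)) (map (\<lambda>k. k + L) [0..<K])"
    by (simp add: occ_list_def occ_bit[abs_def])
  also have "filter (bit (rot K L n)) [0..<L] = filter (\<lambda>j. bit n (j + K)) [0..<L]"
    by (intro filter_cong) (auto simp: bit_rot[OF assms] add.commute)
  also have "\<dots> = map (\<lambda>k. k - K) (filter (bit n) (map (\<lambda>j. j + K) [0..<L]))"
    by (simp add: filter_map o_def)
  also have "map (\<lambda>j. j + K) [0..<L] = [K..<K + L]"
    by (simp add: map_add_upt add.commute)
  also have "filter (bit (rot K L n)) (map (\<lambda>k. k + L) [0..<K]) = map (\<lambda>k. k + L) (filter (bit n) [0..<K])"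
    unfolding filter_map by (intro arg_cong[where f = "map _"] filter_cong) (auto simp: bit_rot[OF assms])
  finally show ?thesis .
qed

lemma occ_list_split: "occ_list (K + L) n = filter (bit n) [0..<K] @ filter (bit n) [K..<K + L]"
  unfolding occ_list_def occ_bit[abs_def] by (simp add: upt_add_eq_append[of 0 K L])

context time_lattice
begin

text \<open>Parity gives every creator a factor -1, and wrapping gives a second -1 to those of the
  last slice. So the \<open>p\<close> creators below the last slice keep a sign and the
  \<open>q\<close> others do not. Bringing the wrapped block to the front costs \<open>p * q\<close>
  transpositions.\<close>

lemma trans_parity_unit_vec:
  assumes n: "n < fdim (N * L)"
  defines "K \<equiv> (N - 1) * L"
  defines "p \<equiv> length (filter (bit n) [0..<K])" and "q \<equiv> length (filter (bit n) [K..<K + L])"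
  shows "(trans_op * parity (N * L)) *\<^sub>v unit_vec (fdim (N * L)) n =
    (- 1) ^ (p + p * q) \<cdot>\<^sub>v unit_vec (fdim (N * L)) (rot K L n)"
proof -
  have KL: "N * L = K + L" using N by (cases N) (auto simp: K_def)
  define lo where "lo = filter (bit n) [0..<K]"
  define hi where "hi = filter (bit n) [K..<K + L]"
  let ?W = "trans_op * parity (N * L)"
  let ?c = "\<lambda>k. if k < K then - 1 else 1 :: complex" and ?\<sigma> = "\<lambda>k. if k < K then k + L else k - K"
  have W_cre: "?W * cre (N * L) k = ?c k \<cdot>\<^sub>m (cre (N * L) (?\<sigma> k) * ?W)" if "k < N * L" for k
  proof -
    have L0: "L > 0" using that by (cases L) auto
    have k: "k = k div L * L + k mod L" "k mod L < L" using L0 by auto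
    have eq: "?W * cre (N * L) k = (- 1) \<cdot>\<^sub>m ((trans_op * cre (N * L) k) * parity (N * L))"
      using that by (simp add: mat_assoc parity_cre mat_distribs)
    show ?thesis
    proof (cases "k < K")
      case True
      then have "k div L < N - 1" unfolding K_def using L0 by (simp add: div_less_iff_less_mult)
      then have "trans_op * cre (N * L) (k div L * L + k mod L) = cre (N * L) (Suc (k div L) * L + k mod L) * trans_op"
        using k by (intro trans_op_cre) auto
      moreover have "Suc (k div L) * L + k mod L = k + L" by simp
      ultimately have "trans_op * cre (N * L) k = cre (N * L) (k + L) * trans_op" by simp
      then show ?thesis unfolding eq using True by (simp add: mat_assoc mat_distribs)
    next
      case False
      then have "k - K < L" "(N - 1) * L + (k - K) = k" using that KL by (auto simp: K_def)
      then have "trans_op * cre (N * L) k = (- 1) \<cdot>\<^sub>m (cre (N * L) (k - K) * trans_op)"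
        using trans_op_cre_last[of "k - K"] by simp
      then show ?thesis unfolding eq using False by (simp add: mat_assoc mat_distribs)
    qed
  qed
  have occ: "occ_list (N * L) n = lo @ hi"
    unfolding KL lo_def hi_def by (rule occ_list_split)
  have rot: "map ?\<sigma> hi @ map ?\<sigma> lo = occ_list (N * L) (rot K L n)"
    unfolding KL using n by (subst occ_list_rot) (auto simp: KL lo_def hi_def)
  have rot_less: "rot K L n < fdim (N * L)"
    using n bit_less_fdim[OF n] unfolding KL
    by (intro less_fdimI) (auto simp: bit_rot split: if_splits)
  have "(\<Prod>k\<leftarrow>lo. ?c k) = (\<Prod>k\<leftarrow>lo. - 1)" "(\<Prod>k\<leftarrow>hi. ?c k) = (\<Prod>k\<leftarrow>hi. 1)"
    by (intro arg_cong[where f = prod_list] map_cong; auto simp: lo_def hi_def)+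
  then have sign: "(\<Prod>k\<leftarrow>lo @ hi. ?c k) = (- 1) ^ p" by (simp add: p_def lo_def)
  have "?W *\<^sub>v unit_vec (fdim (N * L)) n = (\<Prod>k\<leftarrow>lo @ hi. ?c k) \<cdot>\<^sub>v
      (mprod (fdim (N * L)) (map (cre (N * L)) (map ?\<sigma> (lo @ hi))) *\<^sub>v vacuum (N * L))"
    unfolding unit_vec_cre_vacuum[OF n] occ
  proof (rule cre_list_intertwine_vacuum)
    have "k < N * L" if "k \<in> set (lo @ hi)" for k
      using that unfolding KL by (auto simp: lo_def hi_def)
    then show "\<forall>k\<in>set (lo @ hi). ?W * cre (N * L) k = ?c k \<cdot>\<^sub>m (cre (N * L) (?\<sigma> k) * ?W)"
      using W_cre by blast
  qed (auto simp: mat_vec_assoc trans_op_vacuum)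
  also have "mprod (fdim (N * L)) (map (cre (N * L)) (map ?\<sigma> (lo @ hi))) =
      (- 1) ^ (p * q) \<cdot>\<^sub>m mprod (fdim (N * L)) (map (cre (N * L)) (map ?\<sigma> hi @ map ?\<sigma> lo))"
    unfolding map_append[of ?\<sigma>]
    by (subst cre_list_swap) (auto simp: lo_def hi_def p_def q_def KL)
  also have "\<dots> *\<^sub>v vacuum (N * L) = (- 1) ^ (p * q) \<cdot>\<^sub>v unit_vec (fdim (N * L)) (rot K L n)"
    unfolding rot unit_vec_cre_vacuum[OF rot_less] by (simp add: smult_mat_vec)
  finally show ?thesis unfolding sign by (simp add: smult_smult_assoc power_add)
qed

text \<open>Only configurations that are the same on every slice contribute, and for these the
  Jordan-Wigner sign, the antiperiodic boundary sign and the parity cancel.\<close>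

lemma trace_slice_trans_parity:
  assumes L: "L \<ge> 1" and X: "square_dim (fdim L) X"
  shows "mtrace (slice L N 0 X * (trans_op * parity (N * L))) = mtrace X"
proof -
  define K where "K = (N - 1) * L"
  have KL: "N * L = K + L" using N by (cases N) (auto simp: K_def)
  let ?W = "trans_op * parity (N * L)" and ?D = "fdim (N * L)"
  \<comment> \<open>All slices carry the same occupation pattern, written as agreement of
    \<open>n\<close> with its copy shifted by one slice. In this form the condition arises from the
    entry at \<open>(n, rot K L n)\<close>: outside slice 0 an operator placed on slice 0 changes no
    bit.\<close>
  define per where "per n \<longleftrightarrow> drop_bit L n = take_bit K n" for n :: nat
  have per_bit: "per n \<longleftrightarrow> (\<forall>k<N * L. bit n k = bit n (k mod L))" if "n < ?D" for n
  proof
    assume "per n"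
    then have step: "bit n (L + k) = bit n k" if "k < K" for k
      using that by (auto simp: per_def bit_eq_iff bit_simps)
    have "bit n (t * L + j) = bit n j" if "t < N" "j < L" for t j
      using that
    proof (induction t)
      case (Suc t)
      have "Suc t * L + j < K + L" using slice_index_less[of "Suc t" j] Suc.prems KL by simp
      then show ?case using Suc step[of "t * L + j"] by (simp add: add.assoc)
    qed auto
    note this[of "k div L" "k mod L" for k]
    then show "\<forall>k<N * L. bit n k = bit n (k mod L)" using L by (simp add: div_less_iff_less_mult)
  next
    assume *: "\<forall>k<N * L. bit n k = bit n (k mod L)"
    have "bit n (L + k) = bit n k" if "k < K" for k
      using *[rule_format, of k] *[rule_format, of "L + k"] that KL by simp
    moreover have "\<not> bit n (L + k)" if "\<not> k < K" for k
      using bit_less_fdim[OF \<open>n < ?D\<close>, of "L + k"] that KL by auto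
    ultimately show "per n" by (auto simp: per_def bit_eq_iff bit_simps)
  qed
  have entry: "(slice L N 0 X * ?W) $$ (n, n) = (if per n then X $$ (take_bit L n, take_bit L n) else 0)"
    if n: "n < ?D" for n
  proof -
    define p q where "p = length (filter (bit n) [0..<K])" and "q = length (filter (bit n) [K..<K + L])"
    have nK: "n < fdim (K + L)" using n KL by simp
    have rot_less: "rot K L n < ?D"
      using n bit_less_fdim[OF n] unfolding KL
      by (intro less_fdimI) (auto simp: bit_rot split: if_splits)
    have drop: "drop_bit L (rot K L n) = take_bit K n"
      by (rule bit_eqI) (auto simp: bit_simps bit_rot[OF nK] add.commute)
    have take: "take_bit L (rot K L n) = drop_bit K n"
      using bit_less_fdim[OF nK] by (intro bit_eqI) (fastforce simp: bit_simps bit_rot[OF nK])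
    have "(slice L N 0 X * ?W) $$ (n, n) = (slice L N 0 X *\<^sub>v (?W *\<^sub>v unit_vec ?D n)) $ n"
      using n by (subst mat_entry_unit_vec) (auto simp: mat_vec_assoc)
    also have "\<dots> = (- 1) ^ (p + p * q) * slice L N 0 X $$ (n, rot K L n)"
    proof -
      have "slice L N 0 X *\<^sub>v (c \<cdot>\<^sub>v unit_vec ?D m) = c \<cdot>\<^sub>v (slice L N 0 X *\<^sub>v unit_vec ?D m)" for c m
        by (rule mult_mat_vec) (auto intro!: carrier_matI)
      then show ?thesis
        using n rot_less
        by (simp add: trans_parity_unit_vec[OF n, folded K_def] p_def q_def mat_entry_unit_vec[of n "slice L N 0 X"])
    qed
    also have "slice L N 0 X $$ (n, rot K L n) = (if per n then X $$ (take_bit L n, drop_bit K n) else 0)"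
      using n rot_less by (simp add: slice_zero_eq drop take per_def)
    finally have *: "(slice L N 0 X * ?W) $$ (n, n) =
        (- 1) ^ (p + p * q) * (if per n then X $$ (take_bit L n, drop_bit K n) else 0)" .
    show ?thesis
    proof (cases "per n")
      case True
      have bits: "bit n (t * L + j) = bit n j" if "t < N" "j < L" for t j
      proof -
        have "bit n (t * L + j) = bit n ((t * L + j) mod L)"
          using True per_bit[OF n] slice_index_less[OF that] by blast
        then show ?thesis using that by simp
      qed
      have "p = (N - 1) * length (filter (bit n) [0..<L])"
        unfolding p_def K_def using bits by (intro length_filter_periodic) auto
      moreover have "q = length (filter (bit n) [0..<L])"
      proof -
        have "q = length (filter (\<lambda>j. bit n (K + j)) [0..<L])"
          by (simp add: q_def upt_shift filter_map o_def)
        also have "filter (\<lambda>j. bit n (K + j)) [0..<L] = filter (bit n) [0..<L]"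
          using bits[of "N - 1"] N by (intro filter_cong) (auto simp: K_def)
        finally show ?thesis .
      qed
      \<comment> \<open>On a periodic configuration \<open>p\<close> is \<open>(N - 1) * q\<close>,
        so the exponent contains a product of two consecutive integers and is even for every
        \<open>N\<close>.\<close>
      ultimately have "p + p * q = (N - 1) * (q * Suc q)" by (simp add: algebra_simps)
      then have "even (p + p * q)" by simp
      moreover have "drop_bit K n = take_bit L n"
        using bits[of "N - 1"] N bit_less_fdim[OF nK]
        by (intro bit_eqI) (fastforce simp: bit_simps K_def)
      ultimately show ?thesis using * True by simp
    qed (use * in simp)
  qed
  have bij: "bij_betw (take_bit L) {n. n < ?D \<and> per n} {..<fdim L}"
  proof (rule bij_betw_imageI)
    show "inj_on (take_bit L) {n. n < ?D \<and> per n}"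
    proof (rule inj_onI, clarsimp)
      fix m n assume m: "m < ?D" "per m" and n: "n < ?D" "per n" and eq: "take_bit L m = take_bit L n"
      have low: "bit m j = bit n j" if "j < L" for j
        using arg_cong[OF eq, of "\<lambda>x. bit x j"] that by (simp add: bit_simps)
      have "bit m k = bit n k" if "k < N * L" for k
      proof -
        have "bit m k = bit m (k mod L)" using per_bit[OF m(1)] m that by blast
        also have "\<dots> = bit n (k mod L)" using L by (intro low) auto
        also have "\<dots> = bit n k" using per_bit[OF n(1)] n that by blast
        finally show ?thesis .
      qed
      then show "m = n" using bit_less_fdim[OF m(1)] bit_less_fdim[OF n(1)] by (intro bit_eqI) blast
    qed
    show "take_bit L ` {n. n < ?D \<and> per n} = {..<fdim L}"
    proof (intro equalityI subsetI)
      fix c assume c: "c \<in> {..<fdim L}"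
      \<comment> \<open>The preimage of \<open>c\<close> is the configuration that repeats
        \<open>c\<close> on every slice.\<close>
      define n :: nat where "n = horner_sum of_bool 2 (map (\<lambda>k. bit c (k mod L)) [0..<N * L])"
      have bit_n: "bit n k \<longleftrightarrow> k < N * L \<and> bit c (k mod L)" for k
        by (auto simp: n_def bit_horner_sum_bit_iff)
      have n: "n < ?D" by (rule less_fdimI) (simp add: bit_n)
      have "per n" using L_le L unfolding per_bit[OF n] bit_n
        by (auto intro: order.strict_trans2[OF mod_less_divisor])
      moreover have "take_bit L n = c"
        using c bit_less_fdim[of c L] order.strict_trans2[OF _ L_le]
        by (intro bit_eqI) (auto simp: bit_simps bit_n)
      ultimately show "c \<in> take_bit L ` {n. n < ?D \<and> per n}" using n by auto
    qed (auto simp: fdim_def)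
  qed
  have "mtrace (slice L N 0 X * ?W) = (\<Sum>n<?D. if per n then X $$ (take_bit L n, take_bit L n) else 0)"
    unfolding mtrace_def using entry by (intro sum.cong) auto
  also have "\<dots> = (\<Sum>n\<in>{n. n < ?D \<and> per n}. X $$ (take_bit L n, take_bit L n))"
    by (rule sum.mono_neutral_cong_right) auto
  also have "\<dots> = (\<Sum>c<fdim L. X $$ (c, c))"
    by (rule sum.reindex_bij_betw[OF bij])
  finally show ?thesis using X by (simp add: mtrace_def)
qed

end

subsection \<open>The maximally entangled state\<close>

context
  fixes M :: nat
begin

definition pair_cre :: "nat \<Rightarrow> complex mat" where
  "pair_cre k = cre (2 * M) k * cre (2 * M) (M + k)"

lemma pair_cre_dim [simp]: "dim_row (pair_cre k) = fdim (2 * M)" "dim_col (pair_cre k) = fdim (2 * M)"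
  by (auto simp: pair_cre_def)

text \<open>Only the modulus of the sign is recorded: expectation values in \<Phi>^+ involve each
  amplitude together with its conjugate, so the phases never have to be determined.\<close>

lemma pair_cre_vec:
  assumes "k < M" "dim_vec v = fdim (2 * M)" "x < fdim (2 * M)"
  shows "\<exists>s. cmod s = 1 \<and> (pair_cre k *\<^sub>v v) $ x =
    (if bit x k \<and> bit x (M + k) then s * v $ flip_bit (M + k) (flip_bit k x) else 0)"
proof -
  have "cmod (jw_sign y j) = 1" for y j by (simp add: jw_sign_def norm_power)
  then have "cmod (jw_sign x k * jw_sign (flip_bit k x) (M + k)) = 1" by (simp add: norm_mult)
  moreover have "(pair_cre k *\<^sub>v v) $ x = (if bit x k \<and> bit x (M + k) then
      jw_sign x k * jw_sign (flip_bit k x) (M + k) * v $ flip_bit (M + k) (flip_bit k x) else 0)"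
    using assms by (auto simp: pair_cre_def mat_vec_assoc cre_vec)
  ultimately show ?thesis by blast
qed

lemma pair_cre_commute:
  assumes "j < M" "k < M"
  shows "pair_cre j * pair_cre k = pair_cre k * pair_cre j"
proof -
  have 1: "pair_cre j * cre (2 * M) l = cre (2 * M) l * pair_cre j" if "l < 2 * M" for l
  proof -
    have "pair_cre j * cre (2 * M) l = cre (2 * M) j * (cre (2 * M) (M + j) * cre (2 * M) l)"
      by (simp add: pair_cre_def mat_assoc)
    also have "\<dots> = (- 1) \<cdot>\<^sub>m ((cre (2 * M) j * cre (2 * M) l) * cre (2 * M) (M + j))"
      using assms that by (simp add: cre_cre[of "M + j" "2 * M" l] mat_distribs mat_assoc)
    also have "\<dots> = cre (2 * M) l * pair_cre j"
      using assms that by (simp add: cre_cre[of j "2 * M" l] mat_distribs mat_assoc pair_cre_def)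
    finally show ?thesis .
  qed
  have "pair_cre j * pair_cre k = (pair_cre j * cre (2 * M) k) * cre (2 * M) (M + k)"
    by (simp add: pair_cre_def[of k] mat_assoc)
  also have "\<dots> = cre (2 * M) k * (pair_cre j * cre (2 * M) (M + k))"
    using assms by (simp add: 1 mat_assoc)
  also have "\<dots> = pair_cre k * pair_cre j"
    using assms by (simp add: 1 pair_cre_def[of k] mat_assoc)
  finally show ?thesis .
qed

lemma pair_cre_square:
  assumes "k < M"
  shows "pair_cre k * pair_cre k = 0\<^sub>m (fdim (2 * M)) (fdim (2 * M))"
proof (rule mat_eqI_vec)
  fix v :: "complex vec" and x
  assume "dim_vec v = dim_col (0\<^sub>m (fdim (2 * M)) (fdim (2 * M)) :: complex mat)"
    and "x < dim_row (0\<^sub>m (fdim (2 * M)) (fdim (2 * M)) :: complex mat)"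
  then have vx: "dim_vec v = fdim (2 * M)" "x < fdim (2 * M)" by auto
  let ?x' = "flip_bit (M + k) (flip_bit k x)"
  have x': "?x' < fdim (2 * M)" using assms vx by simp
  obtain s where s: "(pair_cre k *\<^sub>v (pair_cre k *\<^sub>v v)) $ x =
      (if bit x k \<and> bit x (M + k) then s * (pair_cre k *\<^sub>v v) $ ?x' else 0)"
    using pair_cre_vec[of k "pair_cre k *\<^sub>v v" x] assms vx by auto
  have "(pair_cre k *\<^sub>v v) $ ?x' = 0" if "bit x k"
    using pair_cre_vec[of k v ?x'] assms vx x' that by auto
  then have "(pair_cre k *\<^sub>v (pair_cre k *\<^sub>v v)) $ x = 0" unfolding s by simp
  then show "(pair_cre k * pair_cre k *\<^sub>v v) $ x = (0\<^sub>m (fdim (2 * M)) (fdim (2 * M)) *\<^sub>v v) $ x"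
    using vx by (simp add: mat_vec_assoc mat_vec_entry)
qed auto

text \<open>Pair creators commute, so the exponential of the sum factorises; each squares to zero,
  so each factor stops after its linear term.\<close>

lemma mexp_pair_cre_sum:
  assumes "\<forall>k\<in>set xs. k < M"
  shows "mexp (msum (fdim (2 * M)) (map pair_cre xs)) =
    mprod (fdim (2 * M)) (map (\<lambda>k. 1\<^sub>m (fdim (2 * M)) + pair_cre k) xs)"
  using assms
proof (induction xs)
  case (Cons k xs)
  have "pair_cre k * msum (fdim (2 * M)) (map pair_cre xs) = 1 \<cdot>\<^sub>m (msum (fdim (2 * M)) (map pair_cre xs) * pair_cre k)"
    using Cons.prems by (intro msum_intertwine) (auto simp: pair_cre_commute)
  then have "mexp (msum (fdim (2 * M)) (map pair_cre (k # xs))) =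
      mexp (pair_cre k) * mexp (msum (fdim (2 * M)) (map pair_cre xs))"
    by (simp, intro mexp_add[of _ "fdim (2 * M)"]) auto
  also have "mexp (pair_cre k) = 1\<^sub>m (fdim (2 * M)) + pair_cre k"
    using Cons.prems by (intro mexp_square_zero) (auto simp: pair_cre_square)
  finally show ?case using Cons by simp
qed auto

text \<open>The list \<open>xs\<close> holds the modes whose pairs have been switched on so far.
  When \<open>k\<close> is added, at most one of the two terms is nonzero at a given
  \<open>x\<close>, according to whether mode \<open>k\<close> is occupied. There is no
  interference, and unit moduli persist.\<close>

lemma pair_state_entry:
  assumes "distinct xs" "\<forall>k\<in>set xs. k < M" "x < fdim (2 * M)"
  shows "cmod ((mprod (fdim (2 * M)) (map (\<lambda>k. 1\<^sub>m (fdim (2 * M)) + pair_cre k) xs) *\<^sub>v vacuum (2 * M)) $ x) =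
    (if (\<forall>k<M. bit x (M + k) = bit x k \<and> (bit x k \<longrightarrow> k \<in> set xs)) then 1 else 0)"
  using assms
proof (induction xs arbitrary: x)
  case Nil
  have "(\<forall>k<M. bit x (M + k) = bit x k \<and> \<not> bit x k) \<longleftrightarrow> x = 0"
  proof
    assume *: "\<forall>k<M. bit x (M + k) = bit x k \<and> \<not> bit x k"
    have "\<not> bit x k" for k
    proof
      assume b: "bit x k"
      then have "k < 2 * M" using bit_less_fdim Nil by blast
      then have "k < M \<or> k - M < M \<and> M + (k - M) = k" by auto
      then show False using b *[rule_format, of k] *[rule_format, of "k - M"] by auto
    qed
    then show "x = 0" by (intro bit_eqI) auto
  qed auto
  then show ?case using Nil by (auto simp: one_mat_vec vacuum_def)
next
  case (Cons k xs)
  define v where "v = mprod (fdim (2 * M)) (map (\<lambda>k. 1\<^sub>m (fdim (2 * M)) + pair_cre k) xs) *\<^sub>v vacuum (2 * M)"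
  define diag where "diag ys x \<longleftrightarrow> (\<forall>k<M. bit x (M + k) = bit x k \<and> (bit x k \<longrightarrow> k \<in> set ys))"
    for ys and x :: nat
  have k: "k < M" "k \<notin> set xs" using Cons.prems by auto
  have [simp]: "dim_vec v = fdim (2 * M)" by (simp add: v_def)
  have IH: "cmod (v $ y) = (if diag xs y then 1 else 0)" if "y < fdim (2 * M)" for y
    unfolding v_def diag_def using Cons.prems that by (intro Cons.IH) auto
  let ?x' = "flip_bit (M + k) (flip_bit k x)"
  have x': "?x' < fdim (2 * M)" using k Cons.prems by simp
  obtain s where s: "cmod s = 1" "(pair_cre k *\<^sub>v v) $ x =
      (if bit x k \<and> bit x (M + k) then s * v $ ?x' else 0)"
    using pair_cre_vec[of k v x] k Cons.prems by auto
  have "mprod (fdim (2 * M)) (map (\<lambda>k. 1\<^sub>m (fdim (2 * M)) + pair_cre k) (k # xs)) *\<^sub>v vacuum (2 * M) =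
      v + pair_cre k *\<^sub>v v"
    by (simp add: v_def mat_vec_assoc add_mat_vec one_mat_vec)
  then have val: "(mprod (fdim (2 * M)) (map (\<lambda>k. 1\<^sub>m (fdim (2 * M)) + pair_cre k) (k # xs)) *\<^sub>v vacuum (2 * M)) $ x =
      v $ x + (if bit x k \<and> bit x (M + k) then s * v $ ?x' else 0)"
    using s Cons.prems by simp
  show ?case
  proof (cases "bit x k")
    case True
    then have "\<not> diag xs x" using k unfolding diag_def by blast
    then have "v $ x = 0" using IH[of x] Cons.prems by simp
    moreover have "diag (k # xs) x \<longleftrightarrow> bit x (M + k) \<and> diag xs ?x'"
      using k True unfolding diag_def by auto
    ultimately show ?thesis unfolding val diag_def[symmetric] using IH[OF x'] s(1) True
      by (auto simp: norm_mult split: if_splits)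
  next
    case False
    then have "diag (k # xs) x \<longleftrightarrow> diag xs x" unfolding diag_def by auto
    then show ?thesis unfolding val diag_def[symmetric] using IH[of x] Cons.prems False by simp
  qed
qed

end

lemma concat_map_upt: "concat (map (\<lambda>t. map (\<lambda>j. f (t * L + j)) [0..<L]) [0..<N]) = map f [0..<N * L]"
proof (induction N)
  case (Suc N)
  have "[0..<Suc N * L] = [0..<N * L] @ map ((+) (N * L)) [0..<L]"
    using upt_add_eq_append[of 0 "N * L" L] by (simp add: add.commute upt_shift[of "N * L" L, symmetric])
  then show ?case using Suc by simp
qed auto

lemma PhiPlus_eq: "PhiPlus L N =
    mprod (fdim (2 * (N * L))) (map (\<lambda>k. 1\<^sub>m (fdim (2 * (N * L))) + pair_cre (N * L) k) [0..<N * L]) *\<^sub>v vacuum (2 * (N * L))"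
proof -
  have "2 * N * L = 2 * (N * L)" by simp
  moreover have "concat (map (\<lambda>t. map (\<lambda>j. mat_adjoint (sysK L N t j) * mat_adjoint (envK L N t j)) [0..<L]) [0..<N])
      = map (pair_cre (N * L)) [0..<N * L]"
    unfolding concat_map_upt[symmetric] by (simp add: sysK_def envK_def pair_cre_def ac_simps)
  ultimately show ?thesis
    unfolding PhiPlus_def by (simp only:) (subst mexp_pair_cre_sum, auto)
qed

lemma PhiPlus_dim [simp]: "dim_vec (PhiPlus L N) = fdim (2 * N * L)"
  by (simp add: PhiPlus_eq mult.assoc)

lemma PhiPlus_entry:
  assumes "x < fdim (2 * N * L)"
  shows "cmod (PhiPlus L N $ x) = (if drop_bit (N * L) x = take_bit (N * L) x then 1 else 0)"
proof -
  let ?M = "N * L"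
  have x: "x < fdim (2 * ?M)" using assms by (simp add: mult.assoc)
  have "drop_bit ?M x = take_bit ?M x \<longleftrightarrow> (\<forall>k<?M. bit x (?M + k) = bit x k)"
  proof -
    have "k < ?M" if "bit x (?M + k)" for k
      using bit_less_fdim[OF x that] by linarith
    then show ?thesis by (auto simp: bit_eq_iff bit_simps)
  qed
  then show ?thesis using x by (simp add: PhiPlus_eq pair_state_entry)
qed

subsection \<open>Embedding the system into the doubled space\<close>

lemma toK_eq: "toK L N X = mat (fdim (2 * N * L)) (fdim (2 * N * L))
    (\<lambda>(i, j). if drop_bit (N * L) i = drop_bit (N * L) j then X $$ (take_bit (N * L) i, take_bit (N * L) j) else 0)"
  unfolding toK_def by (rule mode_hom_inclusion) simp

lemma toK_dim [simp]: "dim_row (toK L N X) = fdim (2 * N * L)" "dim_col (toK L N X) = fdim (2 * N * L)"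
  by (auto simp: toK_eq)

lemma toK_one: "toK L N (1\<^sub>m (fdim (N * L))) = 1\<^sub>m (fdim (2 * N * L))"
proof (rule eq_matI, goal_cases)
  case (1 i j)
  have "i = j \<longleftrightarrow> drop_bit (N * L) i = drop_bit (N * L) j \<and> take_bit (N * L) i = take_bit (N * L) j"
    by (metis bits_ident)
  then show ?case using 1 by (auto simp: toK_eq fdim_def)
qed auto

text \<open>With the environment bits frozen to those of \<open>x\<close>, the remaining freedom is
  one system configuration. A matrix product in the doubled space thereby collapses to one in the
  system space.\<close>

lemma sum_fixed_high_bits:
  fixes f :: "nat \<Rightarrow> complex"
  assumes "x < fdim M'" "M \<le> M'"
  shows "(\<Sum>z<fdim M'. if drop_bit M x = drop_bit M z then f (take_bit M z) else 0) = (\<Sum>m<fdim M. f m)"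
proof -
  let ?S = "{z. z < fdim M' \<and> drop_bit M x = drop_bit M z}"
  have "bij_betw (take_bit M) ?S {..<fdim M}"
  proof (rule bij_betw_imageI)
    show "inj_on (take_bit M) ?S"
      by (rule inj_onI) (metis (mono_tags, lifting) bits_ident mem_Collect_eq)
    show "take_bit M ` ?S = {..<fdim M}"
    proof (intro equalityI subsetI)
      fix m assume m: "m \<in> {..<fdim M}"
      define z where "z = push_bit M (drop_bit M x) + m"
      have "take_bit M z = m" "drop_bit M z = drop_bit M x"
        using m by (auto simp: z_def fdim_def take_bit_eq_mod drop_bit_eq_div push_bit_eq_mult)
      moreover have "z < fdim M'"
      proof (rule less_fdimI)
        fix k assume b: "bit z k"
        show "k < M'"
        proof (cases "k < M")
          case False
          then have "bit (drop_bit M z) (k - M)" using b by (simp add: bit_simps)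
          then have "bit x k" using \<open>drop_bit M z = drop_bit M x\<close> False by (simp add: bit_simps)
          then show ?thesis using bit_less_fdim[OF assms(1)] by simp
        qed (use assms in simp)
      qed
      ultimately show "m \<in> take_bit M ` ?S" by (intro image_eqI[of _ _ z]) auto
    qed (auto simp: fdim_def)
  qed
  then have "(\<Sum>z\<in>?S. f (take_bit M z)) = (\<Sum>m<fdim M. f m)"
    by (rule sum.reindex_bij_betw)
  moreover have "(\<Sum>z<fdim M'. if drop_bit M x = drop_bit M z then f (take_bit M z) else 0) = (\<Sum>z\<in>?S. f (take_bit M z))"
    by (rule sum.mono_neutral_cong_right) auto
  ultimately show ?thesis by simp
qed

lemma toK_mult:
  assumes "square_dim (fdim (N * L)) A" "square_dim (fdim (N * L)) B"
  shows "toK L N (A * B) = toK L N A * toK L N B"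
proof (rule eq_matI, goal_cases)
  case (1 x y)
  then have xy: "x < fdim (2 * N * L)" "y < fdim (2 * N * L)" by auto
  let ?t = "take_bit (N * L) :: nat \<Rightarrow> nat" and ?d = "drop_bit (N * L) :: nat \<Rightarrow> nat"
  have lt: "?t z < fdim (N * L)" for z by (simp add: fdim_def)
  have "(toK L N A * toK L N B) $$ (x, y) =
      (\<Sum>z<fdim (2 * N * L). if ?d x = ?d z then (if ?d x = ?d y then A $$ (?t x, ?t z) * B $$ (?t z, ?t y) else 0) else 0)"
    using xy by (subst mat_mult_entry, simp, simp, simp, intro sum.cong) (auto simp: toK_eq)
  also have "\<dots> = (\<Sum>m<fdim (N * L). if ?d x = ?d y then A $$ (?t x, m) * B $$ (m, ?t y) else 0)"
    using xy by (intro sum_fixed_high_bits) auto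
  also have "\<dots> = toK L N (A * B) $$ (x, y)"
    using xy assms lt by (auto simp: toK_eq mat_mult_entry)
  finally show ?case by simp
qed auto

lemma toK_mprod:
  assumes "\<forall>x\<in>set xs. square_dim (fdim (N * L)) (A x)"
  shows "mprod (fdim (2 * N * L)) (map (\<lambda>x. toK L N (A x)) xs) = toK L N (mprod (fdim (N * L)) (map A xs))"
  using assms by (induction xs) (auto simp: toK_one toK_mult)

section \<open>Brackets, expectation values in the entangled state and rank-one operators\<close>

lemma braket_sum: "dim_vec u = dim_vec w \<Longrightarrow> braket w u = (\<Sum>i<dim_vec u. cnj (w $ i) * u $ i)"
  by (auto simp: braket_def scalar_prod_def lessThan_atLeast0 intro!: sum.cong)

text \<open>A system operator leaves the environment bits alone, and in the support of \<Phi>^+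
  these determine the system bits. So only diagonal entries of \<open>X\<close> contribute, each
  weighted by the squared modulus 1 of an amplitude.\<close>

lemma braket_PhiPlus_toK:
  assumes "square_dim (fdim (N * L)) X"
  shows "braket (PhiPlus L N) (toK L N X *\<^sub>v PhiPlus L N) = mtrace X"
proof -
  let ?D = "fdim (2 * N * L)" and ?\<Phi> = "PhiPlus L N" and ?M = "N * L"
  let ?diag = "\<lambda>x. drop_bit (N * L) x = take_bit (N * L) (x :: nat)"
  have zero: "?\<Phi> $ x = 0" if "x < ?D" "\<not> ?diag x" for x
    using PhiPlus_entry[OF that(1)] that by simp
  have entry: "cnj (?\<Phi> $ x) * (toK L N X *\<^sub>v ?\<Phi>) $ x = (if ?diag x then X $$ (take_bit ?M x, take_bit ?M x) else 0)"
    if x: "x < ?D" for x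
  proof (cases "?diag x")
    case True
    have "(toK L N X *\<^sub>v ?\<Phi>) $ x = (\<Sum>y<?D. if y = x then X $$ (take_bit ?M x, take_bit ?M x) * ?\<Phi> $ x else 0)"
    proof -
      have "toK L N X $$ (x, y) * ?\<Phi> $ y = (if y = x then X $$ (take_bit ?M x, take_bit ?M x) * ?\<Phi> $ x else 0)"
        if y: "y < ?D" for y
      proof (cases "?diag y \<and> drop_bit ?M x = drop_bit ?M y")
        case True
        then have "y = x" using \<open>?diag x\<close> by (metis bits_ident)
        then show ?thesis using x by (simp add: toK_eq)
      next
        case False
        then have "y \<noteq> x" using \<open>?diag x\<close> by auto
        then show ?thesis using False x y zero[OF y] by (auto simp: toK_eq)
      qed
      then show ?thesis using x by (subst mat_vec_entry) auto
    qed
    then have "cnj (?\<Phi> $ x) * (toK L N X *\<^sub>v ?\<Phi>) $ x = X $$ (take_bit ?M x, take_bit ?M x) * (?\<Phi> $ x * cnj (?\<Phi> $ x))"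
      using x by simp
    also have "?\<Phi> $ x * cnj (?\<Phi> $ x) = 1"
      using PhiPlus_entry[OF x] True by (simp add: complex_norm_square[symmetric])
    finally show ?thesis using True by simp
  qed (use zero x in simp)
  have bij: "bij_betw (take_bit ?M) {x. x < ?D \<and> ?diag x} {..<fdim ?M}"
  proof (rule bij_betw_imageI)
    show "inj_on (take_bit ?M) {x. x < ?D \<and> ?diag x}"
      by (rule inj_onI) (metis (mono_tags, lifting) bits_ident mem_Collect_eq)
    show "take_bit ?M ` {x. x < ?D \<and> ?diag x} = {..<fdim ?M}"
    proof (intro equalityI subsetI)
      fix m assume m: "m \<in> {..<fdim ?M}"
      \<comment> \<open>The configuration carrying \<open>m\<close> on the system and again on the
        environment.\<close>
      define z where "z = push_bit ?M m + m"
      have z: "take_bit ?M z = m" "drop_bit ?M z = m"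
        using m by (auto simp: z_def fdim_def take_bit_eq_mod drop_bit_eq_div push_bit_eq_mult)
      have "z < ?D"
      proof (rule less_fdimI)
        fix k assume b: "bit z k"
        show "k < 2 * N * L"
        proof (cases "k < ?M")
          case False
          then have "bit (drop_bit ?M z) (k - ?M)" using b by (simp add: bit_simps)
          then have "k - ?M < ?M" using m bit_less_fdim[of m ?M] z by auto
          then show ?thesis using False by simp
        qed simp
      qed
      then show "m \<in> take_bit ?M ` {x. x < ?D \<and> ?diag x}" using z by (intro image_eqI[of _ _ z]) auto
    qed (auto simp: fdim_def)
  qed
  have "braket ?\<Phi> (toK L N X *\<^sub>v ?\<Phi>) = (\<Sum>x<?D. if ?diag x then X $$ (take_bit ?M x, take_bit ?M x) else 0)"
    using entry by (simp add: braket_sum)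
  also have "\<dots> = (\<Sum>x\<in>{x. x < ?D \<and> ?diag x}. X $$ (take_bit ?M x, take_bit ?M x))"
    by (rule sum.mono_neutral_cong_right) auto
  also have "\<dots> = (\<Sum>m<fdim ?M. X $$ (m, m))"
    by (rule sum.reindex_bij_betw[OF bij])
  finally show ?thesis using assms by (simp add: mtrace_def)
qed

lemma braket_adjoint:
  assumes "square_dim d A" "dim_vec u = d" "dim_vec w = d"
  shows "braket (mat_adjoint A *\<^sub>v u) w = braket u (A *\<^sub>v w)"
proof -
  have "braket (mat_adjoint A *\<^sub>v u) w = (\<Sum>i<d. (\<Sum>l<d. A $$ (l, i) * cnj (u $ l)) * w $ i)"
    using assms by (auto simp: braket_sum mat_vec_entry intro!: sum.cong)
  also have "\<dots> = (\<Sum>l<d. cnj (u $ l) * (\<Sum>i<d. A $$ (l, i) * w $ i))"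
    unfolding sum_distrib_left sum_distrib_right by (subst sum.swap) (simp add: ac_simps)
  also have "\<dots> = braket u (A *\<^sub>v w)"
    using assms by (auto simp: braket_sum mat_vec_entry intro!: sum.cong)
  finally show ?thesis .
qed

lemma ketbra_dim [simp]: "dim_row (ketbra u w) = dim_vec u" "dim_col (ketbra u w) = dim_vec w"
  by (auto simp: ketbra_def)

lemma mtrace_ketbra_mult:
  assumes "dim_vec u = d" "dim_vec w = d" "square_dim d A"
  shows "mtrace (ketbra u w * A) = braket w (A *\<^sub>v u)"
proof -
  have "mtrace (ketbra u w * A) = (\<Sum>i<d. \<Sum>l<d. u $ i * cnj (w $ l) * A $$ (l, i))"
    using assms unfolding mtrace_def by (auto simp: mat_mult_entry ketbra_def intro!: sum.cong)
  also have "\<dots> = (\<Sum>l<d. cnj (w $ l) * (\<Sum>i<d. A $$ (l, i) * u $ i))"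
    unfolding sum_distrib_left by (subst sum.swap) (simp add: ac_simps)
  also have "\<dots> = braket w (A *\<^sub>v u)"
    using assms by (auto simp: braket_sum mat_vec_entry intro!: sum.cong)
  finally show ?thesis .
qed

lemma ketbra_mult_ketbra:
  assumes "dim_vec u = d" "dim_vec w = d"
  shows "ketbra u w * ketbra u w = braket w u \<cdot>\<^sub>m ketbra u w"
proof (rule eq_matI, goal_cases)
  case (1 i j)
  then have ij: "i < d" "j < d" using assms by auto
  have "(ketbra u w * ketbra u w) $$ (i, j) = (\<Sum>l<d. u $ i * cnj (w $ l) * (u $ l * cnj (w $ j)))"
    using assms ij by (subst mat_mult_entry) (auto simp: ketbra_def)
  also have "\<dots> = (\<Sum>l<d. cnj (w $ l) * u $ l) * (u $ i * cnj (w $ j))"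
    unfolding sum_distrib_right by (simp add: ac_simps)
  finally show ?case using assms ij by (simp add: braket_sum ketbra_def)
qed auto

section \<open>The rank-one operator and its expectation values\<close>

theorem theorem8:
  fixes L N :: nat and \<epsilon> :: real and H \<rho> :: "complex mat" and Obs :: "nat \<Rightarrow> complex mat"
  assumes L: "L \<ge> 1" and N: "N \<ge> 1" and eps: "\<epsilon> > 0"
    and H: "H \<in> carrier_mat (fdim L) (fdim L)" "hermitian H"
           "H * parity L = parity L * H"
    and rho: "density_op (fdim L) \<rho>" "mtrace \<rho> > 0" "\<rho> * parity L = parity L * \<rho>"
    and Obs_carrier: "\<forall>t < N. Obs t \<in> carrier_mat (fdim L) (fdim L)"
  shows "braket (PsibarK L N \<epsilon> H) (PsiK L N \<epsilon> H \<rho>) \<noteq> 0 \<and>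
    Rop L N \<epsilon> H \<rho> * Rop L N \<epsilon> H \<rho> = Rop L N \<epsilon> H \<rho> \<and>
    mtrace (Rop L N \<epsilon> H \<rho>) = 1 \<and>
    mtrace (parity (N * L) * slice L N 0 \<rho> * expiSt L N \<epsilon> H *
            mprod (fdim (N * L)) (map (\<lambda>t. slice L N t (Obs t)) [0..<N]))
    / mtrace (parity (N * L) * slice L N 0 \<rho> * expiSt L N \<epsilon> H)
    = mtrace (Rop L N \<epsilon> H \<rho> *
        mprod (fdim (2 * N * L)) (map (\<lambda>t. toK L N (slice L N t (Obs t))) [0..<N]))"
proof -
  have H_dim: "square_dim (fdim L) H" using H(1) by auto
  interpret hamiltonian_lattice L N \<epsilon> H
    using eps N H H_dim even_opI[OF H_dim H(3)] by unfold_locales (auto simp: hermitian_def)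
  have rho_dim: "square_dim (fdim L) \<rho>" using rho(1) by (auto simp: density_op_def)
  let ?d = "fdim (N * L)"
  define P where "P = parity (N * L)"
  define \<rho>0 where "\<rho>0 = slice L N 0 \<rho>"
  define E where "E = expiSt L N \<epsilon> H"
  define Eh where "Eh = expiSt_half L N \<epsilon> H"
  define V where "V = Vop L N \<epsilon> H"
  have [simp]: "square_dim ?d P" "square_dim ?d \<rho>0" "square_dim ?d E" "square_dim ?d Eh"
    "square_dim ?d V" "square_dim ?d trans_op" by (auto simp: P_def \<rho>0_def E_def Eh_def V_def)
  have P_rho: "P * \<rho>0 = \<rho>0 * P"
    unfolding P_def \<rho>0_def using N even_opI[OF rho_dim rho(3)] by (intro parity_slice) auto
  have P_Eh: "P * Eh = Eh * P" unfolding P_def Eh_def by (rule parity_expiSt_half)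
  have Eh_Eh: "Eh * Eh = E" unfolding E_def Eh_def by (rule expiSt_half_square)
  have V_rho: "V * \<rho>0 = \<rho>0 * V" unfolding V_def \<rho>0_def by (rule Vop_slice_zero)
  have V_P: "V * P = P * V" unfolding V_def P_def Vop_evos by (rule parity_evos[symmetric])
  \<comment> \<open>Cyclicity brings the rightmost \<open>V\<close> to the front; it passes
    \<open>P\<close> and \<open>\<rho>0\<close> and cancels against its adjoint. What remains is the
    pure translation with parity, independent of the Hamiltonian.\<close>
  have norm: "mtrace (P * \<rho>0 * E) = mtrace \<rho>"
  proof -
    have "P * \<rho>0 * E = (P * \<rho>0 * mat_adjoint V * trans_op) * V"
      by (simp add: E_def expiSt_eq mat_assoc flip: V_def)
    then have "mtrace (P * \<rho>0 * E) = mtrace (V * (P * \<rho>0 * mat_adjoint V * trans_op))"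
      by (simp add: mtrace_comm[of _ ?d V])
    also have "V * (P * \<rho>0 * mat_adjoint V * trans_op) = (V * P) * (\<rho>0 * (mat_adjoint V * trans_op))"
      by (simp add: mat_assoc)
    also have "\<dots> = P * ((V * \<rho>0) * (mat_adjoint V * trans_op))"
      unfolding V_P by (simp add: mat_assoc)
    also have "\<dots> = P * (\<rho>0 * ((V * mat_adjoint V) * trans_op))"
      unfolding V_rho by (simp add: mat_assoc)
    also have "\<dots> = P * (\<rho>0 * trans_op)"
      unfolding V_def Vop_unitary by simp
    also have "mtrace \<dots> = mtrace (\<rho>0 * (trans_op * P))"
      by (subst mtrace_comm[of _ ?d]) (auto simp: mat_assoc)
    also have "\<dots> = mtrace \<rho>"
      unfolding \<rho>0_def P_def by (rule trace_slice_trans_parity[OF L rho_dim])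
    finally show ?thesis .
  qed
  \<comment> \<open>The left-hand order is the one delivered by bra and ket, with \<open>X\<close>
    and \<open>\<rho>0\<close> separating the two halves. Moving the last \<open>Eh\<close>
    cyclically to the front and past \<open>P\<close> brings them together; a second cyclic move
    puts \<open>\<rho>0\<close> next to \<open>P\<close>.\<close>
  have cyc: "mtrace (P * Eh * X * \<rho>0 * Eh) = mtrace (P * \<rho>0 * E * X)" if [simp]: "square_dim ?d X" for X
  proof -
    have "mtrace (P * Eh * X * \<rho>0 * Eh) = mtrace (Eh * (P * Eh * X * \<rho>0))"
      by (rule mtrace_comm[of _ ?d]) auto
    also have "Eh * (P * Eh * X * \<rho>0) = (Eh * P) * (Eh * X * \<rho>0)"
      by (simp add: mat_assoc)
    also have "\<dots> = P * (Eh * Eh) * X * \<rho>0"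
      unfolding P_Eh[symmetric] by (simp add: mat_assoc)
    also have "mtrace \<dots> = mtrace (\<rho>0 * (P * (Eh * Eh) * X))"
      by (rule mtrace_comm[of _ ?d]) auto
    also have "\<rho>0 * (P * (Eh * Eh) * X) = (\<rho>0 * P) * (E * X)"
      unfolding Eh_Eh by (simp add: mat_assoc)
    also have "\<dots> = P * \<rho>0 * E * X"
      unfolding P_rho[symmetric] by (simp add: mat_assoc)
    finally show ?thesis .
  qed
  let ?\<Psi> = "PsiK L N \<epsilon> H \<rho>" and ?\<Psi>' = "PsibarK L N \<epsilon> H" and ?\<Phi> = "PhiPlus L N"
  let ?D = "fdim (2 * N * L)"
  have \<Psi>: "?\<Psi> = (toK L N \<rho>0 * toK L N Eh) *\<^sub>v ?\<Phi>" and \<Psi>': "?\<Psi>' = mat_adjoint (toK L N P * toK L N Eh) *\<^sub>v ?\<Phi>"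
    by (simp_all add: PsiK_def PsibarK_def \<rho>0_def Eh_def P_def)
  have [simp]: "dim_vec ?\<Psi> = ?D" "dim_vec ?\<Psi>' = ?D" by (simp_all add: \<Psi> \<Psi>')
  \<comment> \<open>The adjoint in the bra moves back onto the ket side, so that a single system
    operator stands between two copies of \<Phi>^+. The case of the identity gives the
    normalisation.\<close>
  have expect: "braket ?\<Psi>' (toK L N X *\<^sub>v ?\<Psi>) = mtrace (P * \<rho>0 * E * X)" if [simp]: "square_dim ?d X" for X
  proof -
    have "braket ?\<Psi>' (toK L N X *\<^sub>v ?\<Psi>) =
        braket ?\<Phi> ((toK L N P * toK L N Eh) *\<^sub>v (toK L N X *\<^sub>v ((toK L N \<rho>0 * toK L N Eh) *\<^sub>v ?\<Phi>)))"
      unfolding \<Psi> \<Psi>' by (rule braket_adjoint[of _ ?D]) auto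
    also have "(toK L N P * toK L N Eh) *\<^sub>v (toK L N X *\<^sub>v ((toK L N \<rho>0 * toK L N Eh) *\<^sub>v ?\<Phi>)) =
        toK L N (P * Eh * X * \<rho>0 * Eh) *\<^sub>v ?\<Phi>"
      by (simp add: toK_mult mat_vec_assoc)
    also have "braket ?\<Phi> \<dots> = mtrace (P * Eh * X * \<rho>0 * Eh)"
      by (rule braket_PhiPlus_toK) simp
    finally show ?thesis by (simp add: cyc)
  qed
  have bk: "braket ?\<Psi>' ?\<Psi> = mtrace (P * \<rho>0 * E)"
    using expect[of "1\<^sub>m ?d"] by (simp add: toK_one one_mat_vec)
  \<comment> \<open>The overlap equals the trace of the density operator, which is positive by
    hypothesis.\<close>
  have nz: "braket ?\<Psi>' ?\<Psi> \<noteq> 0" using rho(2) by (simp add: bk norm)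
  have RR: "Rop L N \<epsilon> H \<rho> * Rop L N \<epsilon> H \<rho> = Rop L N \<epsilon> H \<rho>"
    using nz by (simp add: Rop_def mat_distribs ketbra_mult_ketbra[of _ ?D])
  have Tr: "mtrace (Rop L N \<epsilon> H \<rho> * A) = braket ?\<Psi>' (A *\<^sub>v ?\<Psi>) / braket ?\<Psi>' ?\<Psi>" if "square_dim ?D A" for A
  proof -
    have "mtrace (c \<cdot>\<^sub>m B) = c * mtrace B" if "square_dim ?D B" for c B
      using that by (simp add: mtrace_def sum_distrib_left)
    then show ?thesis using that by (simp add: Rop_def mat_distribs mtrace_ketbra_mult[of _ ?D])
  qed
  \<comment> \<open>The trace formula with the identity as observable: numerator and denominator
    coincide.\<close>
  have Tr1: "mtrace (Rop L N \<epsilon> H \<rho>) = 1"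
    using Tr[of "1\<^sub>m ?D"] nz by (simp add: Rop_def one_mat_vec)
  let ?O = "mprod ?d (map (\<lambda>t. slice L N t (Obs t)) [0..<N])"
  have O: "mprod ?D (map (\<lambda>t. toK L N (slice L N t (Obs t))) [0..<N]) = toK L N ?O"
    by (rule toK_mprod) auto
  have "mtrace (Rop L N \<epsilon> H \<rho> * toK L N ?O) = mtrace (P * \<rho>0 * E * ?O) / mtrace (P * \<rho>0 * E)"
    by (subst Tr, simp, subst expect) (auto simp: bk)
  then show ?thesis
    using nz RR Tr1 by (simp add: O P_def \<rho>0_def E_def)
qed

end
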